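(* Let $\mathcal S(\mathbb Z_{27})$ denote the set of determinants of $27\times 27$ circulant matrices with integer entries. Then $\mathcal S(\mathbb Z_{27})$ consists exactly of: the integers coprime to $3$; all multiples of $3^6$; and the following integers: (a) the elements of $\mathcal S(\mathbb Z_{27})$ exactly divisible by $3^4$ are precisely the integers $3^4mq$ with $3\nmid m$ and $q\equiv 1\pmod 9$ a Type 1 prime; (b) the elements of $\mathcal S(\mathbb Z_{27})$ exactly divisible by $3^5$ are precisely the integers $3^5mq$ with $3\nmid m$, where either $q\equiv 1\pmod 3$ is a Type 1 prime or $q\equiv 1 \pmod 9$ is a Type 3 prime.
   Context: For $k\geq1$ let $\omega_k=e^{2\pi i/3^k}$ and for $F\in\mathbb Z[x]$ let $N_k(F)=\prod_{1\leq j\leq 3^k,\ 3\nmid j}F(\omega_k^j)$. A prime $q\equiv 1\pmod 3$ is Type 1 if there are integers $A,B$ with $3\nmid A$ and $q=N_1(\delta+3A(x-1)+9B)$, where $\delta=1,2,4$ according as $q\equiv 1,4,7\pmod 9$. A prime $q\equiv 1\pmod 9$ is Type 3 if $q=N_2(1+(x-1)^7h(x))$ for some $h\in\mathbb Z[x]$ with $3\nmid h(1)$. The determinant of the circulant matrix with first row $(a_0,\dots,a_{n-1})$ equals $\prod_{z^n=1}F(z)$ with $F(x)=\sum a_jx^j$. *)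

theory Defs
  imports "HOL-Analysis.Analysis" "HOL-Library.Numeral_Type" "HOL-Computational_Algebra.Polynomial"
begin

definition circulant27 :: "(27 \<Rightarrow> int) \<Rightarrow> int^27^27" where
  "circulant27 a = (\<chi> i j. a (j - i))"

definition S27 :: "int set" where
  "S27 = {det (circulant27 a) | a. True}"

definition omega :: "nat \<Rightarrow> complex" where
  "omega k = cis (2 * pi / 3 ^ k)"

definition Nk :: "nat \<Rightarrow> int poly \<Rightarrow> complex" where
  "Nk k F = (\<Prod>j\<in>{j\<in>{1..3^k}. \<not> 3 dvd j}. poly (map_poly of_int F) (omega k ^ j))"

definition delta :: "int \<Rightarrow> int" where
  "delta q = (if q mod 9 = 1 then 1 else if q mod 9 = 4 then 2 else 4)"

definition type1 :: "int \<Rightarrow> bool" where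
  "type1 q \<longleftrightarrow> prime q \<and> q mod 3 = 1 \<and>
     (\<exists>A B :: int. \<not> 3 dvd A \<and>
        of_int q = Nk 1 ([:delta q:] + smult (3 * A) [:-1, 1:] + [:9 * B:]))"

definition type3 :: "int \<Rightarrow> bool" where
  "type3 q \<longleftrightarrow> prime q \<and> q mod 9 = 1 \<and>
     (\<exists>h :: int poly. \<not> 3 dvd poly h 1 \<and>
        of_int q = Nk 2 (1 + [:-1, 1:] ^ 7 * h))"

end

(*
Write D(F) for the product of F over the 27th roots of unity; it factors as F(1) N_1(F) N_2(F) N_3(F).
If T F is the integer polynomial with (T F)(x^3) = F(x) F(w x) F(w^2 x), w = omega_1, then
N_{k+1}(F) = N_k(T F), so everything happens in Z[w] and in Z[zeta], zeta = omega_2.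

If 3 divides D(F) but 3^6 does not, each F(omega_k) is omega_k - 1 times an element prime to 3.  The
congruence T F = F mod 3 compares F and T F at zeta, and F at w with the norm of F(zeta) to Z[w], modulo
small powers of 3.  Call an element a trivial if it agrees with (root of unity) * conj(a) modulo 9 in Z[w], or
modulo (zeta - 1)^8 in Z[zeta].  The comparison shows that two of these elements cannot both be trivial.
Triviality is multiplicative, and Z[w], Z[zeta] are norm-Euclidean, so a nontrivial element has a
nontrivial prime factor.  In Z[zeta] primes over q = 2 mod 3 are associated to their conjugates, hence
trivial, and primes over q = 4, 7 mod 9 come from Z[w].  Nontrivial primes of Z[w] are those over primes of
type 1; a prime of Z[zeta] of degree 1 that is nontrivial but has trivial norm to Z[w] has, up to a unit, the
form 1 + (zeta - 1)^7 h, which is type 3.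

Conversely, D((x - 1) + (1 + x^9 + x^18) K) depends only on K modulo x^9 - 1, and the values of K at 1, w,
zeta can be prescribed up to congruences; units and Galois conjugates move a given prime into the
required class modulo (zeta - 1)^8.
*)
theory Submission
  imports Defs "HOL-Number_Theory.Number_Theory"
begin

section \<open>Norm-Euclidean domains\<close>

text \<open>Write \<lambda> for zeta - 1. The moduli come from conjugation, which sends 1 +
  \<lambda>^k h to 1 + (-1)^k \<lambda>^k h modulo \<lambda>^(k+1). From level 4 on no root of unity
  interferes, so a trivial element cannot sit at an odd level: below \<lambda>^8 the obstructions
  are levels 5 and 7. The norm to Z[w] modulo 9 sees level 5 and is blind to level 7, whence the
  exponent 7 in type 3. Put F(1) = 3 a, F(w) = (w - 1) \<alpha>, F(zeta) = \<lambda> \<beta>, (T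
  F)(zeta) = \<lambda> \<beta>' and T F = F + 3 H. Then D(F) = 3^4 a N(\<alpha>) N(\<beta>)
  N(\<beta>'), \<beta>' - \<beta> = (3 / \<lambda>) H(zeta), and H(1) = -a modulo 3. If 3 does not
  divide a, this difference has level exactly 5, and the norms of \<beta> and \<beta>' to Z[w]
  cannot both be trivial. If 3 divides a exactly once, the difference is a multiple of 3 and the
  conflict moves to the coefficient of (x - 1)^2 in H: triviality in Z[w] makes it nonzero modulo 3,
  triviality in Z[zeta] makes it zero.\<close>

locale norm_euclidean =
  fixes sz :: "'a::idom \<Rightarrow> nat"
  assumes sz_mult: "sz (x * y) = sz x * sz y"
    and sz_eq_0: "sz x = 0 \<longleftrightarrow> x = 0"
    and sz_eq_1: "sz x = 1 \<longleftrightarrow> x dvd 1"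
    and sz_rem: "b \<noteq> 0 \<Longrightarrow> \<exists>q. sz (a - q * b) < sz b"
begin

lemma bezout:
  fixes a b :: 'a
  shows "\<exists>g u v. g = u * a + v * b \<and> g dvd a \<and> g dvd b"
proof (cases "a = 0 \<and> b = 0")
  case False
  define P where "P n \<longleftrightarrow> (\<exists>u v. u * a + v * b \<noteq> 0 \<and> n = sz (u * a + v * b))" for n
  have "\<exists>n. P n"
  proof (cases "a = 0")
    case True
    then have "P (sz (0 * a + 1 * b))" using False unfolding P_def by (metis mult_zero_left add_0 mult_1)
    then show ?thesis by blast
  next
    case False
    then have "P (sz (1 * a + 0 * b))" unfolding P_def by (metis mult_zero_left add_0_right mult_1)
    then show ?thesis by blast
  qed
  then have least: "P (LEAST n. P n)" by (rule LeastI_ex)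
  then obtain u v where uv: "u * a + v * b \<noteq> 0" "(LEAST n. P n) = sz (u * a + v * b)"
    unfolding P_def by blast
  define g where "g = u * a + v * b"
  have dvd: "g dvd s * a + t * b" for s t
  proof -
    obtain q where q: "sz (s * a + t * b - q * g) < sz g"
      using sz_rem uv(1) g_def by blast
    have eq: "s * a + t * b - q * g = (s - q * u) * a + (t - q * v) * b"
      by (simp add: g_def algebra_simps)
    have "s * a + t * b - q * g = 0"
    proof (rule ccontr)
      assume "s * a + t * b - q * g \<noteq> 0"
      then have "P (sz (s * a + t * b - q * g))"
        unfolding P_def eq by blast
      then have "(LEAST n. P n) \<le> sz (s * a + t * b - q * g)" by (rule Least_le)
      with q uv g_def show False by simp
    qed
    then show ?thesis by (metis dvd_triv_right eq_iff_diff_eq_0)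
  qed
  have "g dvd a" using dvd[of 1 0] by simp
  moreover have "g dvd b" using dvd[of 0 1] by simp
  ultimately show ?thesis using g_def by blast
qed (intro exI[of _ 0], simp)

lemma prime_elem_if_irreducible:
  fixes p :: 'a
  assumes "irreducible p"
  shows "prime_elem p"
proof (rule prime_elemI)
  show "p \<noteq> 0" "\<not> p dvd 1" using assms by (auto simp: irreducible_def)
  fix a b assume ab: "p dvd a * b"
  show "p dvd a \<or> p dvd b"
  proof (cases "p dvd a")
    case False
    obtain g u v where g: "g = u * p + v * a" "g dvd p" "g dvd a" using bezout by blast
    then obtain k where k: "p = g * k" by (auto elim: dvdE)
    then have "g dvd 1 \<or> k dvd 1" using assms by (auto simp: irreducible_def)
    moreover have "\<not> k dvd 1"
    proof
      assume "k dvd 1"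
      then obtain k' where "1 = k * k'" by (auto elim: dvdE)
      then have "g = p * k'" using k by (metis mult.assoc mult.right_neutral)
      then show False using g(3) False by (metis dvd_mult_left)
    qed
    ultimately obtain g' where g': "1 = g * g'" by (auto elim: dvdE)
    have "b = g * g' * b" using g' by simp
    also have "\<dots> = p * (u * g' * b) + (a * b) * (v * g')" by (simp add: g(1) algebra_simps)
    finally have "p dvd b" using ab by (metis dvd_add dvd_mult2 dvd_triv_left)
    then show ?thesis ..
  qed simp
qed

text \<open>A predicate that holds for units and is stable under products can fail only if it fails
  at some prime factor. It is applied to units, to trivial elements and to elements of trivial
  norm.\<close>

lemma irreducible_factor:
  fixes b :: 'a
  assumes "b \<noteq> 0" and "\<not> P b"
    and unit: "\<And>u. u dvd 1 \<Longrightarrow> P u"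
    and mult: "\<And>x y. P x \<Longrightarrow> P y \<Longrightarrow> P (x * y)"
  shows "\<exists>p. prime_elem p \<and> p dvd b \<and> \<not> P p"
  using assms(1,2)
proof (induction "sz b" arbitrary: b rule: less_induct)
  case less
  show ?case
  proof (cases "irreducible b")
    case True
    then have "prime_elem b" by (rule prime_elem_if_irreducible)
    then show ?thesis using less.prems(2) by (intro exI[of _ b]) simp
  next
    case False
    have "\<not> b dvd 1" using less.prems(2) unit[of b] by argo
    with False less.prems(1) obtain x y where xy: "b = x * y" "\<not> x dvd 1" "\<not> y dvd 1"
      unfolding irreducible_def by metis
    have "x \<noteq> 0" "y \<noteq> 0" using xy less.prems by auto
    then have "sz x \<ge> 2" "sz y \<ge> 2"
      using xy sz_eq_0[of x] sz_eq_1[of x] sz_eq_0[of y] sz_eq_1[of y] by linarith+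
    then have lt: "sz x < sz b" "sz y < sz b" unfolding xy sz_mult by auto
    have "\<not> P x \<or> \<not> P y" using less.prems(2) mult[of x y] unfolding xy(1) by argo
    then show ?thesis
    proof
      assume "\<not> P x"
      from less.hyps[OF lt(1) \<open>x \<noteq> 0\<close> this] show ?thesis unfolding xy(1) by (metis dvd_mult2)
    next
      assume "\<not> P y"
      from less.hyps[OF lt(2) \<open>y \<noteq> 0\<close> this] show ?thesis unfolding xy(1) by (metis dvd_mult)
    qed
  qed
qed

lemma prime_factor:
  fixes b :: 'a
  assumes "b \<noteq> 0" and "\<not> b dvd 1"
  shows "\<exists>p. prime_elem p \<and> p dvd b"
proof -
  have "x * y dvd 1" if "x dvd 1" "y dvd 1" for x y :: 'a
    using mult_dvd_mono[OF that] by simp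
  then show ?thesis using irreducible_factor[of b "\<lambda>x. x dvd 1"] assms by blast
qed

end

section \<open>The Eisenstein integers\<close>

text \<open>\<open>Eis a b\<close> stands for a + b w with w^2 = - 1 - w.\<close>

datatype eis = Eis (e0: int) (e1: int)

instantiation eis :: comm_ring_1
begin

definition "0 = Eis 0 0"
definition "1 = Eis 1 0"
definition "x + y = Eis (e0 x + e0 y) (e1 x + e1 y)"
definition "x - y = Eis (e0 x - e0 y) (e1 x - e1 y)"
definition "- x = Eis (- e0 x) (- e1 x)"
definition "x * y = Eis (e0 x * e0 y - e1 x * e1 y) (e0 x * e1 y + e1 x * e0 y - e1 x * e1 y)"

instance
  by standard
    (simp_all add: zero_eis_def one_eis_def plus_eis_def minus_eis_def uminus_eis_def
      times_eis_def algebra_simps eis.expand)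

end

lemma eis_sel [simp]:
  "e0 0 = 0" "e1 0 = 0" "e0 1 = 1" "e1 1 = 0"
  "e0 (x + y) = e0 x + e0 y" "e1 (x + y) = e1 x + e1 y"
  "e0 (x - y) = e0 x - e0 y" "e1 (x - y) = e1 x - e1 y"
  "e0 (- x) = - e0 x" "e1 (- x) = - e1 x"
  "e0 (x * y) = e0 x * e0 y - e1 x * e1 y"
  "e1 (x * y) = e0 x * e1 y + e1 x * e0 y - e1 x * e1 y"
  by (simp_all add: zero_eis_def one_eis_def plus_eis_def minus_eis_def uminus_eis_def times_eis_def)

lemma eis_eq_iff: "x = y \<longleftrightarrow> e0 x = e0 y \<and> e1 x = e1 y"
  by (metis eis.expand)

lemma eis_of_nat [simp]: "e0 (of_nat n) = int n" "e1 (of_nat n) = 0"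
  by (induction n) auto

lemma eis_of_int [simp]: "e0 (of_int n) = n" "e1 (of_int n) = 0"
  by (cases n rule: int_cases2; simp)+

lemma eis_numeral [simp]: "e0 (numeral n) = numeral n" "e1 (numeral n) = 0"
  using eis_of_int[of "numeral n"] by simp_all

definition eom :: eis where "eom = Eis 0 1"
definition ecnj :: "eis \<Rightarrow> eis" where "ecnj x = Eis (e0 x - e1 x) (- e1 x)"
definition enorm :: "eis \<Rightarrow> int" where "enorm x = (e0 x)^2 - e0 x * e1 x + (e1 x)^2"
definition elam :: eis where "elam = eom - 1"

lemma eom_sel [simp]: "e0 eom = 0" "e1 eom = 1"
  by (simp_all add: eom_def)

lemma elam_sel [simp]: "e0 elam = -1" "e1 elam = 1"
  by (simp_all add: elam_def)

lemma ecnj_sel [simp]: "e0 (ecnj x) = e0 x - e1 x" "e1 (ecnj x) = - e1 x"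
  by (simp_all add: ecnj_def)

lemma eis_decomp: "x = of_int (e0 x) + of_int (e1 x) * eom"
  by (simp add: eis_eq_iff)

lemma eom_relation: "eom^2 + eom + 1 = 0"
  by (simp add: eis_eq_iff power2_eq_square)

lemma eom_mult: "eom * eom = - 1 - eom" "eom * (eom * x) = - x - eom * x"
  by (simp_all add: eis_eq_iff)

lemmas eom_norm = eom_mult algebra_simps power2_eq_square power3_eq_cube

lemma eom_cube [simp]: "eom^3 = 1"
  by (simp add: eis_eq_iff power3_eq_cube)

lemma ecnj_simps [simp]:
  "ecnj (x + y) = ecnj x + ecnj y" "ecnj (x - y) = ecnj x - ecnj y" "ecnj (- x) = - ecnj x"
  "ecnj (x * y) = ecnj x * ecnj y" "ecnj 0 = 0" "ecnj 1 = 1" "ecnj (of_int n) = of_int n"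
  "ecnj (numeral k) = numeral k" "ecnj (ecnj x) = x" "ecnj eom = eom^2"
  by (simp_all add: eis_eq_iff algebra_simps power2_eq_square)

lemma ecnj_power [simp]: "ecnj (x ^ n) = ecnj x ^ n"
  by (induction n) auto

lemma enorm_mult: "enorm (x * y) = enorm x * enorm y"
  by (simp add: enorm_def power2_eq_square algebra_simps)

lemma mult_ecnj: "x * ecnj x = of_int (enorm x)"
  by (simp add: eis_eq_iff enorm_def power2_eq_square algebra_simps)

lemma enorm_simps [simp]: "enorm 0 = 0" "enorm 1 = 1" "enorm (ecnj x) = enorm x"
  "enorm (- x) = enorm x" "enorm (of_int n) = n^2" "enorm eom = 1" "enorm elam = 3"
  by (simp_all add: enorm_def power2_eq_square algebra_simps)

lemma enorm_numeral [simp]: "enorm (numeral k) = (numeral k)^2"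
  using enorm_simps(5)[of "numeral k"] by simp

lemma enorm_power: "enorm (x ^ n) = enorm x ^ n"
  by (induction n) (auto simp: enorm_mult)

lemma enorm_4: "4 * enorm x = (2 * e0 x - e1 x)^2 + 3 * (e1 x)^2"
  by (simp add: enorm_def power2_eq_square algebra_simps)

lemma enorm_nonneg [simp]: "enorm x \<ge> 0"
  using enorm_4[of x] by (smt (verit) zero_le_power2)

lemma enorm_eq_0 [simp]: "enorm x = 0 \<longleftrightarrow> x = 0"
proof
  assume "enorm x = 0"
  then have *: "(2 * e0 x - e1 x)^2 + 3 * (e1 x)^2 = 0" using enorm_4[of x] by simp
  then have "(e1 x)^2 = 0" by (smt (verit) zero_le_power2)
  with * show "x = 0" by (simp add: eis_eq_iff)
qed simp

instance eis :: idom
proof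
  fix a b :: eis assume "a \<noteq> 0" "b \<noteq> 0"
  then show "a * b \<noteq> 0" by (metis enorm_eq_0 enorm_mult mult_eq_0_iff)
qed

lemma eis_unit_iff: "x dvd 1 \<longleftrightarrow> enorm x = 1"
proof
  assume "x dvd 1"
  then obtain y where "1 = x * y" by (auto elim: dvdE)
  then have "enorm x * enorm y = 1" by (metis enorm_mult enorm_simps(2))
  then show "enorm x = 1" by (metis enorm_nonneg zmult_eq_1_iff abs_of_nonneg zdvd1_eq dvd_triv_left)
next
  assume "enorm x = 1"
  then have "x * ecnj x = 1" using mult_ecnj[of x] by simp
  then show "x dvd 1" by (metis dvd_triv_left)
qed

lemma eis_of_int_dvd: "of_int n dvd x \<longleftrightarrow> n dvd e0 x \<and> n dvd e1 x"
proof
  assume "n dvd e0 x \<and> n dvd e1 x"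
  then obtain a b where "e0 x = n * a" "e1 x = n * b" by (auto elim!: dvdE)
  then have "x = of_int n * Eis a b" by (simp add: eis_eq_iff)
  then show "of_int n dvd x" by simp
qed (auto elim!: dvdE)

lemma eis_numeral_dvd: "numeral n dvd x \<longleftrightarrow> numeral n dvd e0 x \<and> numeral n dvd e1 x"
  using eis_of_int_dvd[of "numeral n" x] by simp

lemma elam_dvd: "elam dvd x \<longleftrightarrow> 3 dvd e0 x + e1 x"
proof
  assume "elam dvd x"
  then obtain y where "x = elam * y" by (auto elim: dvdE)
  then have "e0 x + e1 x = 3 * (- e1 y)" by simp
  then show "3 dvd e0 x + e1 x" by (metis dvd_triv_left)
next
  assume "3 dvd e0 x + e1 x"
  then obtain k where "e0 x + e1 x = 3 * k" by (auto elim: dvdE)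
  then have "x = elam * Eis (k - e0 x) (-k)" by (simp add: eis_eq_iff)
  then show "elam dvd x" by (metis dvd_triv_left)
qed

lemma enorm_mod_3: "3 dvd enorm x - (e0 x + e1 x)^2"
proof -
  have "enorm x - (e0 x + e1 x)^2 = 3 * (- e0 x * e1 x)"
    by (simp add: enorm_def power2_eq_square algebra_simps)
  then show ?thesis by simp
qed

section \<open>The ring of integers of the ninth cyclotomic field\<close>

text \<open>\<open>Cyc a b c\<close> stands for \<open>a + b \<zeta> + c \<zeta>\<^sup>2\<close> with \<open>\<zeta>\<^sup>3 = \<omega>\<close>, where \<open>\<omega>\<close> is \<open>eom\<close>.\<close>

datatype cyc = Cyc (c0: eis) (c1: eis) (c2: eis)

instantiation cyc :: comm_ring_1
begin

definition "0 = Cyc 0 0 0"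
definition "1 = Cyc 1 0 0"
definition "x + y = Cyc (c0 x + c0 y) (c1 x + c1 y) (c2 x + c2 y)"
definition "x - y = Cyc (c0 x - c0 y) (c1 x - c1 y) (c2 x - c2 y)"
definition "- x = Cyc (- c0 x) (- c1 x) (- c2 x)"
definition "x * y = Cyc (c0 x * c0 y + eom * (c1 x * c2 y + c2 x * c1 y))
  (c0 x * c1 y + c1 x * c0 y + eom * (c2 x * c2 y)) (c0 x * c2 y + c1 x * c1 y + c2 x * c0 y)"

instance
  by standard
    (simp_all add: zero_cyc_def one_cyc_def plus_cyc_def minus_cyc_def uminus_cyc_def
      times_cyc_def algebra_simps cyc.expand)

end

lemma cyc_sel [simp]:
  "c0 0 = 0" "c1 0 = 0" "c2 0 = 0" "c0 1 = 1" "c1 1 = 0" "c2 1 = 0"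
  "c0 (x + y) = c0 x + c0 y" "c1 (x + y) = c1 x + c1 y" "c2 (x + y) = c2 x + c2 y"
  "c0 (x - y) = c0 x - c0 y" "c1 (x - y) = c1 x - c1 y" "c2 (x - y) = c2 x - c2 y"
  "c0 (- x) = - c0 x" "c1 (- x) = - c1 x" "c2 (- x) = - c2 x"
  "c0 (x * y) = c0 x * c0 y + eom * (c1 x * c2 y + c2 x * c1 y)"
  "c1 (x * y) = c0 x * c1 y + c1 x * c0 y + eom * (c2 x * c2 y)"
  "c2 (x * y) = c0 x * c2 y + c1 x * c1 y + c2 x * c0 y"
  by (simp_all add: zero_cyc_def one_cyc_def plus_cyc_def minus_cyc_def uminus_cyc_def times_cyc_def)

lemma cyc_eq_iff: "x = y \<longleftrightarrow> c0 x = c0 y \<and> c1 x = c1 y \<and> c2 x = c2 y"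
  by (metis cyc.expand)

lemma cyc_of_nat [simp]: "c0 (of_nat n) = of_nat n" "c1 (of_nat n) = 0" "c2 (of_nat n) = 0"
  by (induction n) auto

lemma cyc_of_int [simp]: "c0 (of_int n) = of_int n" "c1 (of_int n) = 0" "c2 (of_int n) = 0"
  by (cases n rule: int_cases2; simp)+

lemma cyc_numeral [simp]: "c0 (numeral n) = numeral n" "c1 (numeral n) = 0" "c2 (numeral n) = 0"
  using cyc_of_int[of "numeral n"] by simp_all

text \<open>\<open>sig\<close> is the automorphism \<open>\<zeta> \<mapsto> \<omega> \<zeta>\<close>, \<open>ccnj\<close> is complex conjugation
  (\<open>\<zeta>\<^sup>-\<^sup>1 = \<omega>\<^sup>2 \<zeta>\<^sup>2\<close>), and \<open>cN\<close> is the norm to the Eisenstein integers.\<close>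

definition zet :: cyc where "zet = Cyc 0 1 0"
definition emb :: "eis \<Rightarrow> cyc" where "emb a = Cyc a 0 0"
definition sig :: "cyc \<Rightarrow> cyc" where "sig x = Cyc (c0 x) (eom * c1 x) (eom^2 * c2 x)"
definition ccnj :: "cyc \<Rightarrow> cyc" where
  "ccnj x = Cyc (ecnj (c0 x)) (eom^2 * ecnj (c2 x)) (eom^2 * ecnj (c1 x))"
definition cN :: "cyc \<Rightarrow> eis" where
  "cN x = c0 x^3 + eom * c1 x^3 + eom^2 * c2 x^3 - 3 * eom * c0 x * c1 x * c2 x"
definition cnorm :: "cyc \<Rightarrow> int" where "cnorm x = enorm (cN x)"
definition lam :: cyc where "lam = zet - 1"

lemma zet_sel [simp]: "c0 zet = 0" "c1 zet = 1" "c2 zet = 0"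
  by (simp_all add: zet_def)

lemma lam_sel [simp]: "c0 lam = -1" "c1 lam = 1" "c2 lam = 0"
  by (simp_all add: lam_def)

lemma emb_sel [simp]: "c0 (emb a) = a" "c1 (emb a) = 0" "c2 (emb a) = 0"
  by (simp_all add: emb_def)

lemma sig_sel [simp]: "c0 (sig x) = c0 x" "c1 (sig x) = eom * c1 x" "c2 (sig x) = eom^2 * c2 x"
  by (simp_all add: sig_def)

lemma ccnj_sel [simp]: "c0 (ccnj x) = ecnj (c0 x)" "c1 (ccnj x) = eom^2 * ecnj (c2 x)"
  "c2 (ccnj x) = eom^2 * ecnj (c1 x)"
  by (simp_all add: ccnj_def)

lemma cyc_decomp: "x = emb (c0 x) + emb (c1 x) * zet + emb (c2 x) * zet^2"
  by (simp add: cyc_eq_iff power2_eq_square)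

lemma emb_simps [simp]:
  "emb (x + y) = emb x + emb y" "emb (x - y) = emb x - emb y" "emb (- x) = - emb x"
  "emb (x * y) = emb x * emb y" "emb 0 = 0" "emb 1 = 1" "emb (of_int n) = of_int n"
  "emb (numeral k) = numeral k"
  by (simp_all add: cyc_eq_iff)

lemma emb_power [simp]: "emb (x ^ n) = emb x ^ n"
  by (induction n) auto

lemma emb_eq_iff [simp]: "emb x = emb y \<longleftrightarrow> x = y"
  by (simp add: cyc_eq_iff)

lemma zet_cube: "zet^3 = emb eom"
  by (simp add: cyc_eq_iff power3_eq_cube)

lemma zet_nine: "zet^9 = 1"
proof -
  have "zet^9 = (zet^3)^3" by (simp flip: power_mult)
  also have "\<dots> = emb (eom^3)" by (simp add: zet_cube del: eom_cube)
  finally show ?thesis by simp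
qed

lemma sig_simps [simp]:
  "sig (x + y) = sig x + sig y" "sig (x - y) = sig x - sig y" "sig (- x) = - sig x"
  "sig (x * y) = sig x * sig y" "sig 0 = 0" "sig 1 = 1" "sig (of_int n) = of_int n"
  "sig (numeral k) = numeral k" "sig (emb a) = emb a" "sig zet = emb eom * zet"
proof -
  show "sig (x * y) = sig x * sig y"
    unfolding cyc_eq_iff by (simp add: eom_norm)
qed (simp_all add: cyc_eq_iff eom_norm)

lemma sig_power [simp]: "sig (x ^ n) = sig x ^ n"
  by (induction n) auto

lemma sig3 [simp]: "sig (sig (sig x)) = x"
proof -
  show ?thesis unfolding cyc_eq_iff by (simp add: eom_norm)
qed

lemma ccnj_simps [simp]:
  "ccnj (x + y) = ccnj x + ccnj y" "ccnj (x - y) = ccnj x - ccnj y" "ccnj (- x) = - ccnj x"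
  "ccnj (x * y) = ccnj x * ccnj y" "ccnj 0 = 0" "ccnj 1 = 1" "ccnj (of_int n) = of_int n"
  "ccnj (numeral k) = numeral k" "ccnj (emb a) = emb (ecnj a)" "ccnj zet = zet^8" "ccnj (ccnj x) = x"
proof -
  show "ccnj (x * y) = ccnj x * ccnj y"
    unfolding cyc_eq_iff by (simp add: eom_norm)
  show "ccnj (ccnj x) = x"
    unfolding cyc_eq_iff by (simp add: eom_norm)
  have "zet^8 = zet^3 * zet^3 * zet^2" by (simp flip: power_add)
  then show "ccnj zet = zet^8"
    by (simp add: zet_cube cyc_eq_iff power2_eq_square)
qed (simp_all add: cyc_eq_iff eom_norm)

lemma ccnj_power [simp]: "ccnj (x ^ n) = ccnj x ^ n"
  by (induction n) auto

lemma ccnj_zet: "zet * ccnj zet = 1"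
proof -
  have "zet * zet^8 = zet^9" by (simp flip: power_Suc)
  then show ?thesis by (simp add: zet_nine)
qed

lemma emb_cN: "emb (cN x) = x * sig x * sig (sig x)"
proof -
  show ?thesis unfolding cyc_eq_iff cN_def by (simp add: eom_norm)
qed

lemma cN_mult: "cN (x * y) = cN x * cN y"
proof -
  have "emb (cN (x * y)) = emb (cN x * cN y)"
    by (simp add: emb_cN)
  then show ?thesis unfolding emb_eq_iff .
qed

lemma cN_simps [simp]: "cN 0 = 0" "cN 1 = 1" "cN (sig x) = cN x" "cN (- x) = - cN x"
  "cN (emb a) = a^3" "cN zet = eom" "cN (of_int n) = of_int n ^ 3" "cN (numeral k) = numeral k ^ 3"
proof -
  show "cN (sig x) = cN x"
  proof -
    have "emb (cN (sig x)) = emb (cN x)" by (simp only: emb_cN sig3 mult_ac)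
    then show ?thesis unfolding emb_eq_iff .
  qed
  show "cN (- x) = - cN x"
  proof -
    have "emb (cN (- x)) = emb (- cN x)" by (simp only: emb_cN emb_simps sig_simps) simp
    then show ?thesis unfolding emb_eq_iff .
  qed
qed (simp_all add: cN_def)

lemma cN_ccnj [simp]: "cN (ccnj x) = ecnj (cN x)"
proof -
  show ?thesis unfolding cN_def by (simp add: eom_norm)
qed

lemma cN_power: "cN (x ^ n) = cN x ^ n"
  by (induction n) (auto simp: cN_mult)

lemma cN_lam: "cN lam = elam"
  by (simp add: cN_def elam_def)

lemma cnorm_mult: "cnorm (x * y) = cnorm x * cnorm y"
  by (simp add: cnorm_def cN_mult enorm_mult)

lemma cnorm_power: "cnorm (x ^ n) = cnorm x ^ n"
  by (simp add: cnorm_def cN_power enorm_power)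

lemma cnorm_simps [simp]: "cnorm 0 = 0" "cnorm 1 = 1" "cnorm (sig x) = cnorm x" "cnorm (- x) = cnorm x"
  "cnorm (ccnj x) = cnorm x" "cnorm (emb a) = enorm a^3" "cnorm (of_int n) = n^6" "cnorm lam = 3"
  "cnorm zet = 1" "cnorm x \<ge> 0"
  by (simp_all add: cnorm_def cN_lam enorm_power)

lemma emb_dvd: "a dvd b \<Longrightarrow> emb a dvd emb b"
  by (auto elim!: dvdE)

lemma cyc_emb_dvd: "emb a dvd x \<longleftrightarrow> a dvd c0 x \<and> a dvd c1 x \<and> a dvd c2 x"
proof
  assume "a dvd c0 x \<and> a dvd c1 x \<and> a dvd c2 x"
  then obtain p q r where "c0 x = a * p" "c1 x = a * q" "c2 x = a * r" by (auto elim!: dvdE)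
  then have "x = emb a * Cyc p q r" by (simp add: cyc_eq_iff)
  then show "emb a dvd x" by simp
qed (auto elim!: dvdE)

lemma cyc_of_int_dvd: "of_int n dvd x \<longleftrightarrow> of_int n dvd c0 x \<and> of_int n dvd c1 x \<and> of_int n dvd c2 x"
  using cyc_emb_dvd[of "of_int n" x] by simp

lemma cyc_numeral_dvd:
  "numeral n dvd x \<longleftrightarrow> numeral n dvd c0 x \<and> numeral n dvd c1 x \<and> numeral n dvd c2 x"
  using cyc_emb_dvd[of "numeral n" x] by simp

lemma emb_dvd_iff [simp]: "emb a dvd emb b \<longleftrightarrow> a dvd b"
  by (simp add: cyc_emb_dvd)

subsection \<open>The prime above 3\<close>

text \<open>The coefficient sums stand for reduction to the residue field with three elements, where
  w and zeta become 1. They are multiplicative only modulo 3.\<close>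

definition eaug :: "eis \<Rightarrow> int" where "eaug x = e0 x + e1 x"
definition aug :: "cyc \<Rightarrow> int" where "aug x = eaug (c0 x) + eaug (c1 x) + eaug (c2 x)"

lemma eaug_simps [simp]: "eaug (x + y) = eaug x + eaug y" "eaug (x - y) = eaug x - eaug y"
  "eaug (- x) = - eaug x" "eaug 0 = 0" "eaug 1 = 1" "eaug (of_int n) = n" "eaug (numeral k) = numeral k"
  "eaug eom = 1"
  by (simp_all add: eaug_def)

lemma aug_simps [simp]: "aug (x + y) = aug x + aug y" "aug (x - y) = aug x - aug y"
  "aug (- x) = - aug x" "aug 0 = 0" "aug 1 = 1" "aug (of_int n) = n" "aug (numeral k) = numeral k"
  "aug zet = 1"
  by (simp_all add: aug_def)

lemma eaug_mult: "[eaug (x * y) = eaug x * eaug y] (mod 3)"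
proof -
  have "eaug (x * y) - eaug x * eaug y = 3 * (- (e1 x * e1 y))"
    by (simp add: eaug_def algebra_simps)
  then show ?thesis by (metis cong_iff_dvd_diff dvd_triv_left)
qed

lemma aug_mult: "[aug (x * y) = aug x * aug y] (mod 3)"
proof -
  have e: "[eaug (eom * x) = eaug x] (mod 3)" for x using eaug_mult[of eom x] by simp
  have "[aug (x * y) = (eaug (c0 x) * eaug (c0 y) + (eaug (c1 x) * eaug (c2 y) + eaug (c2 x) * eaug (c1 y)))
    + (eaug (c0 x) * eaug (c1 y) + eaug (c1 x) * eaug (c0 y) + eaug (c2 x) * eaug (c2 y))
    + (eaug (c0 x) * eaug (c2 y) + eaug (c1 x) * eaug (c1 y) + eaug (c2 x) * eaug (c0 y))] (mod 3)"
    unfolding aug_def cyc_sel eaug_simps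
    by (intro cong_add eaug_mult cong_trans[OF e]; simp; intro cong_add eaug_mult)
  then show ?thesis by (simp add: aug_def algebra_simps)
qed

lemma cyc_lam_quotient: "\<exists>y. x = of_int (aug x) + lam * y"
proof
  let ?a = "\<lambda>i. e0 (i x)" and ?b = "\<lambda>i. e1 (i x)"
  \<comment> \<open>Synthetic division by zeta - 1: in the basis 1, zeta, ..., zeta^5 the
    coefficients of the quotient are the tail sums of those of \<open>x\<close>.\<close>
  show "x = of_int (aug x) + lam *
    Cyc (Eis (?a c1 + ?a c2 + ?b c0 + ?b c1 + ?b c2) (?b c1 + ?b c2))
      (Eis (?a c2 + ?b c0 + ?b c1 + ?b c2) (?b c2)) (Eis (?b c0 + ?b c1 + ?b c2) 0)"
    by (simp add: cyc_eq_iff eis_eq_iff aug_def eaug_def)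
qed

text \<open>This is 3 / (zeta - 1): the factor 1 + zeta + zeta^2 is (w - 1) / (zeta - 1), and the
  conjugate of w - 1 is 3 / (w - 1).\<close>

definition nu :: cyc where "nu = emb (ecnj elam) * (1 + zet + zet^2)"

lemma lam_nu: "lam * nu = 3"
  by (simp add: nu_def cyc_eq_iff eis_eq_iff power2_eq_square)

lemma lam_dvd: "lam dvd x \<longleftrightarrow> 3 dvd aug x"
proof
  assume "lam dvd x"
  then obtain y where "x = lam * y" by (auto elim: dvdE)
  then have "aug x = 3 * (- e1 (c2 y))" by (simp add: aug_def eaug_def)
  then show "3 dvd aug x" by simp
next
  assume "3 dvd aug x"
  then obtain k where k: "aug x = 3 * k" by (auto elim: dvdE)
  obtain y where "x = of_int (aug x) + lam * y" using cyc_lam_quotient by blast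
  also have "of_int (aug x) = lam * (nu * of_int k)"
    by (simp add: k lam_nu mult.assoc[symmetric])
  finally have "x = lam * (nu * of_int k + y)" by (simp add: distrib_left)
  then show "lam dvd x" by (metis dvd_triv_left)
qed

lemma lam_dvd_mult: "lam dvd x * y \<longleftrightarrow> lam dvd x \<or> lam dvd y"
proof -
  have "3 dvd aug (x * y) \<longleftrightarrow> 3 dvd aug x * aug y"
    using aug_mult by (rule cong_dvd_iff)
  then show ?thesis
    by (simp add: lam_dvd prime_dvd_mult_iff)
qed

lemma cube_cong_3: "[a ^ 3 = a] (mod 3)" for a :: int
proof -
  have "a mod 3 = 0 \<or> a mod 3 = 1 \<or> a mod 3 = 2" by presburger
  moreover have "a ^ 3 mod 3 = (a mod 3) ^ 3 mod 3" by (simp add: power_mod)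
  ultimately show ?thesis unfolding cong_def by auto
qed

lemma eaug_cN: "[eaug (cN x) = aug x] (mod 3)"
proof -
  have c: "[eaug (a ^ 3) = eaug a] (mod 3)" for a
  proof -
    have "[eaug (a ^ 3) = eaug a * (eaug a * eaug a)] (mod 3)"
      unfolding power3_eq_cube mult.assoc
      by (rule cong_trans[OF eaug_mult] cong_mult cong_refl eaug_mult)+
    then show ?thesis using cube_cong_3[of "eaug a"] by (metis cong_trans mult.assoc power3_eq_cube)
  qed
  have o: "[eaug (eom * a) = eaug a] (mod 3)" for a using eaug_mult[of eom a] by simp
  have t: "[eaug (3 * a) = 0] (mod 3)" for a
    using eaug_mult[of 3 a] by (metis cong_mult_self_left cong_trans eaug_simps(7))
  have eq: "cN x = c0 x^3 + eom * c1 x^3 + eom * (eom * c2 x^3) - 3 * (eom * (c0 x * (c1 x * c2 x)))"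
    by (simp add: cN_def power2_eq_square mult.assoc)
  have "[eaug (cN x) = eaug (c0 x) + eaug (c1 x) + eaug (c2 x) - 0] (mod 3)"
    unfolding eq eaug_simps
    by (intro cong_add cong_diff t c cong_trans[OF o c] cong_trans[OF o cong_trans[OF o c]])
  then show ?thesis by (simp add: aug_def)
qed

lemma cnorm_mod_3: "[cnorm x = (aug x)^2] (mod 3)"
proof -
  have "[cnorm x = (eaug (cN x))^2] (mod 3)"
    using enorm_mod_3[of "cN x"] by (simp add: cnorm_def eaug_def cong_iff_dvd_diff)
  then show ?thesis using eaug_cN by (meson cong_pow cong_trans)
qed

lemma three_dvd_cnorm: "3 dvd cnorm x \<longleftrightarrow> lam dvd x"
proof -
  have "3 dvd cnorm x \<longleftrightarrow> 3 dvd (aug x)^2" using cnorm_mod_3 by (rule cong_dvd_iff)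
  then show ?thesis by (simp add: lam_dvd prime_dvd_power_iff)
qed

lemma three_dvd_lam_6: "3 dvd lam ^ 6"
proof -
  have "lam ^ 6 = (lam * lam) * (lam * lam) * (lam * lam)" by (simp add: eval_nat_numeral mult.assoc)
  then show ?thesis by (simp add: cyc_numeral_dvd eis_numeral_dvd)
qed

lemma cnorm_eq: "of_int (cnorm x) = x * (sig x * sig (sig x) * emb (ecnj (cN x)))"
proof -
  have "of_int (cnorm x) = emb (cN x * ecnj (cN x))" by (simp only: mult_ecnj cnorm_def emb_simps)
  then show ?thesis by (simp add: emb_cN mult.assoc)
qed

lemma cyc_dvd_cnorm: "x dvd of_int (cnorm x)"
  unfolding cnorm_eq by simp

text \<open>Here \<open>cyc\<close> is only known to be a commutative ring. Norm zero survives
  division by \<open>lam\<close>, whose norm is 3, so any power of \<open>lam\<close> can be split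
  off, and six of them contain 3. Dividing by 3 shrinks the coordinates, which gives
  \<open>cnorm_eq_0\<close> by descent and then the absence of zero divisors.\<close>

lemma cnorm_0_imp_3_dvd:
  assumes "cnorm x = 0" shows "3 dvd x"
proof -
  have "\<exists>y. x = lam ^ n * y \<and> cnorm y = 0" for n
  proof (induction n)
    case (Suc n)
    then obtain y where y: "x = lam ^ n * y" "cnorm y = 0" by blast
    then have "lam dvd y" using three_dvd_cnorm[of y] by simp
    then obtain z where z: "y = lam * z" by (auto elim: dvdE)
    then have "cnorm z = 0" using y(2) by (simp add: cnorm_mult)
    then show ?case using y(1) z by (metis mult.assoc power_Suc2)
  qed (use assms in simp)
  then show ?thesis using three_dvd_lam_6 by (metis dvd_mult2)
qed

lemma cnorm_eq_0 [simp]: "cnorm x = 0 \<longleftrightarrow> x = 0"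
proof
  define s where "s x = nat (enorm (c0 x) + enorm (c1 x) + enorm (c2 x))" for x
  assume "cnorm x = 0"
  then show "x = 0"
  proof (induction "s x" arbitrary: x rule: less_induct)
    case less
    obtain y where y: "x = 3 * y" using cnorm_0_imp_3_dvd[OF less.prems] by (auto elim: dvdE)
    have "cnorm (3::cyc) = 3^6" using cnorm_simps(7)[of 3] by simp
    then have y0: "cnorm y = 0" using less.prems by (simp add: y cnorm_mult)
    show ?case
    proof (rule ccontr)
      assume "x \<noteq> 0"
      then have "y \<noteq> 0" using y by auto
      have nn: "enorm (c0 y) \<ge> 0" "enorm (c1 y) \<ge> 0" "enorm (c2 y) \<ge> 0" by simp_all
      have "\<not> (enorm (c0 y) = 0 \<and> enorm (c1 y) = 0 \<and> enorm (c2 y) = 0)"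
        using \<open>y \<noteq> 0\<close> by (auto simp: cyc_eq_iff)
      with nn have pos: "enorm (c0 y) + enorm (c1 y) + enorm (c2 y) > 0" by linarith
      have "s x = nat (9 * (enorm (c0 y) + enorm (c1 y) + enorm (c2 y)))"
        by (simp add: s_def y enorm_mult)
      then have "s y < s x" using pos by (simp add: s_def)
      from less.hyps[OF this y0] \<open>y \<noteq> 0\<close> show False by simp
    qed
  qed
qed simp

instance cyc :: idom
proof
  fix a b :: cyc assume "a \<noteq> 0" "b \<noteq> 0"
  then show "a * b \<noteq> 0" by (metis cnorm_eq_0 cnorm_mult mult_eq_0_iff)
qed

lemma cyc_unit_iff: "x dvd 1 \<longleftrightarrow> cnorm x = 1"
proof
  assume "x dvd 1"
  then obtain y where "1 = x * y" by (auto elim: dvdE)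
  then have "cnorm x * cnorm y = 1" by (metis cnorm_mult cnorm_simps(2))
  then show "cnorm x = 1" by (metis cnorm_simps(10) abs_of_nonneg zdvd1_eq dvd_triv_left)
next
  assume "cnorm x = 1"
  then show "x dvd 1" using cyc_dvd_cnorm[of x] by simp
qed

lemma lam_nonzero [simp]: "lam \<noteq> 0"
  by (simp add: cyc_eq_iff)

lemma lam_power_dvd_mult:
  assumes "lam ^ n dvd x * y" "\<not> lam dvd y" shows "lam ^ n dvd x"
  using assms(1)
proof (induction n)
  case (Suc n)
  then have "lam ^ n dvd x * y" by (metis dvd_trans le_imp_power_dvd lessI less_imp_le)
  with Suc.IH obtain z where z: "x = lam ^ n * z" by (auto elim: dvdE)
  have "lam ^ n * lam dvd lam ^ n * (z * y)" using Suc.prems z by (simp add: mult_ac)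
  then have "lam dvd z * y" by simp
  then have "lam dvd z" using assms(2) lam_dvd_mult by blast
  then show ?case using z by (simp add: mult.commute[of lam] mult_dvd_mono)
qed simp

subsection \<open>The complex embedding of the Eisenstein integers\<close>

definition com :: complex where "com = omega 1"

lemma com_eq: "com = Complex (- 1 / 2) (sqrt 3 / 2)"
proof -
  have "cos (2 * pi / 3) = - 1 / 2" using cos_120 by simp
  moreover have "sin (2 * pi / 3) = sqrt 3 / 2" using sin_120 by simp
  ultimately show ?thesis by (simp add: com_def omega_def complex_eq_iff)
qed

definition ecx :: "eis \<Rightarrow> complex" where "ecx x = of_int (e0 x) + of_int (e1 x) * com"

lemma com_sq: "com^2 = - 1 - com"
  by (simp add: com_eq complex_eq_iff power2_eq_square)

lemma ecx_simps [simp]: "ecx (x + y) = ecx x + ecx y" "ecx (x - y) = ecx x - ecx y"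
  "ecx (- x) = - ecx x" "ecx 0 = 0" "ecx 1 = 1" "ecx (of_int n) = of_int n" "ecx (numeral k) = numeral k"
  "ecx eom = com"
  by (simp_all add: ecx_def algebra_simps)

lemma ecx_mult [simp]: "ecx (x * y) = ecx x * ecx y"
proof -
  have "com * com = - 1 - com" using com_sq by (simp add: power2_eq_square)
  then have *: "com * (com * z) = (- 1 - com) * z" for z by (simp flip: mult.assoc)
  show ?thesis by (simp add: ecx_def * algebra_simps)
qed

lemma cnj_com: "cnj (com) = com^2"
  unfolding com_sq by (simp add: com_eq complex_eq_iff)

lemma ecx_ecnj: "ecx (ecnj x) = cnj (ecx x)"
  by (simp add: ecx_def cnj_com com_sq algebra_simps)

lemma of_int_enorm: "of_int (enorm x) = ecx x * cnj (ecx x)"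
  by (metis ecx_ecnj ecx_mult ecx_simps(6) mult_ecnj)

lemma norm_ecx: "of_int (enorm x) = (norm (ecx x))^2"
proof -
  have "complex_of_real (of_int (enorm x)) = complex_of_real ((norm (ecx x))^2)"
    unfolding complex_norm_square using of_int_enorm[of x] by simp
  then show ?thesis by (simp only: of_real_eq_iff)
qed

subsection \<open>Euclidean division\<close>

text \<open>The numbers n - s, s - u, u are barycentric weights, of sum n, of the point s + u w in
  the triangle 0, n, n (1 + w). The weighted mean of its squared distances to the vertices is at
  most n^2 / 3, with equality only at the centroid, so if no distance is smaller the point is the
  centroid.\<close>

lemma triangle_distance:
  fixes n s u :: int
  assumes "0 \<le> u" "u \<le> s" "s < n"
  shows "3 * enorm (Eis s u) < n^2 \<or> 3 * enorm (Eis (s - n) u) < n^2 \<or>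
    3 * enorm (Eis (s - n) (u - n)) < n^2 \<or> (n = 3 * u \<and> s = 2 * u)"
proof (rule ccontr)
  assume *: "\<not> ?thesis"
  define f0 f1 f2 w0 w1 w2 where f: "f0 = enorm (Eis s u)" "f1 = enorm (Eis (s - n) u)"
    "f2 = enorm (Eis (s - n) (u - n))" and w: "w0 = n - s" "w1 = s - u" "w2 = u"
  have ge: "n^2 \<le> 3 * f0" "n^2 \<le> 3 * f1" "n^2 \<le> 3 * f2" using * f by auto
  have "w0 * n^2 \<le> w0 * (3 * f0)" "w1 * n^2 \<le> w1 * (3 * f1)" "w2 * n^2 \<le> w2 * (3 * f2)"
    using assms w ge by (auto intro!: mult_left_mono)
  then have "w0 * n^2 + w1 * n^2 + w2 * n^2 \<le> 3 * (w0 * f0 + w1 * f1 + w2 * f2)"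
    by (simp add: algebra_simps)
  moreover have "w0 * n^2 + w1 * n^2 + w2 * n^2 = n * n^2"
    unfolding w by (simp add: algebra_simps)
  moreover have "2 * (3 * (w0 * f0 + w1 * f1 + w2 * f2)) =
      n * (2 * n^2 - ((w0 - w1)^2 + (w1 - w2)^2 + (w0 - w2)^2))"
    unfolding f w enorm_def by (simp add: algebra_simps power2_eq_square)
  ultimately have "n * ((w0 - w1)^2 + (w1 - w2)^2 + (w0 - w2)^2) \<le> 0"
    by (simp add: algebra_simps)
  then have "(w0 - w1)^2 + (w1 - w2)^2 + (w0 - w2)^2 \<le> 0"
    using assms by (smt (verit) zero_less_mult_iff)
  then have "(w0 - w1)^2 = 0" "(w1 - w2)^2 = 0"
    using zero_le_power2[of "w0 - w1"] zero_le_power2[of "w1 - w2"] zero_le_power2[of "w0 - w2"]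
    by linarith+
  then have "n = 3 * u \<and> s = 2 * u" unfolding w by simp
  with * show False by simp
qed

text \<open>The covering radius of the hexagonal lattice is \<open>1/\<surd>3\<close>, and the second alternative
  describes its deep holes.\<close>

lemma eis_rounding:
  fixes z :: eis
  assumes "n > 0"
  shows "\<exists>q. 3 * enorm (z - of_int n * q) < n^2 \<or>
    (3 * enorm (z - of_int n * q) = n^2 \<and> of_int n dvd elam * (z - of_int n * q))"
proof -
  define s u where su: "s = e0 z mod n" "u = e1 z mod n"
  have bounds: "0 \<le> s" "s < n" "0 \<le> u" "u < n" using assms su by auto
  define q where "q = Eis (e0 z div n) (e1 z div n)"
  have r: "z - of_int n * (q + Eis a b) = Eis (s - n * a) (u - n * b)" for a b
    by (simp add: eis_eq_iff q_def su algebra_simps minus_mult_div_eq_mod[symmetric])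
  let ?G = "\<lambda>x. 3 * enorm x < n^2 \<or> (3 * enorm x = n^2 \<and> of_int n dvd elam * x)"
  have red: "?thesis" if "?G (Eis (s - n * a) (u - n * b))" for a b
    using that r[of a b] by metis
  show ?thesis
  proof (cases "u \<le> s")
    case True
    from triangle_distance[OF bounds(3) True bounds(2)]
    consider "?G (Eis s u)" | "?G (Eis (s - n) u)" | "?G (Eis (s - n) (u - n))" | "n = 3 * u" "s = 2 * u"
      by blast
    then show ?thesis
    proof cases
      case 4
      then have "of_int n dvd elam * Eis s u" unfolding eis_of_int_dvd by simp
      moreover have "3 * enorm (Eis s u) = n^2" using 4 by (simp add: enorm_def power2_eq_square)
      ultimately have "?G (Eis s u)" by blast
      then show ?thesis using red[of 0 0] by simp
    qed (use red[of 0 0] red[of 1 0] red[of 1 1] in auto)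
  next
    case False
    \<comment> \<open>The norm is symmetric in the coordinates, so the other half of the period
      parallelogram is a mirror image.\<close>
    have sw: "enorm (Eis a b) = enorm (Eis b a)" for a b
      by (simp add: enorm_def algebra_simps)
    from triangle_distance[OF bounds(1) _ bounds(4)] False
    consider "?G (Eis s u)" | "?G (Eis s (u - n))" | "?G (Eis (s - n) (u - n))" | "n = 3 * s" "u = 2 * s"
      using sw[of u s] sw[of "u - n" s] sw[of "u - n" "s - n"] by force
    then show ?thesis
    proof cases
      case 4
      then have "of_int n dvd elam * Eis s u" unfolding eis_of_int_dvd by simp
      moreover have "3 * enorm (Eis s u) = n^2" using 4 by (simp add: enorm_def power2_eq_square)
      ultimately have "?G (Eis s u)" by blast
      then show ?thesis using red[of 0 0] by simp
    qed (use red[of 0 0] red[of 0 1] red[of 1 1] in auto)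
  qed
qed

lemma eis_division:
  assumes "b \<noteq> 0" shows "\<exists>q. enorm (a - q * b) < enorm b"
proof -
  define n where "n = enorm b"
  have n: "n > 0" using assms enorm_nonneg[of b] enorm_eq_0[of b] n_def by linarith
  obtain q where q: "3 * enorm (a * ecnj b - of_int n * q) \<le> n^2"
    using eis_rounding[OF n, of "a * ecnj b"] by (metis less_imp_le order_refl)
  have "a * ecnj b - of_int n * q = (a - q * b) * ecnj b"
    unfolding n_def mult_ecnj[symmetric] by (simp add: algebra_simps)
  then have "3 * (enorm (a - q * b) * n) \<le> n^2" using q by (simp add: enorm_mult n_def)
  then have "3 * enorm (a - q * b) * n \<le> n * n" by (simp add: power2_eq_square)
  then have "3 * enorm (a - q * b) \<le> n" using n by (simp add: mult_le_cancel_right)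
  then have "enorm (a - q * b) < n" using n enorm_nonneg[of "a - q * b"] by linarith
  then show ?thesis unfolding n_def by blast
qed

definition cT :: "cyc \<Rightarrow> int" where "cT x = enorm (c0 x) + enorm (c1 x) + enorm (c2 x)"

definition cM :: "cyc \<Rightarrow> eis" where
  "cM x = ecnj (c0 x) * c1 x + ecnj (c1 x) * c2 x + eom^2 * (c0 x * ecnj (c2 x))"

lemma mult_ccnj: "x * ccnj x = Cyc (of_int (cT x)) (cM x) (eom^2 * ecnj (cM x))"
  by (rule cyc_eq_iff[THEN iffD2])
    (simp add: cT_def cM_def mult_ecnj[symmetric] eom_norm)

text \<open>This is the inequality between geometric and arithmetic mean for the squared absolute values
  of the conjugates of \<open>x\<close>: their mean is \<open>cT x\<close> and their product is \<open>cnorm x\<close>.\<close>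

lemma cnorm_le: "cnorm x \<le> (cT x)^3"
proof -
  define T where "T = cT x"
  define m where "m = cM x"
  have m: "x * ccnj x = Cyc (of_int T) m (eom^2 * ecnj m)"
    unfolding T_def m_def by (rule mult_ccnj)
  have "of_int (cnorm x) = cN (x * ccnj x)"
    by (simp add: cN_mult cnorm_def mult_ecnj)
  also have "\<dots> = of_int T ^ 3 + (eom * m^3 + ecnj (eom * m^3)) - 3 * of_int T * (m * ecnj m)"
    unfolding m cN_def by (simp add: eom_norm)
  also have "m * ecnj m = of_int (enorm m)" by (rule mult_ecnj)
  \<comment> \<open>With t the trace of w m^3 it remains to show t \<le> 3 T |m|^2. This follows
    from t^2 \<le> 4 |m|^6 and |m| \<le> T.\<close>
  finally have N: "cnorm x = T^3 + e0 (eom * m^3 + ecnj (eom * m^3)) - 3 * T * enorm m"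
    unfolding eis_eq_iff by (simp add: power3_eq_cube)
  define t where "t = e0 (eom * m^3 + ecnj (eom * m^3))"
  have tr: "(e0 (y + ecnj y))^2 \<le> 4 * enorm y" for y
  proof -
    have "4 * enorm y - (e0 (y + ecnj y))^2 = 3 * (e1 y)^2"
      by (simp add: enorm_def power2_eq_square algebra_simps)
    then show ?thesis by (smt (verit) zero_le_power2)
  qed
  have t: "t^2 \<le> 4 * enorm m ^ 3"
    using tr[of "eom * m^3"] unfolding t_def by (simp add: enorm_mult enorm_power)
  have T0: "T \<ge> 0" unfolding T_def cT_def by simp
  have M: "enorm m \<le> T^2"
  proof -
    define a b c where abc: "a = norm (ecx (c0 x))" "b = norm (ecx (c1 x))" "c = norm (ecx (c2 x))"
    have "norm (ecx eom) = 1"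
      by (metis norm_ecx enorm_simps(6) of_int_1 abs_norm_cancel real_sqrt_abs real_sqrt_one)
    then have "norm (ecx (eom^2)) = 1" by (simp add: power2_eq_square norm_mult del: ecx_simps(8))
    then have "norm (ecx (eom^2 * (c0 x * ecnj (c2 x)))) = a * c"
      unfolding abc by (simp only: ecx_mult norm_mult ecx_ecnj complex_mod_cnj mult_1)
    moreover have "norm (ecx (ecnj (c0 x) * c1 x)) = a * b" "norm (ecx (ecnj (c1 x) * c2 x)) = b * c"
      unfolding abc by (simp_all only: ecx_mult norm_mult ecx_ecnj complex_mod_cnj)
    ultimately have "norm (ecx m) \<le> a * b + b * c + a * c"
      unfolding m_def cM_def ecx_simps(1) by (metis norm_triangle_mono order_refl)
    also have "\<dots> \<le> a^2 + b^2 + c^2"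
      using sum_squares_bound[of a b] sum_squares_bound[of b c] sum_squares_bound[of a c] by simp
    also have "\<dots> = of_int T" by (simp add: abc T_def cT_def norm_ecx)
    finally have "(norm (ecx m))^2 \<le> (of_int T)^2" by (intro power_mono) auto
    then have "real_of_int (enorm m) \<le> of_int (T^2)" by (simp add: norm_ecx)
    then show ?thesis by (simp only: of_int_le_iff)
  qed
  have "t^2 \<le> 4 * (enorm m)^2 * T^2"
  proof -
    have "enorm m ^ 3 = (enorm m)^2 * enorm m" by (simp add: power3_eq_cube power2_eq_square)
    also have "\<dots> \<le> (enorm m)^2 * T^2" using M by (intro mult_left_mono) auto
    finally show ?thesis using t by linarith
  qed
  also have "\<dots> \<le> (3 * T * enorm m)^2" by (simp add: power_mult_distrib)
  finally have "t \<le> 3 * T * enorm m"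
    by (rule power2_le_imp_le) (simp add: T0)
  then show ?thesis using N unfolding t_def T_def by simp
qed

lemma elam_dvd_lam_cube: "emb elam dvd lam ^ 3"
proof -
  have "lam ^ 3 = emb elam * (1 - emb (ecnj elam) * zet * lam)"
    by (simp add: cyc_eq_iff eis_eq_iff power3_eq_cube)
  then show ?thesis by simp
qed

lemma lam_cube_dvd_elam: "lam ^ 3 dvd emb elam"
proof -
  obtain k where k: "lam ^ 3 = emb elam * k" using elam_dvd_lam_cube by (auto elim: dvdE)
  then have "cnorm (lam ^ 3) = cnorm (emb elam) * cnorm k" by (simp add: cnorm_mult)
  then have "cnorm k = 1" by (simp add: cnorm_power)
  then obtain k' where "1 = k * k'" using cyc_unit_iff[of k] by (metis dvd_def)
  then have "emb elam = lam ^ 3 * k'" using k by (simp add: mult.assoc)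
  then show ?thesis by simp
qed

lemma lam_6_dvd_3: "lam ^ 6 dvd 3"
proof -
  have "lam ^ 3 dvd emb (ecnj elam)"
  proof -
    have "ecnj elam = elam * (1 + eom)" by (simp add: eis_eq_iff power2_eq_square)
    then show ?thesis using lam_cube_dvd_elam by simp
  qed
  then have "lam ^ 3 * lam ^ 3 dvd emb elam * emb (ecnj elam)"
    using lam_cube_dvd_elam by (intro mult_dvd_mono)
  moreover have "emb elam * emb (ecnj elam) = 3"
    by (simp add: cyc_eq_iff eis_eq_iff)
  moreover have "lam ^ 3 * lam ^ 3 = lam ^ 6" by (simp flip: power_add)
  ultimately show ?thesis by simp
qed

lemma lam_power_dvd_of_cnorm:
  assumes "3 ^ n dvd cnorm x" shows "lam ^ n dvd x"
  using assms
proof (induction n arbitrary: x)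
  case (Suc n)
  have "3 dvd cnorm x" using Suc.prems by (metis dvd_mult_left power_Suc)
  then obtain y where y: "x = lam * y" using three_dvd_cnorm by (auto elim: dvdE)
  then have "3 ^ n dvd cnorm y" using Suc.prems by (simp add: cnorm_mult)
  then show ?case using Suc.IH y by (simp add: mult_dvd_mono)
qed simp

text \<open>The quotient a / b, written as \<open>z\<close> over the integer n, is rounded
  coordinatewise in Z[w]. Each coordinate of the remainder has norm at most n^2 / 3, and
  \<open>cnorm_le\<close> gives \<open>cnorm s\<close> \<le> n. Equality can occur only if all three
  coordinates are deep holes. Then (w - 1) s = b t with t of norm 27, so w - 1 divides t and b
  divides s: another quotient leaves remainder 0.\<close>

lemma cyc_division:
  assumes "b \<noteq> 0" shows "\<exists>q. cnorm (a - q * b) < cnorm b"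
proof -
  define n where "n = cnorm b"
  have n: "n > 0" using assms cnorm_simps(10)[of b] cnorm_eq_0[of b] n_def by linarith
  define b' where "b' = sig b * sig (sig b) * emb (ecnj (cN b))"
  have bb': "of_int n = b * b'" unfolding n_def b'_def by (rule cnorm_eq)
  have "n * cnorm b' = n * n^5"
    using arg_cong[OF bb', of cnorm] unfolding cnorm_mult cnorm_simps n_def[symmetric] by (simp flip: power_Suc)
  then have nb': "cnorm b' = n^5" using n by (metis mult_cancel_left less_irrefl)
  then have "b' \<noteq> 0" using n by auto
  define z where "z = a * b'"
  obtain Q where Q: "\<And>x. 3 * enorm (x - of_int n * Q x) < n^2 \<or>
    (3 * enorm (x - of_int n * Q x) = n^2 \<and> of_int n dvd elam * (x - of_int n * Q x))"
    using eis_rounding[OF n] by metis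
  define q where "q = Cyc (Q (c0 z)) (Q (c1 z)) (Q (c2 z))"
  define r where "r = z - of_int n * q"
  define s where "s = a - q * b"
  have sr: "s * b' = r" unfolding s_def r_def z_def bb' by (simp add: algebra_simps)
  have r_cases: "3 * enorm (c r) < n^2 \<or> (3 * enorm (c r) = n^2 \<and> of_int n dvd elam * c r)"
    if "c \<in> {c0, c1, c2}" for c
    using that Q[of "c0 z"] Q[of "c1 z"] Q[of "c2 z"] by (auto simp: r_def q_def)
  have le: "3 * enorm (c r) \<le> n^2" if "c \<in> {c0, c1, c2}" for c
    using r_cases[OF that] by linarith
  have T0: "cT r \<ge> 0" by (simp add: cT_def)
  have sn: "cnorm s * n^5 = cnorm r" using sr nb' by (metis cnorm_mult)
  show ?thesis
  proof (cases "cT r < n^2")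
    case True
    have "cnorm r \<le> (cT r)^3" by (rule cnorm_le)
    also have "\<dots> < (n^2)^3" using True T0 by (intro power_strict_mono) auto
    also have "\<dots> = n * n^5" by (simp add: eval_nat_numeral)
    finally have "cnorm s * n^5 < n * n^5" using sn by simp
    then have "cnorm s < n" using n by (simp add: mult_less_cancel_right)
    then show ?thesis unfolding s_def n_def by blast
  next
    case False
    have eq: "3 * enorm (c r) = n^2" if "c \<in> {c0, c1, c2}" for c
      using that False le[of c0] le[of c1] le[of c2] unfolding cT_def by auto
    then have "of_int n dvd elam * c r" if "c \<in> {c0, c1, c2}" for c
      using r_cases[OF that] that by auto
    then have "of_int n dvd emb elam * r" unfolding cyc_of_int_dvd by simp
    then obtain t where t: "emb elam * r = of_int n * t" by (auto elim: dvdE)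
    then have "(emb elam * s) * b' = (b * t) * b'" unfolding sr[symmetric] bb' by (simp add: mult_ac)
    then have st: "emb elam * s = b * t" using \<open>b' \<noteq> 0\<close> by simp
    have "cT r = n^2" using eq[of c0] eq[of c1] eq[of c2] unfolding cT_def by simp
    then have "cnorm s * n^5 \<le> n * n^5"
      using cnorm_le[of r] sn by (simp add: eval_nat_numeral)
    then have "cnorm s \<le> n" using n by (simp add: mult_le_cancel_right)
    show ?thesis
    proof (cases "cnorm s = n")
      case True
      have "27 * n = n * cnorm t"
        using arg_cong[OF st, of cnorm] True n_def by (simp add: cnorm_mult)
      then have "cnorm t = 3 ^ 3" using n by simp
      then have "lam ^ 3 dvd t" by (intro lam_power_dvd_of_cnorm) simp
      then obtain t' where "t = emb elam * t'" using elam_dvd_lam_cube by (meson dvd_trans dvdE)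
      then have "emb elam * s = emb elam * (b * t')" using st by (simp add: mult_ac)
      moreover have "emb elam \<noteq> 0" by (simp add: cyc_eq_iff eis_eq_iff)
      ultimately have "s = b * t'" by simp
      then have "a - (q + t') * b = 0" unfolding s_def by (simp add: algebra_simps)
      then show ?thesis using n n_def by (metis cnorm_simps(1))
    next
      case False
      then have "cnorm s < n" using \<open>cnorm s \<le> n\<close> by simp
      then show ?thesis unfolding s_def n_def by blast
    qed
  qed
qed

interpretation eis: norm_euclidean "\<lambda>x. nat (enorm x)"
proof
  fix a b :: eis
  show "nat (enorm (a * b)) = nat (enorm a) * nat (enorm b)"
    by (simp add: enorm_mult nat_mult_distrib)
  show "nat (enorm a) = 0 \<longleftrightarrow> a = 0"
    using enorm_nonneg[of a] enorm_eq_0[of a] by linarith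
  show "nat (enorm a) = 1 \<longleftrightarrow> a dvd 1"
    unfolding eis_unit_iff by linarith
  show "\<exists>q. nat (enorm (a - q * b)) < nat (enorm b)" if "b \<noteq> 0"
    using eis_division[OF that, of a] by (metis enorm_nonneg nat_less_eq_zless)
qed

interpretation cyc: norm_euclidean "\<lambda>x. nat (cnorm x)"
proof
  fix a b :: cyc
  show "nat (cnorm (a * b)) = nat (cnorm a) * nat (cnorm b)"
    by (simp add: cnorm_mult nat_mult_distrib)
  show "nat (cnorm a) = 0 \<longleftrightarrow> a = 0"
    using cnorm_simps(10)[of a] cnorm_eq_0[of a] by linarith
  show "nat (cnorm a) = 1 \<longleftrightarrow> a dvd 1"
    unfolding cyc_unit_iff by linarith
  show "\<exists>q. nat (cnorm (a - q * b)) < nat (cnorm b)" if "b \<noteq> 0"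
    using cyc_division[OF that, of a] by (metis cnorm_simps(10) nat_less_eq_zless)
qed

section \<open>Elements associated to their conjugates modulo powers of the prime above 3\<close>

text \<open>The equation for u says that u has absolute value 1 in every embedding, i.e. is a root
  of unity. In this form products and norms of witnesses are again witnesses.\<close>

definition etriv :: "eis \<Rightarrow> bool" where
  "etriv a \<longleftrightarrow> (\<exists>u. u * ecnj u = 1 \<and> 9 dvd a - u * ecnj a)"

definition ctriv :: "cyc \<Rightarrow> bool" where
  "ctriv b \<longleftrightarrow> (\<exists>u. u * ccnj u = 1 \<and> lam ^ 8 dvd b - u * ccnj b)"

lemma dvd_diff_mult:
  fixes d a b c e :: "'a::comm_ring_1"
  assumes "d dvd a - b" "d dvd c - e" shows "d dvd a * c - b * e"
proof -
  have "a * c - b * e = (a - b) * c + b * (c - e)" by (simp add: algebra_simps)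
  then show ?thesis using assms by (metis dvd_add dvd_mult dvd_mult2)
qed

lemma dvd_diff_trans:
  fixes d a b c :: "'a::comm_ring_1"
  assumes "d dvd a - b" "d dvd b - c" shows "d dvd a - c"
  using dvd_add[OF assms] by simp

lemma dvd_diff_sym:
  fixes d a b :: "'a::comm_ring_1"
  assumes "d dvd a - b" shows "d dvd b - a"
  using assms by (metis dvd_minus_iff minus_diff_eq)

lemma dvd_diff_power:
  fixes d a b :: "'a::comm_ring_1"
  assumes "d dvd a - b" shows "d dvd a ^ n - b ^ n"
  by (induction n) (use assms dvd_diff_mult in auto)

lemma ecnj_dvd: "a dvd b \<Longrightarrow> ecnj a dvd ecnj b"
  by (auto elim!: dvdE)

lemma ccnj_dvd: "a dvd b \<Longrightarrow> ccnj a dvd ccnj b"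
  by (auto elim!: dvdE)

lemma sig_dvd: "a dvd b \<Longrightarrow> sig a dvd sig b"
  by (auto elim!: dvdE)

lemma etriv_mult: assumes "etriv a" "etriv b" shows "etriv (a * b)"
proof -
  obtain u v where "u * ecnj u = 1" "v * ecnj v = 1"
    and d: "9 dvd a - u * ecnj a" "9 dvd b - v * ecnj b"
    using assms unfolding etriv_def by blast
  then have "(u * v) * ecnj (u * v) = 1" by (metis ecnj_simps(4) mult.assoc mult.left_commute mult_1)
  moreover have "9 dvd a * b - (u * v) * ecnj (a * b)"
    using dvd_diff_mult[OF d] by (simp add: mult_ac)
  ultimately show ?thesis unfolding etriv_def by blast
qed

lemma ctriv_mult: assumes "ctriv a" "ctriv b" shows "ctriv (a * b)"
proof -
  obtain u v where "u * ccnj u = 1" "v * ccnj v = 1"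
    and d: "lam ^ 8 dvd a - u * ccnj a" "lam ^ 8 dvd b - v * ccnj b"
    using assms unfolding ctriv_def by blast
  then have "(u * v) * ccnj (u * v) = 1" by (metis ccnj_simps(4) mult.assoc mult.left_commute mult_1)
  moreover have "lam ^ 8 dvd a * b - (u * v) * ccnj (a * b)"
    using dvd_diff_mult[OF d] by (simp add: mult_ac)
  ultimately show ?thesis unfolding ctriv_def by blast
qed

text \<open>The cofactor e in \<open>ecnj a = a * e\<close> satisfies e * conj(e) = 1, so the
  congruence holds as an equality. Units and rational integers are covered.\<close>

lemma etriv_if_dvd_ecnj: assumes "a dvd ecnj a" shows "etriv a"
proof (cases "a = 0")
  case False
  obtain e where e: "ecnj a = a * e" using assms by (auto elim: dvdE)
  then have "a = ecnj a * ecnj e" by (metis ecnj_simps(4,9))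
  then have "a * (ecnj e * e) = a * 1" using e by (metis mult.assoc mult.commute mult.right_neutral)
  then have u: "ecnj e * e = 1" using False by simp
  then have "a = ecnj e * ecnj a" using e by (metis mult.assoc mult.commute mult_1)
  then show ?thesis unfolding etriv_def using u by (intro exI[of _ "ecnj e"]) simp
qed (auto simp: etriv_def intro!: exI[of _ 1])

lemma ctriv_if_dvd_ccnj: assumes "a dvd ccnj a" shows "ctriv a"
proof (cases "a = 0")
  case False
  obtain e where e: "ccnj a = a * e" using assms by (auto elim: dvdE)
  then have "a = ccnj a * ccnj e" by (metis ccnj_simps(4,11))
  then have "a * (ccnj e * e) = a * 1" using e by (metis mult.assoc mult.commute mult.right_neutral)
  then have u: "ccnj e * e = 1" using False by simp
  then have "a = ccnj e * ccnj a" using e by (metis mult.assoc mult.commute mult_1)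
  then show ?thesis unfolding ctriv_def using u by (intro exI[of _ "ccnj e"]) simp
qed (auto simp: ctriv_def intro!: exI[of _ 1])

lemma etriv_unit: "u dvd 1 \<Longrightarrow> etriv u"
  by (metis etriv_if_dvd_ecnj dvd_trans one_dvd)

lemma ctriv_unit: "u dvd 1 \<Longrightarrow> ctriv u"
  by (metis ctriv_if_dvd_ccnj dvd_trans one_dvd)

lemma nine_dvd_ecnj: "9 dvd a \<Longrightarrow> 9 dvd ecnj a"
  using ecnj_dvd[of 9 a] by simp

lemma etriv_cong: assumes "9 dvd a - b" "etriv a" shows "etriv b"
proof -
  obtain u where u: "u * ecnj u = 1" "9 dvd a - u * ecnj a" using assms(2) unfolding etriv_def by blast
  have "9 dvd ecnj a - ecnj b" using nine_dvd_ecnj[OF assms(1)] by simp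
  then have "9 dvd u * ecnj a - u * ecnj b" by (metis dvd_mult right_diff_distrib)
  then have "9 dvd b - u * ecnj b"
    using dvd_diff_trans[OF dvd_diff_sym[OF assms(1)]] u(2) dvd_diff_trans by blast
  then show ?thesis unfolding etriv_def using u by blast
qed

lemma ccnj_lam: "lam * (- (zet^8)) = ccnj lam"
proof -
  have "zet * zet^8 = 1" using ccnj_zet by simp
  then show ?thesis by (simp add: lam_def algebra_simps)
qed

lemma lam_power_dvd_ccnj: assumes "lam ^ n dvd a" shows "lam ^ n dvd ccnj a"
proof -
  have "lam dvd ccnj lam" using ccnj_lam by (metis dvd_triv_left)
  then have "lam ^ n dvd ccnj lam ^ n" by (rule dvd_power_same)
  moreover have "ccnj lam ^ n dvd ccnj a" using ccnj_dvd[OF assms] by simp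
  ultimately show ?thesis by (rule dvd_trans)
qed

lemma ctriv_cong: assumes "lam ^ 8 dvd a - b" "ctriv a" shows "ctriv b"
proof -
  obtain u where u: "u * ccnj u = 1" "lam ^ 8 dvd a - u * ccnj a" using assms(2) unfolding ctriv_def by blast
  have "lam ^ 8 dvd ccnj a - ccnj b" using lam_power_dvd_ccnj[OF assms(1)] by simp
  then have "lam ^ 8 dvd u * ccnj a - u * ccnj b" by (metis dvd_mult right_diff_distrib)
  then have "lam ^ 8 dvd b - u * ccnj b"
    using dvd_diff_trans[OF dvd_diff_sym[OF assms(1)]] u(2) dvd_diff_trans by blast
  then show ?thesis unfolding ctriv_def using u by blast
qed

lemma etriv_of_int: "etriv (of_int n)"
  by (rule etriv_if_dvd_ecnj) simp

lemma etriv_if_cong_int: "9 dvd a - of_int n \<Longrightarrow> etriv a"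
  using etriv_cong[of "of_int n" a] etriv_of_int dvd_diff_sym by blast

text \<open>The coefficient of w in (x + y w)^3 is 3 x y (x - y), and one of x, y, x - y is
  divisible by 3 unless x + y is; so the cube is a rational integer modulo 9. Cubes arise as norms
  from Z[zeta] of elements of Z[w].\<close>

lemma etriv_cube: assumes "\<not> elam dvd a" shows "etriv (a ^ 3)"
proof -
  have "9 dvd 3 * e0 a * e1 a * (e0 a - e1 a)"
  proof -
    have "3 dvd e0 a * (e1 a * (e0 a - e1 a))"
      using assms unfolding elam_dvd by (simp add: prime_dvd_mult_iff) presburger
    then have "3 * 3 dvd 3 * (e0 a * (e1 a * (e0 a - e1 a)))" by (intro mult_dvd_mono) auto
    then show ?thesis by (simp add: mult_ac)
  qed
  then have "9 dvd e1 (a ^ 3)" by (simp add: power3_eq_cube algebra_simps)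
  then have "9 dvd a ^ 3 - of_int (e0 (a ^ 3))" by (simp add: eis_numeral_dvd)
  then show ?thesis by (rule etriv_if_cong_int)
qed

lemma cube_cong_9:
  fixes a b :: "'a::comm_ring_1"
  assumes "3 dvd a - b" shows "9 dvd a ^ 3 - b ^ 3"
proof -
  obtain k where "a - b = 3 * k" using assms by (auto elim: dvdE)
  then have "a = b + 3 * k" by (simp add: algebra_simps)
  then have "a ^ 3 - b ^ 3 = 9 * (b^2 * k + 3 * (b * k^2) + 3 * k^3)"
    by (simp add: power2_eq_square power3_eq_cube algebra_simps)
  then show ?thesis by (metis dvd_triv_left)
qed

text \<open>Cubing turns a congruence modulo 3 into one modulo 9, and the mixed term of the norm
  form already carries a factor 3.\<close>

lemma cN_cong:
  assumes "3 dvd x - y" shows "9 dvd cN x - cN y"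
proof -
  have d: "3 dvd c0 x - c0 y" "3 dvd c1 x - c1 y" "3 dvd c2 x - c2 y"
    using assms by (simp_all add: cyc_numeral_dvd)
  have "3 dvd c0 x * c1 x * c2 x - c0 y * c1 y * c2 y"
    using d by (intro dvd_diff_mult)
  then have "3 * 3 dvd 3 * (c0 x * c1 x * c2 x - c0 y * c1 y * c2 y)" by (intro mult_dvd_mono) auto
  then have "9 dvd (c0 x^3 - c0 y^3) + eom * (c1 x^3 - c1 y^3) + eom^2 * (c2 x^3 - c2 y^3)
      - eom * (3 * (c0 x * c1 x * c2 x - c0 y * c1 y * c2 y))"
    by (intro dvd_diff[OF dvd_add[OF dvd_add[OF _ dvd_mult] dvd_mult] dvd_mult] d[THEN cube_cong_9]) simp
  moreover have "cN x - cN y = (c0 x^3 - c0 y^3) + eom * (c1 x^3 - c1 y^3) + eom^2 * (c2 x^3 - c2 y^3)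
      - eom * (3 * (c0 x * c1 x * c2 x - c0 y * c1 y * c2 y))"
    by (simp add: cN_def algebra_simps)
  ultimately show ?thesis by simp
qed

lemma three_dvd_if_lam_power: assumes "lam ^ n dvd x" "6 \<le> n" shows "3 dvd x"
  using assms three_dvd_lam_6 by (meson dvd_trans le_imp_power_dvd)

lemma ctriv_imp_etriv_cN: assumes "ctriv b" shows "etriv (cN b)"
proof -
  obtain u where u: "u * ccnj u = 1" "lam ^ 8 dvd b - u * ccnj b"
    using assms unfolding ctriv_def by blast
  have "9 dvd cN b - cN (u * ccnj b)"
    using three_dvd_if_lam_power[OF u(2)] by (intro cN_cong) simp
  moreover have "cN u * ecnj (cN u) = 1"
    using arg_cong[OF u(1), of cN] by (simp add: cN_mult)
  ultimately show ?thesis unfolding etriv_def by (intro exI[of _ "cN u"]) (simp add: cN_mult)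
qed

section \<open>Prime elements of the ninth cyclotomic ring\<close>

lemma prime_elem_dvd_rational_prime:
  fixes p :: "'a::idom"
  assumes "prime_elem p" "p dvd of_int n" "n \<noteq> 0"
  shows "\<exists>q::int. prime q \<and> q dvd n \<and> p dvd of_int q"
  using assms(2,3)
proof (induction "nat \<bar>n\<bar>" arbitrary: n rule: less_induct)
  case less
  have "\<not> \<bar>n\<bar> = 1"
  proof
    assume "\<bar>n\<bar> = 1"
    then have "n = 1 \<or> n = -1" by linarith
    then have "p dvd 1" using less.prems(1) by auto
    with assms(1) show False by (simp add: prime_elem_def)
  qed
  then obtain q where q: "prime q" "q dvd n" using less.prems(2) prime_divisor_exists[of n] by auto
  then obtain m where m: "n = q * m" by (auto elim: dvdE)
  have "p dvd of_int q * of_int m" using less.prems(1) m by simp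
  then have "p dvd of_int q \<or> p dvd of_int m" using assms(1) prime_elem_dvd_mult_iff by blast
  then show ?case
  proof
    assume pm: "p dvd of_int m"
    have "q > 1" using q(1) prime_gt_1_int by blast
    have "m \<noteq> 0" using m less.prems(2) by auto
    then have "\<bar>m\<bar> < \<bar>n\<bar>" using m \<open>q > 1\<close> by (simp add: abs_mult)
    then have "nat \<bar>m\<bar> < nat \<bar>n\<bar>" by linarith
    from less.hyps[OF this pm \<open>m \<noteq> 0\<close>] obtain q' where "prime q'" "q' dvd m" "p dvd of_int q'" by blast
    then show ?thesis using m by (metis dvd_mult)
  qed (use q in blast)
qed

lemma dvd_coprime_ints:
  fixes p :: "'a::comm_ring_1"
  assumes "p dvd of_int a" "p dvd of_int b" "coprime a b" shows "p dvd 1"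
proof -
  obtain x y where "x * a + y * b = 1" using assms(3) by (metis bezout_int coprime_imp_gcd_eq_1)
  then have "of_int x * of_int a + of_int y * of_int b = (1::'a)" by (metis of_int_1 of_int_add of_int_mult)
  then show ?thesis using assms(1,2) by (metis dvd_add dvd_mult)
qed

subsection \<open>Primes congruent to 2 modulo 3\<close>

lemma freshmans_dream_dvd:
  fixes x y :: "'a::comm_ring_1"
  assumes "prime p" shows "of_nat p dvd (x + y) ^ p - (x ^ p + y ^ p)"
proof -
  have p: "p > 0" using assms prime_gt_0_nat by blast
  have "(x + y) ^ p = (\<Sum>k\<le>p. of_nat (p choose k) * x ^ k * y ^ (p - k))" by (rule binomial_ring)
  also have "{..p} = insert 0 (insert p {0<..<p})" using p by auto
  also have "(\<Sum>k\<in>\<dots>. of_nat (p choose k) * x ^ k * y ^ (p - k)) =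
      (\<Sum>k\<in>{0<..<p}. of_nat (p choose k) * x ^ k * y ^ (p - k)) + (x ^ p + y ^ p)"
    using p by (simp add: add_ac)
  finally have "(x + y) ^ p - (x ^ p + y ^ p) =
      (\<Sum>k\<in>{0<..<p}. of_nat (p choose k) * x ^ k * y ^ (p - k))" by simp
  moreover have "of_nat p dvd (\<Sum>k\<in>{0<..<p}. of_nat (p choose k) * x ^ k * y ^ (p - k))"
  proof (rule dvd_sum)
    fix k assume "k \<in> {0<..<p}"
    then have "p dvd p choose k" using assms by (intro dvd_choose_prime) auto
    then have "(of_nat p :: 'a) dvd of_nat (p choose k)" by (auto elim!: dvdE)
    then show "of_nat p dvd of_nat (p choose k) * x ^ k * y ^ (p - k)" by (metis dvd_mult2)
  qed
  ultimately show ?thesis by simp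
qed

lemma freshmans_dream_dvd_power:
  fixes x y :: "'a::comm_ring_1"
  assumes "prime p" shows "of_nat p dvd (x + y) ^ (p ^ n) - (x ^ (p ^ n) + y ^ (p ^ n))"
proof (induction n)
  case (Suc n)
  have "of_nat p dvd ((x + y) ^ (p ^ n)) ^ p - (x ^ (p ^ n) + y ^ (p ^ n)) ^ p"
    using Suc by (rule dvd_diff_power)
  then have "of_nat p dvd ((x + y) ^ (p ^ n)) ^ p - ((x ^ (p ^ n)) ^ p + (y ^ (p ^ n)) ^ p)"
    using freshmans_dream_dvd[OF assms] dvd_diff_trans by blast
  then show ?case by (simp add: power_mult[symmetric] mult.commute)
qed simp

text \<open>As q is 2, 5 or 8 modulo 9, q^3 is -1 modulo 9, so the power q^3 sends zeta to its
  conjugate. Modulo q this power map is a ring homomorphism, so the elements with the property form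
  a subring, and it contains zeta.\<close>

lemma frobenius_conj:
  assumes "prime q" "q mod 3 = 2" shows "of_nat q dvd x ^ (q ^ 3) - ccnj x"
proof -
  define S where "S = {x. of_nat q dvd x ^ (q ^ 3) - ccnj x}"
  have add: "x + y \<in> S" if "x \<in> S" "y \<in> S" for x y
  proof -
    have "of_nat q dvd (x ^ (q ^ 3) + y ^ (q ^ 3)) - ccnj (x + y)"
      using that dvd_add[of "of_nat q" "x ^ (q ^ 3) - ccnj x" "y ^ (q ^ 3) - ccnj y"]
      by (simp add: S_def algebra_simps)
    then show ?thesis unfolding S_def using freshmans_dream_dvd_power[OF assms(1)] dvd_diff_trans by blast
  qed
  have mult: "x * y \<in> S" if "x \<in> S" "y \<in> S" for x y
    using that dvd_diff_mult unfolding S_def by (simp add: power_mult_distrib)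
  have zero: "0 \<in> S" and one: "1 \<in> S"
    using assms(1) prime_gt_0_nat[of q] by (simp_all add: S_def power_0_left)
  have minus: "- x \<in> S" if "x \<in> S" for x
  proof -
    have "of_nat q dvd 0 - (x ^ (q ^ 3) + (- x) ^ (q ^ 3))"
      using freshmans_dream_dvd_power[OF assms(1), of x "- x" 3] assms(1) prime_gt_0_nat[of q]
      by (simp add: power_0_left)
    then have "of_nat q dvd - (0 - (x ^ (q ^ 3) + (- x) ^ (q ^ 3))) - (x ^ (q ^ 3) - ccnj x)"
      using that unfolding S_def by (metis dvd_diff dvd_minus_iff mem_Collect_eq)
    then show ?thesis unfolding S_def by (simp add: algebra_simps)
  qed
  have int: "of_int n \<in> S" for n
  proof -
    have "of_nat k \<in> S" for k by (induction k) (auto intro: zero one add)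
    then show ?thesis by (cases n rule: int_cases2) (auto intro: minus)
  qed
  have "q ^ 3 mod 9 = 8"
  proof -
    have "q mod 9 = 2 \<or> q mod 9 = 5 \<or> q mod 9 = 8" using assms(2) by presburger
    then show ?thesis using power_mod[of q 9 3] by auto
  qed
  then obtain k where k: "q ^ 3 = 9 * k + 8" by (metis mult_div_mod_eq)
  have zet: "zet \<in> S" unfolding S_def k by (simp add: power_add power_mult zet_nine)
  have "emb eom \<in> S" unfolding zet_cube[symmetric] power3_eq_cube by (intro mult zet)
  then have emb: "emb a \<in> S" for a
    by (subst eis_decomp) (auto intro!: add mult int)
  have "x \<in> S"
    by (subst cyc_decomp) (auto intro!: add mult emb zet simp: power2_eq_square)
  then show ?thesis unfolding S_def by simp
qed

lemma ctriv_if_dvd_inert: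
  fixes q :: int
  assumes "prime q" "q mod 3 = 2" "x dvd of_int q" shows "ctriv x"
proof (rule ctriv_if_dvd_ccnj)
  define n where "n = nat q"
  have qn: "q = int n" using assms(1) prime_ge_0_int by (simp add: n_def)
  have n: "prime n" "n mod 3 = 2" using assms(1,2) unfolding qn by (simp_all, presburger)
  have "x dvd x ^ (n ^ 3) - ccnj x"
    using assms(3) frobenius_conj[OF n, of x] unfolding qn by (metis dvd_trans of_int_of_nat_eq)
  moreover have "x dvd x ^ (n ^ 3)" using n(1) prime_gt_0_nat by (intro dvd_power) auto
  ultimately show "x dvd ccnj x" by (metis dvd_diff dvd_minus_iff minus_diff_eq diff_diff_eq2 add_diff_cancel_left')
qed

subsection \<open>Primes congruent to 1 modulo 3\<close>

text \<open>For a primitive root g modulo q and q - 1 = 3 m k, the residue r = g^k has order 3 m, so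
  r^m is a primitive cube root of unity. The cases m = 1 and m = 3 give roots of the third and the
  ninth cyclotomic polynomial.\<close>

lemma cyclotomic_root_mod_prime:
  fixes q :: int
  assumes "prime q" "q mod (3 * int m) = 1" "m > 0"
  shows "\<exists>r::int. q dvd r ^ (2 * m) + r ^ m + 1"
proof -
  define n where "n = nat q"
  have qn: "q = int n" using assms(1) prime_ge_0_int by (simp add: n_def)
  have n: "prime n" using assms(1) unfolding qn by simp
  then have n1: "n > 1" using prime_gt_1_nat by blast
  have "int (n mod (3 * m)) = int 1" using assms(2) unfolding qn by (simp add: zmod_int)
  then have "n mod (3 * m) = 1" by (simp only: int_int_eq)
  then obtain k where k: "n = 3 * m * k + 1" by (metis mult_div_mod_eq)
  then have "k > 0" using n1 by (cases k) auto
  obtain g where g: "ord n g = 3 * m * k"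
    using residue_prime_has_primroot[OF n] k by auto
  define r where "r = g ^ k"
  have r1: "\<not> [r ^ m = 1] (mod n)"
  proof
    assume "[r ^ m = 1] (mod n)"
    then have "ord n g dvd k * m" unfolding r_def power_mult[symmetric] ord_divides .
    then have "3 * m * k \<le> k * m" using g \<open>k > 0\<close> assms(3) by (metis dvd_imp_le nat_0_less_mult_iff)
    then show False using \<open>k > 0\<close> assms(3) by simp
  qed
  have r3: "[(r ^ m) ^ 3 = 1] (mod n)"
  proof -
    have "k * m * 3 = ord n g" using g by simp
    then show ?thesis unfolding r_def power_mult[symmetric] by (metis ord_divides dvd_refl)
  qed
  define s where "s = int r ^ m"
  have "\<not> q dvd s - 1"
    using r1 unfolding s_def qn by (metis cong_iff_dvd_diff cong_int_iff of_nat_power of_nat_1)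
  moreover have "q dvd s ^ 3 - 1"
    using r3 unfolding s_def qn by (metis cong_iff_dvd_diff cong_int_iff of_nat_power of_nat_1)
  moreover have "s ^ 3 - 1 = (s - 1) * (s ^ 2 + s + 1)"
    by (simp add: power2_eq_square power3_eq_cube algebra_simps)
  ultimately have "q dvd s ^ 2 + s + 1" using assms(1) prime_dvd_mult_iff by metis
  moreover have "s ^ 2 = int r ^ (2 * m)" unfolding s_def by (simp add: power_mult[symmetric] mult.commute)
  ultimately show ?thesis unfolding s_def by metis
qed

lemma of_int_dvd_of_int: "a dvd b \<Longrightarrow> (of_int a :: 'a::comm_ring_1) dvd of_int b"
  by (auto elim!: dvdE)

lemma enorm_prime_exists:
  assumes "prime q" "q mod 3 = 1"
  shows "\<exists>p. enorm p = q"
proof -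
  have q1: "q > 1" using assms(1) prime_gt_1_int by blast
  obtain r where "q dvd r ^ (2 * 1) + r ^ 1 + 1"
    using cyclotomic_root_mod_prime[of q 1] assms by auto
  then have r: "q dvd r^2 + r + 1" by simp
  have "\<not> (of_int q :: eis) dvd 1" unfolding eis_unit_iff using q1 by (simp add: power2_eq_1_iff)
  moreover have "(of_int q :: eis) \<noteq> 0" using q1 by (simp add: eis_eq_iff)
  ultimately obtain p :: eis where p: "prime_elem p" "p dvd of_int q"
    using eis.prime_factor by blast
  have pn: "p \<noteq> 0" "\<not> p dvd 1" using p(1) by (auto simp: prime_elem_def)
  have "enorm p dvd q^2" using p(2) enorm_mult by (metis dvd_def enorm_simps(5))
  then obtain i where i: "i \<le> 2" "enorm p = q ^ i"
    using divides_primepow[of q "enorm p" 2] assms(1) by (auto simp: abs_of_nonneg)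
  have "i \<noteq> 0" using i(2) pn(2) eis_unit_iff by (metis power_0)
  \<comment> \<open>Norm q^2 would make p associated to q, and then q would divide r - w or r - w^2,
    whose coefficients are coprime to q.\<close>
  moreover have "i \<noteq> 2"
  proof
    assume "i = 2"
    obtain d where d: "of_int q = p * d" using p(2) by (auto elim: dvdE)
    then have "q^2 = enorm p * enorm d" by (metis enorm_mult enorm_simps(5))
    then have "enorm d = 1" using i \<open>i = 2\<close> q1 by simp
    then obtain d' where d': "1 = d * d'" using eis_unit_iff by (metis dvd_def)
    have "p = of_int q * d'" using d d' by (metis mult.assoc mult.right_neutral)
    then have qp: "(of_int q :: eis) dvd p" by simp
    have "of_int (r^2 + r + 1) = (of_int r - eom) * (of_int r - eom^2 :: eis)"
      by (simp add: eom_norm)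
    then have "p dvd (of_int r - eom) * (of_int r - eom^2)"
      using of_int_dvd_of_int[OF r] p(2) by (metis dvd_trans)
    then have "p dvd of_int r - eom \<or> p dvd of_int r - eom^2" using p(1) prime_elem_dvd_mult_iff by blast
    then have "of_int q dvd of_int r - eom \<or> of_int q dvd of_int r - eom^2" using qp dvd_trans by blast
    then have "q dvd 1" by (auto simp: eis_of_int_dvd power2_eq_square)
    then show False using q1 by auto
  qed
  ultimately have "i = 1" using i(1) by linarith
  then show ?thesis using i by auto
qed

lemma cyc_dvd_emb_prime:
  assumes "prime_elem x" "x dvd of_int (enorm p)"
  shows "x dvd emb p \<or> x dvd emb (ecnj p)"
proof -
  have "of_int (enorm p) = emb p * emb (ecnj p)" by (metis emb_simps(4,7) mult_ecnj)
  then show ?thesis using assms prime_elem_dvd_mult_iff by metis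
qed

section \<open>Absolute norms modulo 9 and the splitting of rational primes\<close>

lemma cube_mod_9: "[s ^ 3 = (s mod 3) ^ 3] (mod 9)" for s :: int
proof -
  have "3 dvd s - s mod 3" by simp
  then show ?thesis unfolding cong_iff_dvd_diff by (rule cube_cong_9)
qed

text \<open>A + B w is a^3 + w b^3 + w^2 c^3 - 3 a b c. Both the cubes and 3 a b c depend modulo 9
  only on residues modulo 3, which leaves a finite check.\<close>

lemma int_norm_form_mod_9:
  fixes a b c :: int
  defines "A \<equiv> a^3 - c^3 - 3 * a * b * c" and "B \<equiv> b^3 - c^3"
  assumes "\<not> 3 dvd a + b + c"
  shows "[A^2 - A * B + B^2 = 1] (mod 9)"
proof -
  define a' b' c' where abc: "a' = a mod 3" "b' = b mod 3" "c' = c mod 3"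
  have "3 * 3 dvd 3 * (a * b * c - a' * b' * c')"
    unfolding abc by (intro mult_dvd_mono dvd_diff_mult) auto
  then have t: "[3 * a * b * c = 3 * a' * b' * c'] (mod 9)"
    by (simp add: cong_iff_dvd_diff right_diff_distrib mult.assoc)
  define A' B' where "A' = a'^3 - c'^3 - 3 * a' * b' * c'" and "B' = b'^3 - c'^3"
  have "[A = A'] (mod 9)" "[B = B'] (mod 9)"
    unfolding A_def A'_def B_def B'_def abc
    by (intro cong_diff cube_mod_9 t[unfolded abc])+
  then have "[A^2 - A * B + B^2 = A'^2 - A' * B' + B'^2] (mod 9)"
    by (intro cong_add cong_diff cong_pow cong_mult)
  moreover have "[A'^2 - A' * B' + B'^2 = 1] (mod 9)"
  proof -
    have m: "x mod 3 \<in> {0,1,2}" for x :: int using pos_mod_bound[of 3 x] pos_mod_sign[of 3 x] by auto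
    have "a' \<in> {0,1,2}" "b' \<in> {0,1,2}" "c' \<in> {0,1,2}" unfolding abc by (rule m)+
    moreover have "\<not> 3 dvd a' + b' + c'" using assms(3) unfolding abc by presburger
    ultimately show ?thesis unfolding A'_def B'_def cong_def by auto
  qed
  ultimately show ?thesis by (rule cong_trans)
qed

lemma cube_cong_eaug: "3 * elam dvd x ^ 3 - of_int (eaug x) ^ 3"
proof -
  define s y :: eis where "s = of_int (eaug x)" and "y = of_int (e1 x)"
  have x: "x = s + y * elam" by (simp add: eis_eq_iff s_def y_def eaug_def)
  have c: "elam * (elam * (elam * z)) = - (3 * (eom * (elam * z)))" for z by (simp add: eis_eq_iff)
  have "x ^ 3 - s ^ 3 = 3 * elam * (s^2 * y + s * y^2 * elam - y^3 * eom)"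
    unfolding x power2_eq_square power3_eq_cube by (simp add: algebra_simps c)
  then show ?thesis unfolding s_def by simp
qed

lemma enorm_cong_9:
  assumes "3 * elam dvd x - y" shows "[enorm x = enorm y] (mod 9)"
proof -
  obtain t where "x - y = 3 * elam * t" using assms by (auto elim: dvdE)
  then have "x = y + 3 * elam * t" by (simp add: algebra_simps)
  then have "enorm x - enorm y = 9 * (e0 t * (e1 y - e0 y) - e1 t * e1 y
      + 3 * enorm t)"
    by (simp add: enorm_def power2_eq_square algebra_simps)
  then show ?thesis by (metis cong_iff_dvd_diff dvd_triv_left)
qed

text \<open>Replacing the coordinates by integers congruent to them modulo w - 1, and dropping the
  factor w of the mixed term, changes the norm to Z[w] by a multiple of 3 (w - 1), hence the
  absolute norm by a multiple of 9. The result limits which powers of q can be norms of primes over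
  q.\<close>

lemma cnorm_mod_9:
  assumes "\<not> lam dvd x" shows "cnorm x mod 9 = 1"
proof -
  define a b c where abc: "a = eaug (c0 x)" "b = eaug (c1 x)" "c = eaug (c2 x)"
  define M :: eis where "M = of_int a^3 + eom * of_int b^3 + eom^2 * of_int c^3 - 3 * (of_int a * of_int b * of_int c)"
  have *: "elam dvd z - of_int (eaug z)" for z
    by (simp add: elam_dvd eaug_def)
  have "elam dvd eom * (c0 x * c1 x * c2 x) - 1 * (of_int a * of_int b * of_int c)"
    unfolding abc using *[of eom] by (intro dvd_diff_mult *) simp
  then have "3 * elam dvd 3 * (eom * (c0 x * c1 x * c2 x) - of_int a * of_int b * of_int c)"
    by (intro mult_dvd_mono) auto
  then have "3 * elam dvd (c0 x^3 - of_int a^3) + eom * (c1 x^3 - of_int b^3) + eom^2 * (c2 x^3 - of_int c^3)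
      - 3 * (eom * (c0 x * c1 x * c2 x) - of_int a * of_int b * of_int c)"
    unfolding abc
    by (intro dvd_diff[OF dvd_add[OF dvd_add[OF _ dvd_mult] dvd_mult]] cube_cong_eaug)
  moreover have "cN x - M = (c0 x^3 - of_int a^3) + eom * (c1 x^3 - of_int b^3) + eom^2 * (c2 x^3 - of_int c^3)
      - 3 * (eom * (c0 x * c1 x * c2 x) - of_int a * of_int b * of_int c)"
    by (simp add: cN_def M_def algebra_simps)
  ultimately have "[cnorm x = enorm M] (mod 9)"
    unfolding cnorm_def by (metis enorm_cong_9)
  moreover have "[enorm M = 1] (mod 9)"
  proof -
    have "\<not> 3 dvd a + b + c" using assms by (simp add: lam_dvd aug_def abc)
    from int_norm_form_mod_9[OF this]
    show ?thesis by (simp add: enorm_def M_def power2_eq_square power3_eq_cube mult.assoc)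
  qed
  ultimately show ?thesis unfolding cong_def by simp
qed

lemma not_lam_dvd_if_dvd_prime:
  assumes "prime q" "q \<noteq> 3" "x dvd of_int q" shows "\<not> lam dvd x"
proof
  assume "lam dvd x"
  then have "3 dvd aug (of_int q)" using assms(3) lam_dvd by (meson dvd_trans)
  then have "3 dvd q" by simp
  then show False using assms(1,2) primes_dvd_imp_eq[of 3 q] by auto
qed

text \<open>The norm of x is q^i with 1 \<le> i \<le> 3 and must be 1 modulo 9. As q has order 3
  modulo 9, i = 3, so x exhausts p.\<close>

lemma prime_over_4_7_associated:
  assumes "prime q" "q mod 9 = 4 \<or> q mod 9 = 7" "enorm p = q"
    and x: "prime_elem x" "x dvd emb p"
  shows "\<exists>d. emb p = x * d \<and> d dvd 1"
proof -
  have q1: "q > 1" using assms(1) prime_gt_1_int by blast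
  obtain d where d: "emb p = x * d" using x(2) by (auto elim: dvdE)
  then have n: "q ^ 3 = cnorm x * cnorm d" using assms(3) by (metis cnorm_mult cnorm_simps(6))
  then have "cnorm x dvd q ^ 3" by simp
  then obtain i where i: "i \<le> 3" "cnorm x = q ^ i"
    using divides_primepow[of q "cnorm x" 3] assms(1) by auto
  have "x dvd of_int q" using x(2) mult_ecnj[of p] assms(3)
    by (metis dvd_mult2 emb_simps(4,7))
  then have "\<not> lam dvd x" using assms(1,2) by (intro not_lam_dvd_if_dvd_prime) auto
  then have m: "q ^ i mod 9 = 1" using cnorm_mod_9 i(2) by metis
  have "\<not> x dvd 1" using x(1) by (simp add: prime_elem_def)
  then have "i \<noteq> 0" using i(2) cyc_unit_iff by (metis power_0)
  moreover have "i \<noteq> 1" using m assms(2) by auto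
  moreover have "i \<noteq> 2" using m assms(2) power_mod[of q 9 2] by auto
  ultimately have "i = 3" using i(1) by linarith
  then have "cnorm d = 1" using n i(2) q1 by simp
  then show ?thesis using d cyc_unit_iff by blast
qed

text \<open>Since \<open>\<zeta>\<close> is congruent to a rational integer modulo \<open>x\<close>, the three conjugates of \<open>x\<close> over
  the Eisenstein integers are pairwise nonassociated divisors of \<open>p\<close>.\<close>

lemma prime_over_1_cN:
  assumes "prime q" "q mod 9 = 1" "enorm p = q"
    and x: "prime_elem x" "x dvd emb p"
  shows "cN x dvd p" "enorm (cN x) = q"
proof -
  have q1: "q > 1" using assms(1) prime_gt_1_int by blast
  have xq: "x dvd of_int q" using x(2) mult_ecnj[of p] assms(3)
    by (metis dvd_mult2 emb_simps(4,7))
  have nu: "\<not> x dvd 1" using x(1) by (simp add: prime_elem_def)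
  have not3: "\<not> x dvd emb elam"
  proof
    assume "x dvd emb elam"
    then have "x dvd of_int 3" by (metis dvd_mult2 emb_simps(4,7) enorm_simps(7) mult_ecnj)
    moreover have "coprime q 3"
      using assms(1,2) by (intro primes_coprime) auto
    ultimately show False using dvd_coprime_ints xq nu by blast
  qed
  obtain r where r: "q dvd r ^ 6 + r ^ 3 + 1"
    using cyclotomic_root_mod_prime[of q 3] assms by auto
  have w: "emb eom * emb eom = - 1 - emb eom" "emb eom * (emb eom * z) = - z - emb eom * z" for z
    by (simp_all add: cyc_eq_iff eom_mult)
  \<comment> \<open>Since r is a primitive ninth root of unity modulo q, r^6 + r^3 + 1 splits in
    Z[zeta] into the six factors r - e zeta^k with e a power of w and k = 1, 2. The prime x divides
    one of them.\<close>
  have split: "a ^ 3 - t ^ 3 = (a - t) * ((a - emb eom * t) * (a - emb (eom^2) * t))" for a t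
    using zet_cube by (simp add: w power2_eq_square power3_eq_cube algebra_simps)
  have "(zet^2) ^ 3 = zet ^ 3 * zet ^ 3" by (simp flip: power_mult power_add)
  then have z6: "(zet^2) ^ 3 = emb eom * emb eom" by (simp only: zet_cube)
  have "(of_int r ^ 3 - zet ^ 3) * (of_int r ^ 3 - (zet^2) ^ 3) = of_int r ^ 3 * of_int r ^ 3 + of_int r ^ 3 + 1"
    unfolding z6 unfolding zet_cube by (simp add: w algebra_simps)
  then have "of_int (r ^ 6 + r ^ 3 + 1) = (of_int r ^ 3 - zet ^ 3) * (of_int r ^ 3 - (zet^2) ^ 3)"
    by (simp flip: power_add)
  then have "x dvd (of_int r ^ 3 - zet ^ 3) * (of_int r ^ 3 - (zet^2) ^ 3)"
    using of_int_dvd_of_int[OF r] xq by (metis dvd_trans)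
  then have "x dvd of_int r - zet \<or> x dvd of_int r - emb eom * zet \<or> x dvd of_int r - emb (eom^2) * zet \<or>
      x dvd of_int r - zet^2 \<or> x dvd of_int r - emb eom * zet^2 \<or> x dvd of_int r - emb (eom^2) * zet^2"
    unfolding split prime_elem_dvd_mult_iff[OF x(1)] by blast
  moreover have "eom dvd 1" "eom^2 dvd 1" by (simp_all add: eis_unit_iff enorm_power)
  ultimately have "\<exists>k e. (k = 1 \<or> k = 2) \<and> e dvd 1 \<and> x dvd of_int r - emb e * zet ^ k"
    by (metis dvd_refl emb_simps(6) mult_1 power_one_right)
  then obtain k e where k: "k = 1 \<or> k = 2" "e dvd 1" "x dvd of_int r - emb e * zet ^ k" by blast
  \<comment> \<open>Otherwise x divides r - e zeta^k together with its image under
    \<open>sig\<close>, hence their difference, a unit times w^k - 1, against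
    \<open>not3\<close>.\<close>
  have sx: "\<not> x dvd sig x"
  proof
    assume "x dvd sig x"
    then have "x dvd of_int r - emb e * (emb eom * zet) ^ k"
      using sig_dvd[OF k(3)] by (simp, metis dvd_trans)
    then have "x dvd (of_int r - emb e * zet ^ k) - (of_int r - emb e * (emb eom * zet) ^ k)"
      using k(3) by (metis dvd_diff)
    also have "\<dots> = emb e * (emb (eom ^ k - 1) * zet ^ k)"
      by (simp add: power_mult_distrib algebra_simps)
    finally have "x dvd emb (eom ^ k - 1) \<or> x dvd emb e \<or> x dvd zet ^ k"
      using x(1) prime_elem_dvd_mult_iff by blast
    moreover have "emb e dvd 1" "zet ^ k dvd 1"
      using k(2) emb_dvd[of e 1] by (simp_all add: cyc_unit_iff cnorm_power)
    ultimately have "x dvd emb (eom ^ k - 1)" using nu dvd_trans by blast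
    moreover have "eom ^ k - 1 dvd elam"
    proof -
      have "elam = (eom ^ 2 - 1) * (- eom)" by (simp add: eis_eq_iff power2_eq_square)
      then show ?thesis using k(1) by (metis dvd_def dvd_refl elam_def power_one_right)
    qed
    ultimately show False using not3 emb_dvd dvd_trans by blast
  qed
  have sx': "\<not> sig x dvd x"
  proof
    assume "sig x dvd x"
    then have "sig (sig x) dvd sig x" "x dvd sig (sig x)" using sig_dvd sig3 by metis+
    then show False using sx dvd_trans by blast
  qed
  have "\<not> sig (sig x) dvd x" "\<not> sig (sig x) dvd sig x"
    using sx sx' sig_dvd sig3 by metis+
  have prime_sig: "prime_elem (sig y)" if "prime_elem y" for y
  proof (rule prime_elemI)
    show "sig y \<noteq> 0" using that by (metis prime_elem_def sig3 sig_simps(5))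
    show "\<not> sig y dvd 1" using that sig_dvd[of "sig y" 1] sig_dvd[of "sig (sig y)" 1] by (auto simp: prime_elem_def)
    fix a b assume "sig y dvd a * b"
    then have "y dvd sig (sig a) * sig (sig b)" using sig_dvd sig3 sig_simps(4) by metis
    then have "y dvd sig (sig a) \<or> y dvd sig (sig b)" using that prime_elem_dvd_mult_iff by blast
    then show "sig y dvd a \<or> sig y dvd b" using sig_dvd sig3 by metis
  qed
  obtain p1 where p1: "emb p = x * p1" using x(2) by (auto elim: dvdE)
  have "sig x dvd emb p" using sig_dvd[OF x(2)] by simp
  then have "sig x dvd p1" using prime_sig[OF x(1)] sx' p1 prime_elem_dvd_mult_iff by metis
  then obtain p2 where p2: "p1 = sig x * p2" by (auto elim: dvdE)
  have "sig (sig x) dvd emb p" using sig_dvd[OF \<open>sig x dvd emb p\<close>] by simp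
  then have "sig (sig x) dvd x * (sig x * p2)" unfolding p1 p2 .
  then have "sig (sig x) dvd p2"
    using prime_sig[OF prime_sig[OF x(1)]] \<open>\<not> sig (sig x) dvd x\<close> \<open>\<not> sig (sig x) dvd sig x\<close>
      prime_elem_dvd_mult_iff by metis
  then obtain p3 where p3: "p2 = sig (sig x) * p3" by (auto elim: dvdE)
  have "emb p = emb (cN x) * p3" unfolding emb_cN p1 p2 p3 by (simp add: mult.assoc)
  then show dvd: "cN x dvd p" by (metis dvd_triv_left emb_dvd_iff)
  then have "enorm (cN x) dvd q" using assms(3) by (metis dvd_def enorm_mult)
  then have "enorm (cN x) = 1 \<or> enorm (cN x) = q"
    using assms(1) enorm_nonneg prime_int_iff by metis
  moreover have "enorm (cN x) \<noteq> 1" using nu cyc_unit_iff by (simp add: cnorm_def)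
  ultimately show "enorm (cN x) = q" by blast
qed

section \<open>Normal forms modulo powers of the prime above 3\<close>

lemma eis_eval:
  "Eis a b + Eis c d = Eis (a + c) (b + d)" "Eis a b - Eis c d = Eis (a - c) (b - d)"
  "- Eis a b = Eis (- a) (- b)" "Eis a b * Eis c d = Eis (a * c - b * d) (a * d + b * c - b * d)"
  "eom = Eis 0 1" "elam = Eis (-1) 1" "0 = Eis 0 0" "1 = Eis 1 0" "numeral k = Eis (numeral k) 0"
  "ecnj (Eis a b) = Eis (a - b) (- b)" "enorm (Eis a b) = a * a - a * b + b * b"
  by (simp_all add: eis_eq_iff enorm_def power2_eq_square)

lemma cyc_eval:
  "Cyc a b c + Cyc a' b' c' = Cyc (a + a') (b + b') (c + c')"
  "Cyc a b c - Cyc a' b' c' = Cyc (a - a') (b - b') (c - c')"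
  "- Cyc a b c = Cyc (- a) (- b) (- c)"
  "Cyc a b c * Cyc a' b' c' = Cyc (a * a' + eom * (b * c' + c * b'))
    (a * b' + b * a' + eom * (c * c')) (a * c' + b * b' + c * a')"
  "zet = Cyc 0 1 0" "lam = Cyc (-1) 1 0" "0 = Cyc 0 0 0" "1 = Cyc 1 0 0" "numeral k = Cyc (numeral k) 0 0"
  "sig (Cyc a b c) = Cyc a (eom * b) (eom * eom * c)"
  "ccnj (Cyc a b c) = Cyc (ecnj a) (eom * eom * ecnj c) (eom * eom * ecnj b)"
  "cnorm (Cyc a b c) = enorm (a * a * a + eom * (b * b * b) + eom * eom * (c * c * c) - 3 * (eom * (a * b * c)))"
  by (simp_all add: cyc_eq_iff cnorm_def cN_def power2_eq_square power3_eq_cube mult.assoc)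

text \<open>Since 3 is totally ramified, the exponent of \<open>lam\<close> in x is that of 3 in the
  absolute norm. Congruences between concrete elements thus become integer computations.\<close>

lemma lam_power_dvd_iff: "lam ^ n dvd x \<longleftrightarrow> 3 ^ n dvd cnorm x"
proof
  assume "lam ^ n dvd x"
  then obtain y where "x = lam ^ n * y" by (auto elim: dvdE)
  then show "3 ^ n dvd cnorm x" by (simp add: cnorm_mult cnorm_power)
qed (rule lam_power_dvd_of_cnorm)

lemma lam_power_dvd_sig: assumes "lam ^ n dvd a" shows "lam ^ n dvd sig a"
  using assms by (simp add: lam_power_dvd_iff)

text \<open>\<open>eta\<close> is the cyclotomic unit \<open>- (\<zeta> + \<zeta>\<^sup>-\<^sup>1)\<close>, and \<open>eta4\<close> is \<open>- eta\<^sup>2 (\<zeta>\<^sup>2 + \<zeta>\<^sup>-\<^sup>2)\<close>.\<close>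

definition eta :: cyc where "eta = Cyc 0 (Eis (-1) 0) (Eis 1 1)"
definition eta4 :: cyc where "eta4 = Cyc (Eis (-2) 0) (Eis 2 1) (Eis (-2) (-1))"
definition theta :: cyc where "theta = 1 + nu"

lemma theta_eval: "theta = Cyc (Eis (-1) (-1)) (Eis (-2) (-1)) (Eis (-2) (-1))"
  by (simp add: theta_def nu_def cyc_eq_iff eis_eq_iff power2_eq_square)

lemma eta_cube: "eta ^ 3 = Cyc (Eis 1 0) (Eis (-3) 0) (Eis 3 3)"
  by (simp add: eta_def power3_eq_cube cyc_eval eis_eval)

text \<open>Norm 3^k of u - 1 means that u is 1 modulo exactly \<open>lam^k\<close>: zeta,
  \<open>eta\<close>, zeta^3, \<open>eta4\<close>, \<open>theta\<close> have levels 1 to 5, and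
  \<open>eta^3\<close> has level 6. The congruence of \<open>eta^3\<close> with 4 lets units imitate
  the integers 4 and 16 = 7 modulo \<open>lam^8\<close>.\<close>

lemma unit_lam_levels:
  shows "cnorm (zet - 1) = 3" "cnorm (eta - 1) = 9" "cnorm (zet^3 - 1) = 27" "cnorm (eta4 - 1) = 81"
    "cnorm (theta - 1) = 243" "3 ^ 6 dvd cnorm (eta^3 - 1)" "\<not> 3 ^ 7 dvd cnorm (eta^3 - 1)"
    "3 ^ 8 dvd cnorm (eta^3 - 4)"
    "cnorm eta = 1" "cnorm eta4 = 1"
  unfolding zet_cube emb_def eta_cube theta_eval unfolding eta_def eta4_def
  by (simp_all add: cyc_eval eis_eval)

text \<open>The automorphism \<open>sig\<close> moves \<open>theta\<close> exactly at level 7, and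
  its square moves it twice as far. Conjugation exchanges the classes of \<open>theta^2\<close> and
  \<open>theta\<close> modulo \<open>lam^7\<close> up to a unit. These are the moves used in
  \<open>etriv_level_5\<close>.\<close>

lemma theta_levels:
  "3 ^ 7 dvd cnorm (theta ^ 3 - 1)" "3 ^ 7 dvd cnorm (sig theta - theta)"
  "\<not> 3 ^ 8 dvd cnorm (sig theta - theta)"
  "3 ^ 8 dvd cnorm (sig (sig theta) - theta - 2 * (sig theta - theta))"
  "3 ^ 7 dvd cnorm (ccnj (theta ^ 2) * (eta ^ 3) ^ 2 - theta)"
  unfolding theta_eval eta_cube unfolding power2_eq_square power3_eq_cube
  by (simp_all add: cyc_eval eis_eval)

lemma mod_3_cases:
  fixes s t :: int
  assumes "\<not> 3 dvd t" obtains "3 dvd s" | "3 dvd s + t" | "3 dvd s + 2 * t"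
proof -
  have "3 dvd s \<or> 3 dvd s + t \<or> 3 dvd s + 2 * t" using assms by presburger
  then show thesis using that by blast
qed

text \<open>With b = 1 + lam^k s and u = 1 + lam^k t the product b u^i is 1 + lam^k (s + i t) modulo
  lam^(k+1). As t is nonzero in the residue field with three elements, some i < 3 cancels s.\<close>

lemma lam_step:
  assumes "k \<ge> 1" "lam ^ k dvd b - 1" "lam ^ k dvd u - 1" "\<not> lam ^ Suc k dvd u - 1"
  shows "\<exists>i<3. lam ^ Suc k dvd b * u ^ i - 1"
proof -
  obtain s where s: "b - 1 = lam ^ k * s" using assms(2) by (auto elim: dvdE)
  obtain t where t: "u - 1 = lam ^ k * t" using assms(3) by (auto elim: dvdE)
  have "\<not> lam dvd t" using assms(4) unfolding t by (metis mult_dvd_mono dvd_refl power_Suc2)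
  then have nt: "\<not> 3 dvd aug t" by (simp add: lam_dvd)
  have lamk: "lam dvd lam ^ k" using assms(1) by (simp add: dvd_power)
  have b: "b = 1 + lam ^ k * s" and u: "u = 1 + lam ^ k * t" using s t by (simp_all add: algebra_simps)
  consider "3 dvd aug s" | "3 dvd aug s + aug t" | "3 dvd aug s + 2 * aug t" using mod_3_cases[OF nt] .
  then show ?thesis
  proof cases
    case 1
    then have "lam dvd s" by (simp add: lam_dvd)
    then have "lam ^ k * lam dvd b * u ^ 0 - 1" using s by simp
    then show ?thesis by (intro exI[of _ 0]) (simp add: mult.commute)
  next
    case 2
    then have "lam dvd s + t" by (simp add: lam_dvd)
    then have "lam dvd (s + t) + lam ^ k * (s * t)" using lamk by (rule dvd_add[OF _ dvd_mult2])
    then have "lam ^ k * lam dvd lam ^ k * ((s + t) + lam ^ k * (s * t))" by (intro mult_dvd_mono dvd_refl)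
    also have "\<dots> = b * u ^ 1 - 1" unfolding b u by (simp add: algebra_simps)
    finally show ?thesis by (intro exI[of _ 1]) (simp add: mult.commute)
  next
    case 3
    define w where "w = t * t + 2 * (s * t) + lam ^ k * (s * t * t)"
    have "lam dvd s + 2 * t"
      using 3 aug_mult[of 2 t] by (simp add: lam_dvd cong_def) presburger
    then have "lam dvd (s + 2 * t) + lam ^ k * w" using lamk by (rule dvd_add[OF _ dvd_mult2])
    then have "lam ^ k * lam dvd lam ^ k * ((s + 2 * t) + lam ^ k * w)" by (intro mult_dvd_mono dvd_refl)
    also have "\<dots> = b * u ^ 2 - 1" unfolding b u w_def by (simp add: power2_eq_square algebra_simps)
    finally show ?thesis by (intro exI[of _ 2]) (simp add: mult.commute)
  qed
qed

lemma lam_step_unit: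
  assumes "\<exists>e. e dvd 1 \<and> lam ^ k dvd b * e - 1" "k \<ge> 1"
    and "3 ^ k dvd cnorm (u - 1)" "\<not> 3 ^ Suc k dvd cnorm (u - 1)" "cnorm u = 1"
  shows "\<exists>e. e dvd 1 \<and> lam ^ Suc k dvd b * e - 1"
proof -
  obtain e where e: "e dvd 1" "lam ^ k dvd b * e - 1" using assms(1) by blast
  have "lam ^ k dvd u - 1" "\<not> lam ^ Suc k dvd u - 1" using assms(3,4) unfolding lam_power_dvd_iff .
  then obtain i where "lam ^ Suc k dvd b * e * u ^ i - 1"
    using lam_step[OF assms(2) e(2)] by blast
  moreover have "e * u ^ i dvd 1" using e(1) assms(5) by (simp add: cyc_unit_iff cnorm_mult cnorm_power)
  ultimately show ?thesis by (metis mult.assoc)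
qed

text \<open>Units account for the levels 1, 2, 3, 4 and 6 of the filtration of the multiplicative group by
  powers of \<open>\<lambda>\<close>, and \<open>\<theta> = 1 + 3/\<lambda>\<close> accounts for level 5.\<close>

lemma normal_form:
  assumes "\<not> lam dvd b"
  shows "\<exists>e i. e dvd 1 \<and> i < 3 \<and> lam ^ 7 dvd b * e - theta ^ i"
proof -
  have "\<exists>e. e dvd 1 \<and> lam ^ 1 dvd b * e - 1"
  proof -
    have "3 dvd aug b - 1 \<or> 3 dvd aug b + 1" using assms unfolding lam_dvd by presburger
    then show ?thesis
    proof
      assume "3 dvd aug b - 1"
      then show ?thesis by (intro exI[of _ 1]) (simp add: lam_dvd)
    next
      assume "3 dvd aug b + 1"
      then have "3 dvd - aug b - 1" by presburger
      then show ?thesis by (intro exI[of _ "-1"]) (simp add: lam_dvd)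
    qed
  qed
  then have "\<exists>e. e dvd 1 \<and> lam ^ Suc 1 dvd b * e - 1"
    by (rule lam_step_unit[where u = zet]) (simp_all add: unit_lam_levels)
  then have "\<exists>e. e dvd 1 \<and> lam ^ Suc (Suc 1) dvd b * e - 1"
    by (rule lam_step_unit[where u = eta]) (simp_all add: unit_lam_levels)
  then have "\<exists>e. e dvd 1 \<and> lam ^ Suc (Suc (Suc 1)) dvd b * e - 1"
    by (rule lam_step_unit[where u = "zet^3"]) (simp_all add: unit_lam_levels cnorm_power)
  then have "\<exists>e. e dvd 1 \<and> lam ^ Suc (Suc (Suc (Suc 1))) dvd b * e - 1"
    by (rule lam_step_unit[where u = eta4]) (simp_all add: unit_lam_levels)
  then obtain e where e: "e dvd 1" "lam ^ 5 dvd b * e - 1" by (auto simp: eval_nat_numeral)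
  obtain i where i: "i < 3" "lam ^ Suc 5 dvd b * e * theta ^ i - 1"
    using lam_step[OF _ e(2), of theta] unit_lam_levels(5) by (auto simp: lam_power_dvd_iff)
  obtain j where j: "lam ^ Suc 6 dvd b * e * theta ^ i * (eta^3) ^ j - 1"
    using lam_step[of 6 "b * e * theta ^ i" "eta^3"] i(2) unit_lam_levels(6,7)
    by (auto simp: lam_power_dvd_iff)
  define f where "f = e * (eta^3) ^ j"
  have f: "f dvd 1" using e(1) by (simp add: f_def cyc_unit_iff cnorm_mult cnorm_power unit_lam_levels)
  have bf: "lam ^ 7 dvd b * f * theta ^ i - 1" using j by (simp add: f_def mult_ac)
  show ?thesis
  proof (cases "i = 0")
    case True
    then show ?thesis using f bf by (intro exI[of _ f] exI[of _ 0]) simp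
  next
    case False
    \<comment> \<open>As \<open>theta^3\<close> is 1 modulo \<open>lam^7\<close>, the factor
      \<open>theta^i\<close> passes to the other side as \<open>theta^(3 - i)\<close>.\<close>
    have "lam ^ 7 dvd theta ^ 3 - 1" using theta_levels(1) unfolding lam_power_dvd_iff .
    then have "lam ^ 7 dvd (b * f * theta ^ i - 1) * theta ^ (3 - i) - b * f * (theta ^ 3 - 1)"
      by (rule dvd_diff[OF dvd_mult2[OF bf] dvd_mult])
    also have "\<dots> = b * f - theta ^ (3 - i)"
    proof -
      have "theta ^ 3 = theta ^ i * theta ^ (3 - i)" using i(1) by (simp flip: power_add)
      then show ?thesis by (simp add: algebra_simps)
    qed
    finally show ?thesis using f False by (intro exI[of _ f] exI[of _ "3 - i"]) simp
  qed
qed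

section \<open>Units of Z[w], and detection of levels 5 and 7\<close>

abbreviation eunits :: "eis set" where
  "eunits \<equiv> {Eis 1 0, Eis (-1) 0, Eis 0 1, Eis 0 (-1), Eis 1 1, Eis (-1) (-1)}"

lemma eis_units:
  assumes "enorm u = 1"
  shows "u \<in> eunits"
proof -
  obtain a b where u: "u = Eis a b" by (cases u)
  have n: "a^2 - a * b + b^2 = 1" using assms by (simp add: u enorm_def)
  have "(2 * a - b)^2 + 3 * b^2 = 4" "(2 * b - a)^2 + 3 * a^2 = 4"
    using n by (simp_all add: power2_eq_square algebra_simps)
  then have "3 * b^2 \<le> 4" "3 * a^2 \<le> 4" by (smt (verit) zero_le_power2)+
  then have "\<bar>b\<bar>^2 < 2^2" "\<bar>a\<bar>^2 < 2^2" by simp_all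
  then have "\<bar>b\<bar> < 2" "\<bar>a\<bar> < 2"
    using power_less_imp_less_base[of "\<bar>b\<bar>" 2 2] power_less_imp_less_base[of "\<bar>a\<bar>" 2 2] by simp_all
  then have "a \<in> {-1, 0, 1}" "b \<in> {-1, 0, 1}" by auto
  then show ?thesis using n u by auto
qed

lemma etriv_cases:
  assumes "etriv a"
  obtains u where "u \<in> eunits" "9 dvd a - u * ecnj a"
proof -
  obtain u where u: "u * ecnj u = 1" "9 dvd a - u * ecnj a" using assms unfolding etriv_def by blast
  have "enorm u = 1" using u(1) mult_ecnj[of u] by (metis eis_of_int(1) eis_sel(3))
  then show thesis using that eis_units u(2) by blast
qed

text \<open>The norms of \<open>theta\<close> and \<open>theta^2\<close> are -5 - 3 w and 16 + 21 w,
  and each of the six units fails for them modulo 9. So the norm to Z[w] detects level 5.\<close>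

lemma not_etriv_theta: assumes "i < 3" "etriv (cN theta ^ i)" shows "i = 0"
proof (rule ccontr)
  have c: "cN theta = Eis (-5) (-3)"
    by (simp add: theta_eval cN_def eis_eval power2_eq_square power3_eq_cube)
  assume "i \<noteq> 0"
  with assms(1) have "i = 1 \<or> i = 2" by auto
  then have "cN theta ^ i = Eis (-5) (-3) \<or> cN theta ^ i = Eis 16 21"
    unfolding c by (auto simp: power2_eq_square eis_eval)
  with assms(2) show False
    by (elim disjE; elim ssubst[where P = etriv, rotated] etriv_cases)
      (auto simp: eis_numeral_dvd)
qed

lemma etriv_mult_unit_iff: assumes "u dvd 1" shows "etriv (a * u) \<longleftrightarrow> etriv a"
proof
  obtain v where v: "1 = u * v" using assms by (auto elim: dvdE)
  then have "v dvd 1" by (metis dvd_triv_right)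
  assume "etriv (a * u)"
  then have "etriv (a * u * v)" using \<open>v dvd 1\<close> etriv_mult etriv_unit by blast
  then show "etriv a" using v by (metis mult.assoc mult.right_neutral)
qed (use assms etriv_mult etriv_unit in blast)

lemma ctriv_mult_unit_iff: assumes "u dvd 1" shows "ctriv (a * u) \<longleftrightarrow> ctriv a"
proof
  obtain v where v: "1 = u * v" using assms by (auto elim: dvdE)
  then have "v dvd 1" by (metis dvd_triv_right)
  assume "ctriv (a * u)"
  then have "ctriv (a * u * v)" using \<open>v dvd 1\<close> ctriv_mult ctriv_unit by blast
  then show "ctriv a" using v by (metis mult.assoc mult.right_neutral)
qed (use assms ctriv_mult ctriv_unit in blast)

lemma cN_unit: "u dvd 1 \<Longrightarrow> cN u dvd 1"
  unfolding cyc_unit_iff eis_unit_iff cnorm_def .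

lemma etriv_cN_normal_form:
  assumes "e dvd 1" "lam ^ 7 dvd b * e - theta ^ i" "i < 3"
  shows "etriv (cN b) \<longleftrightarrow> i = 0"
proof -
  have "9 dvd cN (b * e) - cN (theta ^ i)"
    using three_dvd_if_lam_power[OF assms(2)] by (intro cN_cong) simp
  then have "9 dvd cN b * cN e - cN theta ^ i" by (simp add: cN_mult cN_power)
  then have "etriv (cN b * cN e) \<longleftrightarrow> etriv (cN theta ^ i)" using etriv_cong dvd_diff_sym by blast
  then have "etriv (cN b) \<longleftrightarrow> etriv (cN theta ^ i)" using etriv_mult_unit_iff cN_unit assms(1) by blast
  then show ?thesis using not_etriv_theta[OF assms(3)] etriv_of_int[of 1] by auto
qed

text \<open>Trivial norm forces exponent 0 of \<open>theta\<close> in the normal form, so x is a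
  unit times some 1 + lam^7 h. One more factor \<open>lam\<close> in h would make x trivial.\<close>

lemma ctriv_level_7:
  assumes "\<not> lam dvd x" "\<not> ctriv x" "etriv (cN x)"
  shows "\<exists>h. \<not> lam dvd h \<and> cnorm x = cnorm (1 + lam ^ 7 * h)"
proof -
  obtain e i where e: "e dvd 1" "i < 3" "lam ^ 7 dvd x * e - theta ^ i" using normal_form assms(1) by blast
  then have "i = 0" using etriv_cN_normal_form assms(3) by blast
  then obtain h where "x * e - 1 = lam ^ 7 * h" using e(3) by (auto elim: dvdE)
  then have h: "x * e = 1 + lam ^ 7 * h" by (simp add: algebra_simps)
  have "\<not> lam dvd h"
  proof
    assume "lam dvd h"
    then have "lam ^ 7 * lam dvd x * e - 1" using h by (simp add: mult_dvd_mono)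
    then have "lam ^ 8 dvd 1 - x * e" using dvd_diff_sym by (simp add: eval_nat_numeral mult_ac)
    moreover have "ctriv 1" by (rule ctriv_unit) simp
    ultimately have "ctriv (x * e)" by (rule ctriv_cong)
    then show False using assms(2) ctriv_mult_unit_iff e(1) by blast
  qed
  moreover have "cnorm x = cnorm (x * e)" using e(1) by (simp add: cnorm_mult cyc_unit_iff)
  ultimately show ?thesis using h by metis
qed

text \<open>The construction for 3^4 q needs an element of norm q in the exact class of
  \<open>theta\<close> modulo \<open>lam^8\<close>. A unit and, for exponent 2, complex conjugation
  reach that class modulo \<open>lam^7\<close>. The three classes left at level 7 are those of
  \<open>theta\<close> and its two conjugates under \<open>sig\<close>, so applying a power of
  \<open>sig\<close> finishes.\<close>

lemma etriv_level_5:
  assumes "\<not> lam dvd x" "\<not> etriv (cN x)"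
  shows "\<exists>y. cnorm y = cnorm x \<and> lam ^ 8 dvd y - theta"
proof -
  have *: "\<exists>y. cnorm y = cnorm x \<and> lam ^ 8 dvd y - theta" if e: "e dvd 1" "lam ^ 7 dvd x * e - theta" for x e
  proof -
    obtain z where z: "x * e - theta = lam ^ 7 * z" using e(2) by (auto elim: dvdE)
    have "lam ^ 7 dvd sig theta - theta" using theta_levels(2) by (simp only: lam_power_dvd_iff)
    then obtain w where w: "sig theta - theta = lam ^ 7 * w" by (auto elim: dvdE)
    have "\<not> lam ^ 8 dvd sig theta - theta" using theta_levels(3) by (simp only: lam_power_dvd_iff not_False_eq_True)
    moreover have s8: "lam ^ 7 * lam = lam ^ 8" by (simp flip: power_Suc2)
    ultimately have "\<not> lam dvd w" unfolding w by (metis mult_dvd_mono dvd_refl)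
    then have nw: "\<not> 3 dvd aug w" by (simp add: lam_dvd)
    have n: "cnorm (sig (x * e)) = cnorm x" "cnorm (x * e) = cnorm x" "cnorm (sig (sig (x * e))) = cnorm x"
      using e(1) by (simp_all add: cnorm_mult cyc_unit_iff)
    from nw have "\<not> 3 dvd - aug w" by simp
    then consider "3 dvd aug z" | "3 dvd aug z + - aug w" | "3 dvd aug z + 2 * - aug w" by (rule mod_3_cases)
    then show ?thesis
    proof cases
      case 1
      then have "lam ^ 7 * lam dvd x * e - theta" unfolding z by (intro mult_dvd_mono) (auto simp: lam_dvd)
      then show ?thesis using n s8 by metis
    next
      case 2
      then have "lam ^ 7 * lam dvd lam ^ 7 * (z - w)" by (intro mult_dvd_mono) (auto simp: lam_dvd)
      also have "lam ^ 7 * (z - w) = x * e - sig theta" using z w by (simp add: algebra_simps)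
      finally have "lam ^ 8 dvd sig (sig (x * e - sig theta))" using lam_power_dvd_sig s8 by metis
      then have "lam ^ 8 dvd sig (sig (x * e)) - theta" by (simp only: sig_simps(2) sig3)
      then show ?thesis using n by metis
    next
      case 3
      then have "lam dvd z - 2 * w" using aug_mult[of 2 w] by (simp add: lam_dvd cong_def) presburger
      then have "lam ^ 7 * lam dvd lam ^ 7 * (z - 2 * w)" by (intro mult_dvd_mono) auto
      also have "lam ^ 7 * (z - 2 * w) = (x * e - theta) - 2 * (sig theta - theta)" using z w by (simp add: algebra_simps)
      finally have "lam ^ 8 dvd (x * e - theta) - 2 * (sig theta - theta)" using s8 by simp
      moreover have "lam ^ 8 dvd (sig (sig theta) - theta) - 2 * (sig theta - theta)"
        using theta_levels(4) by (simp only: lam_power_dvd_iff)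
      ultimately have "lam ^ 8 dvd ((x * e - theta) - 2 * (sig theta - theta)) - ((sig (sig theta) - theta) - 2 * (sig theta - theta))"
        by (rule dvd_diff)
      then have "lam ^ 8 dvd x * e - sig (sig theta)" by simp
      then have "lam ^ 8 dvd sig (x * e) - theta" using lam_power_dvd_sig[of 8] by (metis sig3 sig_simps(2))
      then show ?thesis using n by metis
    qed
  qed
  obtain e i where e: "e dvd 1" "i < 3" "lam ^ 7 dvd x * e - theta ^ i" using normal_form assms(1) by blast
  have "i \<noteq> 0" using etriv_cN_normal_form e assms(2) by blast
  then consider "i = 1" | "i = 2" using e(2) by linarith
  then show ?thesis
  proof cases
    case 1
    then show ?thesis using * e by simp
  next
    case 2
    define f where "f = (eta ^ 3) ^ 2"
    have "lam ^ 7 dvd ccnj (x * e - theta ^ 2)" using lam_power_dvd_ccnj[OF e(3)] unfolding 2 .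
    then have "lam ^ 7 dvd (ccnj x * ccnj e - ccnj (theta ^ 2)) * f"
      unfolding ccnj_simps(2,4) by (rule dvd_mult2)
    then have "lam ^ 7 dvd ccnj x * (ccnj e * f) - ccnj (theta ^ 2) * f"
      by (simp only: left_diff_distrib mult.assoc)
    moreover have "lam ^ 7 dvd ccnj (theta ^ 2) * f - theta"
      using theta_levels(5) unfolding f_def by (simp only: lam_power_dvd_iff)
    ultimately have "lam ^ 7 dvd ccnj x * (ccnj e * f) - theta" by (rule dvd_diff_trans)
    moreover have "ccnj e * f dvd 1"
      using e(1) by (simp add: f_def cyc_unit_iff cnorm_mult cnorm_power unit_lam_levels)
    ultimately show ?thesis using *[of "ccnj e * f" "ccnj x"] by simp
  qed
qed

section \<open>Prime divisors of norms\<close>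

lemma ctriv_if_dvd_3:
  assumes "prime_elem x" "x dvd 3" shows "ctriv x"
proof -
  have "x dvd lam ^ 6" using assms(2) three_dvd_lam_6 by (rule dvd_trans)
  then have "x dvd lam" using assms(1) prime_elem_dvd_power by blast
  then obtain d where d: "lam = x * d" by (auto elim: dvdE)
  then have "cnorm x * cnorm d = 3" by (metis cnorm_mult cnorm_simps(8))
  moreover have "cnorm x \<noteq> 1" using assms(1) by (simp add: prime_elem_def cyc_unit_iff)
  moreover have "cnorm x = 1 \<or> cnorm x = 3"
  proof -
    have "prime (3 :: int)" by simp
    then show ?thesis using calculation(1) cnorm_simps(10)[of x] unfolding prime_int_iff by (metis dvd_triv_left)
  qed
  ultimately have "d dvd 1" by (simp add: cyc_unit_iff)
  moreover have "ctriv lam"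
    by (rule ctriv_if_dvd_ccnj) (metis ccnj_lam dvd_triv_left)
  ultimately show ?thesis using d ctriv_mult_unit_iff by metis
qed

lemma cyc_prime_cases:
  assumes "prime_elem x"
  obtains "ctriv x"
  | p u where "prime (enorm p)" "x = emb p * u" "u dvd 1" "\<not> elam dvd p" "enorm p dvd cnorm x"
  | "prime (cnorm x)" "cnorm x mod 9 = 1"
proof -
  have x: "x \<noteq> 0" "\<not> x dvd 1" using assms by (auto simp: prime_elem_def)
  obtain q where q: "prime q" "q dvd cnorm x" "x dvd of_int q"
    using prime_elem_dvd_rational_prime[OF assms cyc_dvd_cnorm] x by auto
  have "q mod 3 = 0 \<or> q mod 3 = 1 \<or> q mod 3 = 2" by presburger
  then show thesis
  proof (elim disjE)
    assume "q mod 3 = 0"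
    then have "q = 3" using q(1) primes_dvd_imp_eq[of 3 q] by auto
    then show thesis using that(1) ctriv_if_dvd_3 assms q(3) by simp
  next
    assume "q mod 3 = 2"
    then show thesis using that(1) ctriv_if_dvd_inert q by blast
  next
    assume q1: "q mod 3 = 1"
    obtain p0 where "enorm p0 = q" using enorm_prime_exists q(1) q1 by blast
    then obtain p where p: "enorm p = q" "x dvd emb p" using cyc_dvd_emb_prime[OF assms] q(3) by (metis enorm_simps(3))
    have np: "\<not> elam dvd p"
    proof
      assume "elam dvd p"
      then have "3 dvd q" using p(1) by (auto elim!: dvdE simp: enorm_mult)
      then show False using q1 by presburger
    qed
    have "q mod 9 = 1 \<or> (q mod 9 = 4 \<or> q mod 9 = 7)" using q1 by presburger
    then show thesis
    proof
      assume "q mod 9 = 1"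
      then have "cnorm x = q" using prime_over_1_cN(2)[OF q(1) _ p(1) assms p(2)] by (simp add: cnorm_def)
      then show thesis using that(3) q(1) \<open>q mod 9 = 1\<close> by simp
    next
      assume "q mod 9 = 4 \<or> q mod 9 = 7"
      then obtain d where d: "emb p = x * d" "d dvd 1"
        using prime_over_4_7_associated[OF q(1) _ p(1) assms p(2)] by auto
      obtain u where u: "1 = d * u" using d(2) by (auto elim: dvdE)
      have "x = emb p * u" using d u by (metis mult.assoc mult.right_neutral)
      then show thesis using that(2)[of p u] u p(1) q np by (metis dvd_triv_right)
    qed
  qed
qed

text \<open>A prime coming from Z[w] has norm p^3 up to a unit, which is trivial. So the responsible
  prime has degree 1 over some q = 1 modulo 9; this is the origin of the congruence condition in the
  case 3^4.\<close>

lemma nontrivial_cN_prime_divisor: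
  assumes "b \<noteq> 0" "\<not> etriv (cN b)"
  shows "\<exists>p. prime (enorm p) \<and> enorm p mod 9 = 1 \<and> \<not> etriv p \<and> enorm p dvd cnorm b"
proof -
  obtain x where x: "prime_elem x" "x dvd b" "\<not> etriv (cN x)"
    using cyc.irreducible_factor[of b "\<lambda>x. etriv (cN x)"] assms etriv_unit cN_unit etriv_mult cN_mult by metis
  from x(1) show ?thesis
  proof (cases rule: cyc_prime_cases)
    case 1
    then show ?thesis using x(3) ctriv_imp_etriv_cN by blast
  next
    case (2 p u)
    then have "etriv (p ^ 3 * cN u)" using etriv_cube etriv_mult etriv_unit cN_unit by blast
    then show ?thesis using x(3) 2 by (simp add: cN_mult)
  next
    case 3
    moreover have "cnorm x dvd cnorm b" using x(2) by (auto elim!: dvdE simp: cnorm_mult)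
    ultimately show ?thesis using x(3) by (intro exI[of _ "cN x"]) (simp add: cnorm_def)
  qed
qed

lemma lam_8_dvd_9: "lam ^ 8 dvd 9"
  unfolding lam_power_dvd_iff by (simp add: cyc_eval eis_eval)

lemma etriv_imp_ctriv_emb: assumes "etriv a" shows "ctriv (emb a)"
proof -
  obtain u where u: "u * ecnj u = 1" "9 dvd a - u * ecnj a" using assms unfolding etriv_def by blast
  have "emb u * ccnj (emb u) = 1" using arg_cong[OF u(1), of emb] by simp
  moreover have "lam ^ 8 dvd emb a - emb u * ccnj (emb a)"
    using dvd_trans[OF lam_8_dvd_9] emb_dvd[OF u(2)] by simp
  ultimately show ?thesis unfolding ctriv_def by blast
qed

text \<open>For a nontrivial prime of degree 1 the norm decides: if it is nontrivial it is the
  required p, otherwise only level 7 is left.\<close>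

lemma nontrivial_prime_divisor:
  assumes "b \<noteq> 0" "\<not> ctriv b"
  shows "(\<exists>p. prime (enorm p) \<and> \<not> etriv p \<and> enorm p dvd cnorm b) \<or>
    (\<exists>h. \<not> lam dvd h \<and> prime (cnorm (1 + lam ^ 7 * h)) \<and> cnorm (1 + lam ^ 7 * h) mod 9 = 1 \<and>
       cnorm (1 + lam ^ 7 * h) dvd cnorm b)"
proof -
  obtain x where x: "prime_elem x" "x dvd b" "\<not> ctriv x"
    using cyc.irreducible_factor[of b ctriv] assms ctriv_unit ctriv_mult by metis
  have xb: "cnorm x dvd cnorm b" using x(2) by (auto elim!: dvdE simp: cnorm_mult)
  from x(1) show ?thesis
  proof (cases rule: cyc_prime_cases)
    case 1
    then show ?thesis using x(3) by blast
  next
    case (2 p u)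
    then have "\<not> etriv p" using x(3) etriv_imp_ctriv_emb ctriv_mult_unit_iff by metis
    then show ?thesis using 2 xb dvd_trans by blast
  next
    case 3
    show ?thesis
    proof (cases "etriv (cN x)")
      case True
      have "\<not> lam dvd x"
      proof
        assume "lam dvd x"
        then have "3 dvd cnorm x" by (simp add: three_dvd_cnorm)
        then show False using 3(2) by presburger
      qed
      then show ?thesis using ctriv_level_7[OF _ x(3) True] 3 xb by metis
    next
      case False
      then show ?thesis using 3 xb by (intro disjI1 exI[of _ "cN x"]) (simp add: cnorm_def)
    qed
  qed
qed

section \<open>Primes of type 1\<close>

lemma eis_primary_associate:
  assumes "\<not> elam dvd p" shows "\<exists>u. enorm u = 1 \<and> 3 dvd e1 (u * p)"
proof -
  have "3 dvd e1 p \<or> 3 dvd e0 p - e1 p \<or> 3 dvd e0 p"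
    using assms unfolding elam_dvd by presburger
  then show ?thesis
  proof (elim disjE)
    assume "3 dvd e1 p"
    then show ?thesis by (intro exI[of _ 1]) simp
  next
    assume "3 dvd e0 p - e1 p"
    then show ?thesis by (intro exI[of _ eom]) simp
  next
    assume "3 dvd e0 p"
    then show ?thesis by (intro exI[of _ "eom^2"]) (simp add: enorm_mult power2_eq_square)
  qed
qed

text \<open>The squares of 1, 2, 4 are 1, 4, 7 modulo 9, so \<open>delta q\<close> is the square
  root of q modulo 9, unique up to sign.\<close>

lemma delta_square: "q mod 3 = 1 \<Longrightarrow> [c^2 = q] (mod 9) \<Longrightarrow> 9 dvd c - delta q \<or> 9 dvd - c - delta q"
proof -
  assume q: "q mod 3 = 1" and c: "[c^2 = q] (mod 9)"
  have "c^2 mod 9 = (c mod 9)^2 mod 9" by (simp add: power_mod)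
  then have cq: "(c mod 9)^2 mod 9 = q mod 9" using c by (simp add: cong_def)
  have "c mod 9 \<in> {0,1,2,3,4,5,6,7,8}" by auto
  moreover have "q mod 9 = 1 \<or> q mod 9 = 4 \<or> q mod 9 = 7" using q by presburger
  ultimately have "(c mod 9 - delta q) mod 9 = 0 \<or> (- (c mod 9) - delta q) mod 9 = 0"
    using cq by (auto simp: delta_def)
  then show "9 dvd c - delta q \<or> 9 dvd - c - delta q"
    by presburger
qed

text \<open>A suitable associate r of p is c + 3 k (w - 1), of norm c^2 modulo 9, so c is
  \<open>delta q\<close> up to sign modulo 9. If 3 divided k, r would be an integer modulo 9 and
  hence trivial.\<close>

lemma nontrivial_enorm_form:
  assumes "prime (enorm p)" "\<not> etriv p"
  defines "q \<equiv> enorm p"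
  shows "q mod 3 = 1 \<and> (\<exists>A B. \<not> 3 dvd A \<and>
    q = enorm (of_int (delta q) + of_int (3 * A) * elam + of_int (9 * B)))"
proof -
  have np: "\<not> elam dvd p"
  proof
    assume "elam dvd p"
    then obtain t where t: "p = elam * t" by (auto elim: dvdE)
    then have "enorm p = 3 * enorm t" by (simp add: enorm_mult)
    then have "enorm t dvd enorm p" "enorm t \<noteq> enorm p" using assms(1) by auto
    then have "enorm t = 1" using assms(1) enorm_nonneg[of t] unfolding prime_int_iff by blast
    moreover have "etriv elam"
    proof (rule etriv_if_dvd_ecnj)
      have "ecnj elam = elam * (1 + eom)" by (simp add: eis_eq_iff)
      then show "elam dvd ecnj elam" by simp
    qed
    ultimately show False using assms(2) t etriv_mult_unit_iff eis_unit_iff by metis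
  qed
  obtain u where u: "enorm u = 1" "3 dvd e1 (u * p)" using eis_primary_associate[OF np] by blast
  define r where "r = u * p"
  have nr: "\<not> etriv r" using assms(2) u(1) etriv_mult_unit_iff eis_unit_iff by (metis mult.commute r_def)
  have qr: "q = enorm r" using u(1) by (simp add: q_def r_def enorm_mult)
  obtain k where k: "e1 r = 3 * k" using u(2) r_def by (auto elim: dvdE)
  have nlr: "\<not> elam dvd r"
  proof
    assume "elam dvd r"
    then have "elam dvd (ecnj u * u) * p" by (simp add: r_def mult.assoc)
    then show False using np u(1) mult_ecnj[of u] by (simp add: mult.commute)
  qed
  define c where "c = eaug r"
  have "q - c^2 = 9 * (3 * (k * k) - k * c)"
    by (simp add: qr c_def eaug_def enorm_def k power2_eq_square algebra_simps)
  then have c9: "[c^2 = q] (mod 9)" by (metis cong_iff_dvd_diff cong_sym dvd_triv_left)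
  have "\<not> 3 dvd c" using nlr by (simp add: c_def eaug_def elam_dvd)
  then have "c mod 3 = 1 \<or> c mod 3 = 2" by presburger
  then have "c^2 mod 3 = 1" using power_mod[of c 3 2] by auto
  moreover have "[c^2 = q] (mod 3)" using c9 by (rule cong_dvd_modulus) simp
  ultimately have q3: "q mod 3 = 1" by (simp add: cong_def)
  obtain s :: int where s: "s = 1 \<or> s = -1" "9 dvd s * c - delta q"
    using delta_square[OF q3 c9] by (metis mult_1 mult_minus1)
  then obtain B where B: "s * c = delta q + 9 * B" by (metis dvd_def add.commute diff_eq_eq)
  have "\<not> 3 dvd s * k"
  proof
    assume "3 dvd s * k"
    then have "3 dvd k" using s(1) by auto
    then have "9 dvd e1 r" using k by auto
    then have "9 dvd r - of_int (e0 r)" by (simp add: eis_numeral_dvd)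
    then show False using nr etriv_if_cong_int by blast
  qed
  moreover have "of_int (delta q) + of_int (3 * (s * k)) * elam + of_int (9 * B) = of_int s * r"
    using B k by (simp add: eis_eq_iff c_def eaug_def algebra_simps)
  moreover have "q = enorm (of_int s * r)" using s(1) qr by (auto simp: enorm_mult)
  ultimately show ?thesis using q3 by metis
qed

lemma enorm_form_nontrivial:
  assumes "\<not> 3 dvd A" "d \<in> {1, 2, 4}"
  shows "\<not> etriv (of_int d + of_int (3 * A) * elam + of_int (9 * B))"
proof
  assume "etriv (of_int d + of_int (3 * A) * elam + of_int (9 * B))"
  then show False
  proof (rule etriv_cases)
    fix u assume u: "u \<in> eunits"
      and "9 dvd of_int d + of_int (3 * A) * elam + of_int (9 * B) -
        u * ecnj (of_int d + of_int (3 * A) * elam + of_int (9 * B))"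
    then have *: "9 dvd e0 (of_int d + of_int (3 * A) * elam + of_int (9 * B) -
        u * ecnj (of_int d + of_int (3 * A) * elam + of_int (9 * B)))"
      "9 dvd e1 (of_int d + of_int (3 * A) * elam + of_int (9 * B) -
        u * ecnj (of_int d + of_int (3 * A) * elam + of_int (9 * B)))"
      by (simp_all only: eis_numeral_dvd)
    then show False using u assms
      by (elim insertE emptyE; simp; presburger)
  qed
qed

text \<open>A sign change (-2 = 7 - 9) makes the constant 1 modulo 3, and conjugation adjusts A
  modulo 3. The point of \<open>3 * ecnj elam\<close> is that its product with \<open>elam\<close>
  is the integer 9, which \<open>S27_type1_243\<close> can supply by a constant term.\<close>

lemma enorm_form_adjusted:
  assumes "\<not> 3 dvd A" "d \<in> {1, 2, 4}"
  shows "\<exists>d' k. d' \<in> {1, 4, 7} \<and> enorm (of_int d + of_int (3 * A) * elam + of_int (9 * B)) =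
    enorm (of_int d' + 3 * ecnj elam + 9 * k)"
proof -
  obtain s d' c :: int where s: "s = 1 \<or> s = -1" "d' \<in> {1, 4, 7}" "s * d = d' + 9 * c"
  proof (cases "d = 2")
    case True then show thesis using that[of "-1" 7 "-1"] by simp
  next
    case False then show thesis using assms(2) that[of 1 d 0] by auto
  qed
  define A' B' where "A' = s * A" and "B' = s * B + c"
  have A': "\<not> 3 dvd A'" using assms(1) s(1) by (auto simp: A'_def)
  define p where "p = of_int d' + of_int (3 * A') * elam + of_int (9 * B')"
  have "p = of_int s * (of_int d + of_int (3 * A) * elam + of_int (9 * B))"
    using s(3) by (simp add: p_def eis_eq_iff A'_def B'_def algebra_simps)
  then have n: "enorm p = enorm (of_int d + of_int (3 * A) * elam + of_int (9 * B))"
    using s(1) by (auto simp: enorm_mult)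
  have "3 dvd A' + 1 \<or> 3 dvd A' - 1" using A' by presburger
  then show ?thesis
  proof
    assume "3 dvd A' + 1"
    then obtain m where "A' = 3 * m - 1" by (metis dvd_def add_diff_cancel_right')
    then have "p = of_int d' + 3 * ecnj elam + 9 * (of_int m * elam + 1 + of_int B')"
      by (simp add: p_def eis_eq_iff)
    then show ?thesis using n s(2) by metis
  next
    assume "3 dvd A' - 1"
    then obtain m where "A' = 3 * m + 1" by (metis dvd_def diff_add_cancel)
    then have "ecnj p = of_int d' + 3 * ecnj elam + 9 * (of_int m * ecnj elam + of_int B')"
      by (simp add: p_def eis_eq_iff)
    then show ?thesis using n s(2) by (metis enorm_simps(3))
  qed
qed

section \<open>Evaluation of integer polynomials and the cubic norm\<close>

definition evp :: "'a::comm_ring_1 \<Rightarrow> int poly \<Rightarrow> 'a" where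
  "evp x F = poly (map_poly of_int F) x"

lemma evp_0 [simp]: "evp x 0 = 0"
  by (simp add: evp_def)

lemma evp_pCons [simp]: "evp x (pCons c F) = of_int c + x * evp x F"
  by (simp add: evp_def map_poly_pCons)

lemma evp_1 [simp]: "evp x 1 = 1"
  by (simp add: one_pCons)

lemma evp_numeral [simp]: "evp x (numeral k) = numeral k"
  by (simp add: numeral_poly)

lemma evp_add [simp]: "evp x (F + G) = evp x F + evp x G"
  by (induction F G rule: poly_induct2) (simp_all add: algebra_simps)

lemma evp_smult [simp]: "evp x (Polynomial.smult c F) = of_int c * evp x F"
  by (induction F) (simp_all add: algebra_simps)

lemma evp_minus [simp]: "evp x (- F) = - evp x F"
  using evp_smult[of x "-1" F] by simp

lemma evp_diff [simp]: "evp x (F - G) = evp x F - evp x G"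
  using evp_add[of x F "- G"] by simp

lemma evp_mult [simp]: "evp x (F * G) = evp x F * evp x G"
  by (induction F) (simp_all add: algebra_simps)

lemma evp_power [simp]: "evp x (F ^ n) = evp x F ^ n"
  by (induction n) simp_all

lemma evp_pcompose: "evp x (pcompose F G) = evp (evp x G) F"
  by (induction F) (simp_all add: pcompose_pCons)

lemma evp_int: "evp x F = poly F x" for x :: int
  by (induction F) simp_all

lemma evp_sum [simp]: "evp x (sum f A) = (\<Sum>a\<in>A. evp x (f a))"
  by (induction A rule: infinite_finite_induct) simp_all

abbreviation pX :: "int poly" where "pX \<equiv> [:0, 1:]"

definition trisect :: "int poly \<Rightarrow> int poly \<Rightarrow> int poly \<Rightarrow> int poly" where
  "trisect f g h = pcompose f (pX ^ 3) + pX * pcompose g (pX ^ 3) + pX ^ 2 * pcompose h (pX ^ 3)"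

text \<open>\<open>cubic_norm F G\<close> says that \<open>G(x\<^sup>3)\<close> is the product of \<open>F(x)\<close>, \<open>F(\<omega> x)\<close>, \<open>F(\<omega>\<^sup>2 x)\<close>.\<close>

definition cubic_norm :: "int poly \<Rightarrow> int poly \<Rightarrow> bool" where
  "cubic_norm F G \<longleftrightarrow> (\<exists>f g h. F = trisect f g h \<and>
     G = f ^ 3 + pX * g ^ 3 + pX ^ 2 * h ^ 3 - 3 * pX * f * g * h)"

lemma trisect_exists: "\<exists>f g h. F = trisect f g h"
proof (induction F)
  case 0
  show ?case by (intro exI[of _ 0]) (simp add: trisect_def)
next
  case (pCons c F)
  then obtain f g h where "F = trisect f g h" by blast
  moreover have "pCons c F = [:c:] + pX * F" by simp
  ultimately have "pCons c F = trisect (pCons c h) f g"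
    by (simp add: trisect_def pcompose_pCons power2_eq_square power3_eq_cube algebra_simps)
  then show ?case by blast
qed

lemma cubic_norm_exists: obtains G where "cubic_norm F G"
  using trisect_exists[of F] unfolding cubic_norm_def by blast

lemma evp_trisect: "evp x (trisect f g h) = evp (x ^ 3) f + x * evp (x ^ 3) g + x ^ 2 * evp (x ^ 3) h"
  by (simp add: trisect_def evp_pcompose)

lemma cubic_norm_conjugates:
  assumes "cubic_norm F G" "w ^ 2 + w + 1 = 0"
  shows "evp (x ^ 3) G = evp x F * evp (w * x) F * evp (w ^ 2 * x) F"
proof -
  obtain f g h where F: "F = trisect f g h"
    and G: "G = f ^ 3 + pX * g ^ 3 + pX ^ 2 * h ^ 3 - 3 * pX * f * g * h"
    using assms(1) unfolding cubic_norm_def by blast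
  have "w * w + w + 1 = 0" using assms(2) by (simp add: power2_eq_square)
  then have w: "w * w = - 1 - w" by (metis add.assoc add.commute add_eq_0_iff diff_conv_add_uminus minus_add_distrib)
  then have w': "w * (w * z) = - z - w * z" for z
    by (metis mult.assoc left_diff_distrib mult_minus1)
  have w3: "w ^ 3 = 1" "(w ^ 2) ^ 3 = 1" by (simp_all add: power2_eq_square power3_eq_cube w w' algebra_simps)
  have x3: "(w * x) ^ 3 = x ^ 3" "(w ^ 2 * x) ^ 3 = x ^ 3" by (simp_all only: power_mult_distrib w3 mult_1)
  show ?thesis unfolding F G evp_trisect x3
    by (simp add: power2_eq_square power3_eq_cube w w' algebra_simps)
qed

lemma evp_zet_trisect: "evp zet (trisect f g h) = Cyc (evp eom f) (evp eom g) (evp eom h)"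
proof -
  have "evp (emb a) F = emb (evp a F)" for a F by (induction F) simp_all
  then show ?thesis unfolding evp_trisect zet_cube by (simp add: cyc_eq_iff power2_eq_square)
qed

lemma cubic_norm_cN: assumes "cubic_norm F G" shows "evp eom G = cN (evp zet F)"
  using assms unfolding cubic_norm_def by (auto simp: evp_zet_trisect cN_def)

text \<open>This is a^3 + b^3 + c^3 - 3 a b c = (a + b + c) N(a + b w + c w^2), taken at the values
  of the three parts of F at 1.\<close>

lemma cubic_norm_at_1:
  assumes "cubic_norm F G" shows "poly G 1 = poly F 1 * enorm (evp eom F)"
proof -
  obtain f g h where F: "F = trisect f g h"
    and G: "G = f ^ 3 + pX * g ^ 3 + pX ^ 2 * h ^ 3 - 3 * pX * f * g * h"
    using assms unfolding cubic_norm_def by blast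
  have one: "evp 1 f = (of_int (poly f 1) :: eis)" for f by (induction f) simp_all
  define a b c where "a = poly f 1" "b = poly g 1" "c = poly h 1"
  have "evp eom F = Eis (a - c) (b - c)"
    unfolding F evp_trisect eom_cube one by (simp add: eis_eq_iff a_b_c_def power2_eq_square)
  moreover have "poly F 1 = a + b + c"
    unfolding F using evp_trisect[of "1::int" f g h] by (simp add: evp_int a_b_c_def)
  moreover have "poly G 1 = a^3 + b^3 + c^3 - 3 * a * b * c"
    unfolding G by (simp add: a_b_c_def)
  ultimately show ?thesis by (simp add: enorm_def power2_eq_square power3_eq_cube algebra_simps)
qed

lemma poly_cube_cong_3: "\<exists>h. f ^ 3 = pcompose f (pX ^ 3) + 3 * h" for f :: "int poly"
proof (induction f)
  case 0
  show ?case by (intro exI[of _ 0]) simp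
next
  case (pCons c f)
  then obtain h where h: "f ^ 3 = pcompose f (pX ^ 3) + 3 * h" by blast
  have "[c ^ 3 = c] (mod 3)" by (rule cube_cong_3)
  then obtain d where d: "c ^ 3 = c + 3 * d" by (metis cong_iff_lin cong_sym)
  have "[:c:] ^ 3 = [:c ^ 3:]" by (simp add: power3_eq_cube)
  then have c3: "[:c:] ^ 3 = [:c:] + 3 * [:d:]" by (simp add: d numeral_poly)
  have cube: "(a + b) ^ 3 = a ^ 3 + b ^ 3 + 3 * (a ^ 2 * b + a * b ^ 2)" for a b :: "int poly"
    by (simp add: power2_eq_square power3_eq_cube algebra_simps)
  have "pCons c f = [:c:] + pX * f" by simp
  then have "pCons c f ^ 3 = [:c:] ^ 3 + pX ^ 3 * f ^ 3 + 3 * ([:c:] ^ 2 * (pX * f) + [:c:] * (pX * f) ^ 2)"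
    by (simp only: cube power_mult_distrib[of pX f 3])
  also have "\<dots> = pcompose (pCons c f) (pX ^ 3) + 3 * ([:d:] + pX ^ 3 * h + [:c:] ^ 2 * (pX * f) + [:c:] * (pX * f) ^ 2)"
    unfolding c3 h pcompose_pCons by (simp only: distrib_left add_ac mult_ac)
  finally show ?case by blast
qed

text \<open>Modulo 3 the mixed term vanishes and cubing f, g, h substitutes x^3 for x, which
  reassembles F.\<close>

lemma cubic_norm_cong_3:
  assumes "cubic_norm F G" shows "\<exists>H. G = F + 3 * H"
proof -
  obtain f g h where F: "F = trisect f g h"
    and G: "G = f ^ 3 + pX * g ^ 3 + pX ^ 2 * h ^ 3 - 3 * pX * f * g * h"
    using assms unfolding cubic_norm_def by blast
  obtain a b c where "f ^ 3 = pcompose f (pX ^ 3) + 3 * a" "g ^ 3 = pcompose g (pX ^ 3) + 3 * b"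
    "h ^ 3 = pcompose h (pX ^ 3) + 3 * c" using poly_cube_cong_3 by metis
  then have "G = F + 3 * (a + pX * b + pX ^ 2 * c - pX * f * g * h)"
    unfolding F G trisect_def by (simp only: distrib_left right_diff_distrib mult_ac add_ac) algebra
  then show ?thesis by blast
qed

lemma eaug_evp: "[eaug (evp eom F) = poly F 1] (mod 3)"
proof (induction F)
  case (pCons c F)
  have "[eaug (eom * evp eom F) = 1 * eaug (evp eom F)] (mod 3)" using eaug_mult[of eom] by simp
  then show ?case using pCons.IH by (simp add: cong_add cong_trans)
qed simp

lemma aug_evp: "[aug (evp zet F) = poly F 1] (mod 3)"
proof (induction F)
  case (pCons c F)
  have "[aug (zet * evp zet F) = 1 * aug (evp zet F)] (mod 3)" using aug_mult[of zet] by simp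
  then show ?case using pCons.IH by (simp add: cong_add cong_trans)
qed simp

lemma evp_zet_surj: "\<exists>F. evp zet F = b"
proof -
  define F where "F = [:e0 (c0 b), e0 (c1 b), e0 (c2 b), e1 (c0 b), e1 (c1 b), e1 (c2 b):]"
  have "evp zet F = b" unfolding F_def by (simp add: cyc_eq_iff eis_eq_iff)
  then show ?thesis by blast
qed

lemma evp_eom_surj: "\<exists>F. evp eom F = a"
  by (intro exI[of _ "[:e0 a, e1 a:]"]) (simp add: eis_eq_iff)

lemma lam_dvd_evp: "lam dvd evp zet F \<longleftrightarrow> 3 dvd poly F 1"
  unfolding lam_dvd using aug_evp by (rule cong_dvd_iff)

section \<open>Norms as products over roots of unity\<close>

lemma ecx_evp: "ecx (evp a F) = evp (ecx a) F"
  by (induction F) simp_all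

lemma evp_complex_cnj: "evp (cnj z) F = cnj (evp z F)"
  by (induction F) simp_all

lemma omega_power_nat: "omega k ^ n = cis (2 * pi * real n / 3 ^ k)"
proof -
  have "omega k ^ n = cis (real n * (2 * pi / 3 ^ k))" by (simp only: omega_def Complex.DeMoivre)
  then show ?thesis by (simp only: times_divide_eq_right mult_ac)
qed

lemma omega_Suc_cube: "omega (Suc k) ^ 3 = omega k"
  unfolding omega_power_nat by (simp add: omega_def)

lemma omega_pow_eq_1: "omega k ^ (3 ^ k) = 1"
  unfolding omega_power_nat by simp

lemma omega_pow_com: "omega (Suc k) ^ (3 ^ k) = com"
  unfolding omega_power_nat com_def by (simp add: omega_def)

lemma com_cube: "com ^ 3 = 1"
  using omega_pow_eq_1[of 1] by (simp add: com_def)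

lemma com_relation: "com ^ 2 + com + 1 = 0"
  by (simp add: com_sq)

lemma Nk_evp: "Nk k F = (\<Prod>j\<in>{j\<in>{1..3^k}. \<not> 3 dvd j}. evp (omega k ^ j) F)"
  by (simp add: Nk_def evp_def)

lemma Nk_1: "Nk 1 F = of_int (enorm (evp eom F))"
proof -
  have "{j\<in>{1..3^1}. \<not> 3 dvd j} = {1, 2::nat}"
  proof -
    have "{1..3::nat} = {1, 2, 3}" by auto
    then show ?thesis by auto
  qed
  then have "Nk 1 F = evp com F * evp (com ^ 2) F" unfolding Nk_evp by (simp add: com_def)
  also have "\<dots> = ecx (evp eom F) * cnj (ecx (evp eom F))"
    by (simp add: ecx_evp evp_complex_cnj[symmetric] cnj_com)
  finally show ?thesis by (simp add: of_int_enorm)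
qed

lemma Nk_2: "Nk 2 F = of_int (cnorm (evp zet F))"
proof -
  obtain G where G: "cubic_norm F G" by (rule cubic_norm_exists)
  define z where "z = omega 2"
  have c: "com = z ^ 3" using omega_pow_com[of 1] by (simp add: z_def numeral_2_eq_2)
  have z9: "z ^ 9 = 1" using omega_pow_eq_1[of 2] by (simp add: z_def)
  have "{j\<in>{1..3^2}. \<not> 3 dvd j} = {1, 2, 4, 5, 7, 8::nat}"
  proof -
    have "{1..9::nat} = {1, 2, 3, 4, 5, 6, 7, 8, 9}" by auto
    then show ?thesis by auto
  qed
  \<comment> \<open>Exponents are grouped by residue modulo 3: each triple is an orbit under
    multiplication by z^3 = w and hence yields one value of G.\<close>
  then have "Nk 2 F = (evp z F * evp (z ^ 4) F * evp (z ^ 7) F) * (evp (z ^ 2) F * evp (z ^ 5) F * evp (z ^ 8) F)"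
    unfolding Nk_evp z_def by simp
  also have "evp z F * evp (z ^ 4) F * evp (z ^ 7) F = evp (z ^ 3) G"
    unfolding cubic_norm_conjugates[OF G com_relation] c
    by (simp flip: power_mult power_add power_Suc2)
  also have "evp (z ^ 2) F * evp (z ^ 5) F * evp (z ^ 8) F = evp ((z ^ 2) ^ 3) G"
    unfolding cubic_norm_conjugates[OF G com_relation] c
    by (simp flip: power_mult power_add power_Suc2)
  also have "(z ^ 2) ^ 3 = com ^ 2" unfolding c by (simp flip: power_mult)
  also have "evp (z ^ 3) G * evp (com ^ 2) G = ecx (evp eom G) * cnj (ecx (evp eom G))"
    by (simp add: ecx_evp evp_complex_cnj[symmetric] cnj_com c[symmetric])
  finally show ?thesis by (simp add: of_int_enorm[symmetric] cubic_norm_cN[OF G] cnorm_def)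
qed

lemma prod_roots_of_unity_step:
  assumes "cubic_norm F G"
  shows "(\<Prod>j<3 ^ Suc k. evp (omega (Suc k) ^ j) F) = (\<Prod>j<3 ^ k. evp (omega k ^ j) G)"
proof -
  let ?f = "\<lambda>j. evp (omega (Suc k) ^ j) F"
  have "(\<Prod>j<3 ^ Suc k. ?f j) = (\<Prod>m<3. \<Prod>j\<in>{m * 3 ^ k..<m * 3 ^ k + 3 ^ k}. ?f j)"
    by (simp add: prod.nat_group)
  also have "\<dots> = (\<Prod>m<3. \<Prod>j<3 ^ k. ?f (j + m * 3 ^ k))"
  proof (rule prod.cong[OF refl])
    fix m :: nat
    show "(\<Prod>j\<in>{m * 3 ^ k..<m * 3 ^ k + 3 ^ k}. ?f j) = (\<Prod>j<3 ^ k. ?f (j + m * 3 ^ k))"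
      by (rule prod.reindex_bij_witness[of _ "\<lambda>j. j + m * 3 ^ k" "\<lambda>j. j - m * 3 ^ k"]) auto
  qed
  also have "\<dots> = (\<Prod>j<3 ^ k. \<Prod>m<3. ?f (j + m * 3 ^ k))" by (rule prod.swap)
  also have "\<dots> = (\<Prod>j<3 ^ k. evp (omega k ^ j) G)"
  proof (intro prod.cong refl)
    fix j
    define x where "x = omega (Suc k) ^ j"
    have "omega (Suc k) ^ (j + m * 3 ^ k) = com ^ m * x" for m
    proof -
      have "omega (Suc k) ^ (m * 3 ^ k) = (omega (Suc k) ^ (3 ^ k)) ^ m"
        by (simp add: power_mult[symmetric] mult.commute)
      then show ?thesis by (simp add: power_add omega_pow_com x_def)
    qed
    then have "(\<Prod>m<3. ?f (j + m * 3 ^ k)) = evp x F * evp (com * x) F * evp (com ^ 2 * x) F"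
      by (simp add: eval_nat_numeral)
    also have "\<dots> = evp (x ^ 3) G" using cubic_norm_conjugates[OF assms com_relation] by simp
    also have "x ^ 3 = (omega (Suc k) ^ 3) ^ j"
      by (simp add: x_def power_mult[symmetric] mult.commute)
    also have "\<dots> = omega k ^ j" by (simp only: omega_Suc_cube)
    finally show "(\<Prod>m<3. ?f (j + m * 3 ^ k)) = evp (omega k ^ j) G" .
  qed
  finally show ?thesis .
qed

text \<open>Three steps reach G''(1), and \<open>cubic_norm_at_1\<close> unwinds it into values at
  1, w and zeta. The primitive 27th roots of unity enter only through G(zeta), so the arithmetic
  stays in the two rings above.\<close>

lemma prod_roots_of_unity_27:
  assumes "cubic_norm F G"
  shows "(\<Prod>j<27. evp (omega 3 ^ j) F) =
    of_int (poly F 1 * enorm (evp eom F) * cnorm (evp zet F) * cnorm (evp zet G))"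
proof -
  obtain G' where G': "cubic_norm G G'" by (rule cubic_norm_exists)
  obtain G'' where G'': "cubic_norm G' G''" by (rule cubic_norm_exists)
  have "(\<Prod>j<27. evp (omega 3 ^ j) F) = (\<Prod>j<3 ^ 0. evp (omega 0 ^ j) G'')"
    using prod_roots_of_unity_step[OF assms, of 2] prod_roots_of_unity_step[OF G', of 1]
      prod_roots_of_unity_step[OF G'', of 0] by (simp add: eval_nat_numeral)
  also have "\<dots> = of_int (poly G'' 1)"
  proof -
    have "evp 1 F = (of_int (poly F 1) :: complex)" for F by (induction F) simp_all
    then show ?thesis by simp
  qed
  also have "poly G'' 1 = poly F 1 * enorm (evp eom F) * cnorm (evp zet F) * cnorm (evp zet G)"
    unfolding cubic_norm_at_1[OF G''] cubic_norm_at_1[OF G'] cubic_norm_at_1[OF assms]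
      cubic_norm_cN[OF G'] cubic_norm_cN[OF assms] cnorm_def by simp
  finally show ?thesis .
qed

lemma type1_iff: "type1 q \<longleftrightarrow> prime q \<and> q mod 3 = 1 \<and>
  (\<exists>A B. \<not> 3 dvd A \<and> q = enorm (of_int (delta q) + of_int (3 * A) * elam + of_int (9 * B)))"
proof -
  have e: "evp eom ([:delta q:] + Polynomial.smult (3 * A) [:-1, 1:] + [:9 * B:]) =
      of_int (delta q) + of_int (3 * A) * elam + of_int (9 * B)" for A B
    by (simp add: elam_def algebra_simps)
  show ?thesis unfolding type1_def Nk_1 of_int_eq_iff e ..
qed

lemma type1_if_nontrivial: "prime (enorm p) \<Longrightarrow> \<not> etriv p \<Longrightarrow> type1 (enorm p)"
  unfolding type1_iff using nontrivial_enorm_form by blast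

lemma type3_iff: "type3 q \<longleftrightarrow> prime q \<and> q mod 9 = 1 \<and> (\<exists>h. \<not> lam dvd h \<and> q = cnorm (1 + lam ^ 7 * h))"
proof -
  have e: "evp zet (1 + [:-1, 1:] ^ 7 * h) = 1 + lam ^ 7 * evp zet h" for h
    by (simp add: lam_def)
  have "(\<exists>h. \<not> 3 dvd poly h 1 \<and> of_int q = Nk 2 (1 + [:-1, 1:] ^ 7 * h)) \<longleftrightarrow>
      (\<exists>h. \<not> lam dvd evp zet h \<and> q = cnorm (1 + lam ^ 7 * evp zet h))"
    unfolding Nk_2 of_int_eq_iff lam_dvd_evp e ..
  then show ?thesis unfolding type3_def using evp_zet_surj by metis
qed

section \<open>Circulant determinants\<close>

definition idx :: "27 \<Rightarrow> nat" where "idx x = nat (Rep_bit1 x)"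

lemma Rep_27: "0 \<le> Rep_bit1 (x :: 27)" "Rep_bit1 (x :: 27) < 27"
  using Rep_bit1[of x] by auto

lemma idx_less: "idx x < 27"
  using Rep_27[of x] by (simp add: idx_def)

lemma idx_0 [simp]: "idx 0 = 0"
  by (simp add: idx_def bit1.Rep_0)

lemma idx_add: "idx (x + y) = (idx x + idx y) mod 27"
proof -
  have "Rep_bit1 (x + y) = (Rep_bit1 x + Rep_bit1 y) mod 27"
    unfolding bit1.add_def bit1.Rep_Abs_mod by simp
  then show ?thesis using Rep_27[of x] Rep_27[of y] by (simp add: idx_def nat_mod_distrib nat_add_distrib)
qed

lemma idx_1: "idx 1 = 1"
  by (simp add: idx_def bit1.Rep_1)

lemma bij_idx: "bij_betw idx UNIV {..<27}"
proof (rule bij_betwI[where g = "\<lambda>n. Abs_bit1 (int n)"])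
  show "Abs_bit1 (int (idx x)) = x" for x :: 27
    using Rep_27[of x] by (simp add: idx_def Rep_bit1_inverse)
  show "idx (Abs_bit1 (int n)) = n" if "n \<in> {..<27}" for n
    using that by (simp add: idx_def Abs_bit1_inverse)
qed (auto simp: idx_less)

lemma power_mod_27: "z ^ 27 = 1 \<Longrightarrow> z ^ (n mod 27) = (z ^ n :: complex)"
  by (metis mult_div_mod_eq power_add power_mult power_one mult_1)

lemma power_idx_add: "z ^ 27 = 1 \<Longrightarrow> z ^ idx (x + y) = (z ^ idx x * z ^ idx y :: complex)"
  unfolding idx_add power_mod_27 by (rule power_add)

lemma of_int_det: "of_int (det A) = det (\<chi> i j. complex_of_int (A $ i $ j))"
  by (simp add: det_def)

lemma omega_3_27: "omega 3 ^ 27 = 1"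
  using omega_pow_eq_1[of 3] by simp

lemma omega_3_inj: assumes "omega 3 ^ i = omega 3 ^ j" "i < 27" "j < 27" shows "i = j"
proof -
  have "bij_betw (\<lambda>k. cis (2 * pi * real k / real 27)) {..<27} {z. z ^ 27 = 1}"
    by (rule Complex.bij_betw_roots_unity) simp
  then have "inj_on (\<lambda>k. cis (2 * pi * real k / real 27)) {..<27}" by (rule bij_betw_imp_inj_on)
  moreover have "cis (2 * pi * real i / real 27) = cis (2 * pi * real j / real 27)"
    using assms(1) by (simp add: omega_power_nat)
  ultimately show ?thesis using assms(2,3) by (auto dest: inj_onD)
qed

text \<open>The Fourier matrix \<open>V\<close> diagonalises circulant matrices. It is invertible
  because \<open>V' ** V\<close> is 27 times the identity, by orthogonality of characters.\<close>

lemma det_circulant27: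
  "of_int (det (circulant27 a)) = (\<Prod>j<27. \<Sum>x\<in>UNIV. of_int (a x) * (omega 3 ^ j) ^ idx x)"
proof -
  define w where "w = omega 3"
  have w27: "w ^ 27 = 1" and w0: "w \<noteq> 0" using omega_3_27 by (auto simp: w_def)
  have wi: "(w ^ i) ^ 27 = 1" for i using w27 by (metis power_mult mult.commute power_one)
  define M :: "complex^27^27" where "M = (\<chi> i j. of_int (a (j - i)))"
  define V :: "complex^27^27" where "V = (\<chi> i j. (w ^ idx j) ^ idx i)"
  define V' :: "complex^27^27" where "V' = (\<chi> i j. (inverse w ^ idx j) ^ idx i)"
  define ev where "ev j = (\<Sum>x\<in>UNIV. of_int (a x) * (w ^ idx j) ^ idx x)" for j :: 27
  define D :: "complex^27^27" where "D = (\<chi> i j. if i = j then ev i else 0)"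
  have "M ** V = V ** D"
  proof (subst vec_eq_iff, intro allI, subst vec_eq_iff, intro allI)
    fix i j
    have "(M ** V) $ i $ j = (\<Sum>k\<in>UNIV. of_int (a (k - i)) * (w ^ idx j) ^ idx k)"
      by (simp add: matrix_matrix_mult_def M_def V_def)
    also have "\<dots> = (\<Sum>l\<in>UNIV. of_int (a l) * (w ^ idx j) ^ idx (l + i))"
      by (rule sum.reindex_bij_witness[of _ "\<lambda>l. l + i" "\<lambda>k. k - i"]) auto
    also have "\<dots> = (w ^ idx j) ^ idx i * ev j"
      by (simp add: power_idx_add[OF wi] ev_def sum_distrib_left mult_ac)
    also have "\<dots> = (V ** D) $ i $ j"
      by (simp add: matrix_matrix_mult_def V_def D_def if_distrib[of "\<lambda>x. _ * x"] cong: if_cong)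
    finally show "(M ** V) $ i $ j = (V ** D) $ i $ j" .
  qed
  then have "det M * det V = det V * det D" by (metis det_mul)
  moreover have "det V \<noteq> 0"
  proof
    assume "det V = 0"
    have VV: "V' ** V = (\<chi> i j. if i = j then 27 else 0)"
    proof (subst vec_eq_iff, intro allI, subst vec_eq_iff, intro allI)
      fix i j
      define z where "z = w ^ idx j * inverse w ^ idx i"
      have "(V' ** V) $ i $ j = (\<Sum>k\<in>UNIV. (inverse w ^ idx k) ^ idx i * (w ^ idx j) ^ idx k)"
        by (simp add: matrix_matrix_mult_def V_def V'_def)
      also have "\<dots> = (\<Sum>k\<in>UNIV. z ^ idx k)"
        by (simp add: z_def power_mult_distrib power_mult[symmetric] mult_ac)
      also have "\<dots> = (\<Sum>k<27. z ^ k)" by (rule sum.reindex_bij_betw[OF bij_idx])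
      also have "\<dots> = (if i = j then 27 else 0)"
      proof (cases "i = j")
        case True
        then have "z = 1" using w0 by (simp add: z_def power_mult_distrib[symmetric])
        then show ?thesis using True by simp
      next
        case False
        have "z \<noteq> 1"
        proof
          assume "z = 1"
          then have "w ^ idx j = w ^ idx i" using w0 by (simp add: z_def power_inverse field_simps)
          then have "idx j = idx i" unfolding w_def by (intro omega_3_inj idx_less)
          then show False using False bij_idx by (auto simp: bij_betw_def dest: injD)
        qed
        moreover have "z ^ 27 = 1"
          using wi[of "idx j"] wi[of "idx i"] by (simp add: z_def power_mult_distrib power_inverse)
        ultimately show ?thesis using False by (simp add: sum_gp_strict)
      qed
      finally show "(V' ** V) $ i $ j = (\<chi> i j. if i = j then 27 else 0) $ i $ j" by simp
    qed
    have "det (V' ** V) = 27 ^ 27" unfolding VV by (subst det_diagonal) auto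
    then show False using \<open>det V = 0\<close> by (simp add: det_mul)
  qed
  ultimately have "det M = det D" by simp
  also have "det D = (\<Prod>j\<in>UNIV. ev j)" unfolding D_def by (subst det_diagonal) auto
  also have "\<dots> = (\<Prod>j<27. \<Sum>x\<in>UNIV. of_int (a x) * (w ^ j) ^ idx x)"
    unfolding ev_def by (rule prod.reindex_bij_betw[OF bij_idx])
  finally show ?thesis unfolding of_int_det circulant27_def M_def w_def by simp
qed

lemma evp_monom: "evp z (Polynomial.monom c n) = of_int c * z ^ n"
  by (induction n) (simp_all add: monom_0 monom_Suc mult_ac)

text \<open>Reduction modulo x^27 - 1: multiplication by x rotates the coefficient vector.\<close>

lemma evp_reduced_exists: "\<exists>a. \<forall>z::complex. z ^ 27 = 1 \<longrightarrow> evp z F = (\<Sum>x\<in>UNIV. of_int (a x) * z ^ idx x)"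
proof (induction F)
  case 0
  show ?case by (intro exI[of _ "\<lambda>_. 0"]) simp
next
  case (pCons c F)
  then obtain a where a: "\<And>z::complex. z ^ 27 = 1 \<Longrightarrow> evp z F = (\<Sum>x\<in>UNIV. of_int (a x) * z ^ idx x)" by blast
  show ?case
  proof (intro exI[of _ "\<lambda>x. a (x - 1) + (if x = 0 then c else 0)"] allI impI)
    fix z :: complex assume z: "z ^ 27 = 1"
    have "(\<Sum>x\<in>UNIV. of_int (a (x - 1) + (if x = 0 then c else 0)) * z ^ idx x) =
      (\<Sum>x\<in>UNIV. of_int (a (x - 1)) * z ^ idx x) + (\<Sum>x\<in>UNIV. (if x = 0 then of_int c else 0) * z ^ idx x)"
      unfolding sum.distrib[symmetric] by (intro sum.cong) (auto simp: algebra_simps)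
    also have "(\<Sum>x\<in>UNIV. (if x = 0 then of_int c else 0) * z ^ idx x) = (\<Sum>x\<in>UNIV. if x = (0::27) then of_int c else 0)"
      by (intro sum.cong) auto
    also have "\<dots> = of_int c" by simp
    also have "(\<Sum>x\<in>UNIV. of_int (a (x - 1)) * z ^ idx x) = (\<Sum>x\<in>UNIV. of_int (a x) * z ^ idx (x + 1))"
      by (rule sum.reindex_bij_witness[of _ "\<lambda>x. x + 1" "\<lambda>x. x - 1"]) auto
    also have "\<dots> = z * evp z F"
      unfolding a[OF z] power_idx_add[OF z] by (simp add: idx_1 sum_distrib_left mult_ac)
    finally show "evp z (pCons c F) = (\<Sum>x\<in>UNIV. of_int (a (x - 1) + (if x = 0 then c else 0)) * z ^ idx x)"
      by (simp add: add.commute)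
  qed
qed

lemma S27_prod_iff: "n \<in> S27 \<longleftrightarrow> (\<exists>F. of_int n = (\<Prod>j<27. evp (omega 3 ^ j) F))"
proof
  assume "n \<in> S27"
  then obtain a where n: "n = det (circulant27 a)" unfolding S27_def by blast
  define F where "F = (\<Sum>x\<in>UNIV. Polynomial.monom (a x) (idx x))"
  have "of_int n = (\<Prod>j<27. evp (omega 3 ^ j) F)"
    unfolding n det_circulant27 F_def by (simp add: evp_monom)
  then show "\<exists>F. of_int n = (\<Prod>j<27. evp (omega 3 ^ j) F)" by blast
next
  assume "\<exists>F. of_int n = (\<Prod>j<27. evp (omega 3 ^ j) F)"
  then obtain F where F: "of_int n = (\<Prod>j<27. evp (omega 3 ^ j) F)" by blast
  obtain a where a: "\<And>z::complex. z ^ 27 = 1 \<Longrightarrow> evp z F = (\<Sum>x\<in>UNIV. of_int (a x) * z ^ idx x)"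
    using evp_reduced_exists by blast
  have "(omega 3 ^ j) ^ 27 = 1" for j using omega_3_27 by (metis power_mult mult.commute power_one)
  then have "of_int n = (of_int (det (circulant27 a)) :: complex)" unfolding F det_circulant27 by (simp add: a)
  then show "n \<in> S27" unfolding S27_def by auto
qed

lemma S27_iff:
  "n \<in> S27 \<longleftrightarrow> (\<exists>F G. cubic_norm F G \<and> n = poly F 1 * enorm (evp eom F) * cnorm (evp zet F) * cnorm (evp zet G))"
  unfolding S27_prod_iff by (metis prod_roots_of_unity_27 cubic_norm_exists of_int_eq_iff)

lemma S27_mult: assumes "m \<in> S27" "n \<in> S27" shows "m * n \<in> S27"
proof -
  obtain F G where "of_int m = (\<Prod>j<27. evp (omega 3 ^ j) F)" "of_int n = (\<Prod>j<27. evp (omega 3 ^ j) G)"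
    using assms unfolding S27_prod_iff by blast
  then have "of_int (m * n) = (\<Prod>j<27. evp (omega 3 ^ j) (F * G))" by (simp add: prod.distrib)
  then show ?thesis unfolding S27_prod_iff by blast
qed

section \<open>Realising determinants\<close>

definition geom :: "nat \<Rightarrow> int poly" where "geom n = (\<Sum>i<n. pX ^ i)"

lemma evp_geom: "evp z (geom n) = (\<Sum>i<n. z ^ i)"
  by (simp add: geom_def)

lemma geom_mult: "(z - 1) * evp z (geom n) = z ^ n - 1"
  by (simp add: evp_geom power_diff_1_eq)

text \<open>Take (x^m - 1) / (x - 1) + h (x^27 - 1) / (x - 1) with n = m + 27 h. Its value at 1 is
  n. At the other 27th roots of unity the second summand vanishes, and the first has product 1
  because z to z^m permutes these roots.\<close>

lemma S27_coprime: assumes "\<not> 3 dvd n" shows "n \<in> S27"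
proof -
  define m where "m = nat (n mod 27)"
  define h where "h = n div 27"
  have n: "n = int m + h * 27" by (simp add: m_def h_def)
  have m3: "\<not> 3 dvd m"
  proof
    assume "3 dvd m"
    then have "(3::int) dvd int m" using int_dvd_int_iff[of 3 m] by simp
    then show False using assms n by simp
  qed
  have cop: "coprime m 27"
  proof -
    have "coprime 3 m" using m3 prime_imp_coprime[of 3 m] by simp
    then have "coprime (3 ^ 3) m" by (rule coprime_power_left_iff[THEN iffD2, OF disjI1])
    then show ?thesis by (simp add: coprime_commute)
  qed
  define w where "w = omega 3"
  have w27: "w ^ 27 = 1" using omega_3_27 by (simp add: w_def)
  have wi: "(w ^ j) ^ 27 = 1" for j using w27 by (metis power_mult mult.commute power_one)
  have w1: "w ^ j \<noteq> 1" if "j \<in> {1..<27}" for j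
  proof
    assume "w ^ j = 1"
    then have "omega 3 ^ j = omega 3 ^ 0" by (simp add: w_def)
    then have "j = 0" using that by (intro omega_3_inj) auto
    then show False using that by simp
  qed
  have g27: "evp (w ^ j) (geom 27) = 0" if "j \<in> {1..<27}" for j
    using geom_mult[of "w ^ j" 27] w1[OF that] wi by simp
  have bij: "bij_betw (\<lambda>j. (j * m) mod 27) {1..<27} {1..<27}"
  proof -
    have ne: "(j * m) mod 27 \<noteq> 0" if "j \<in> {1..<27}" for j
    proof
      assume "(j * m) mod 27 = 0"
      then have "27 dvd j * m" by presburger
      then have "27 dvd j" using cop by (simp add: coprime_dvd_mult_left_iff coprime_commute)
      then show False using that by (auto dest: dvd_imp_le)
    qed
    have inj: "inj_on (\<lambda>j. (j * m) mod 27) {1..<27}"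
    proof (rule inj_onI)
      fix i j assume ij: "i \<in> {1..<27}" "j \<in> {1..<27}" "(i * m) mod 27 = (j * m) mod 27"
      then have "[i * m = j * m] (mod 27)" by (simp add: cong_def)
      then have "[i = j] (mod 27)" using cop by (simp add: cong_mult_rcancel_nat)
      then show "i = j" using ij by (simp add: cong_def)
    qed
    have "(\<lambda>j. (j * m) mod 27) ` {1..<27} \<subseteq> {1..<27}" using ne by (auto simp: Suc_le_eq)
    then have "(\<lambda>j. (j * m) mod 27) ` {1..<27} = {1..<27}"
      using inj by (intro card_subset_eq) (auto simp: card_image)
    then show ?thesis using inj by (simp add: bij_betw_def)
  qed
  have "(\<Prod>j\<in>{1..<27}. w ^ j - 1) * (\<Prod>j\<in>{1..<27}. evp (w ^ j) (geom m)) = (\<Prod>j\<in>{1..<27}. w ^ ((j * m) mod 27) - 1)"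
    unfolding prod.distrib[symmetric] geom_mult power_mod_27[OF w27] by (simp add: power_mult)
  also have "\<dots> = (\<Prod>j\<in>{1..<27}. w ^ j - 1)"
    by (rule prod.reindex_bij_betw[OF bij])
  finally have "(\<Prod>j\<in>{1..<27}. w ^ j - 1) * (\<Prod>j\<in>{1..<27}. evp (w ^ j) (geom m)) = (\<Prod>j\<in>{1..<27}. w ^ j - 1) * 1"
    by simp
  moreover have "(\<Prod>j\<in>{1..<27}. w ^ j - 1) \<noteq> 0" using w1 by (subst prod_zero_iff) auto
  ultimately have one: "(\<Prod>j\<in>{1..<27}. evp (w ^ j) (geom m)) = 1"
    by (simp only: mult_cancel_left) simp
  define F where "F = geom m + Polynomial.smult h (geom 27)"
  have "{..<27} = insert 0 {1..<27::nat}" by auto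
  then have "(\<Prod>j<27. evp (w ^ j) F) = evp 1 F * (\<Prod>j\<in>{1..<27}. evp (w ^ j) F)" by simp
  also have "(\<Prod>j\<in>{1..<27}. evp (w ^ j) F) = 1"
    unfolding one[symmetric] by (intro prod.cong) (simp_all add: F_def g27)
  also have "evp 1 F = of_int n" by (simp add: F_def evp_geom n)
  finally show ?thesis unfolding S27_prod_iff w_def by (intro exI[of _ F]) simp
qed

text \<open>The value at the primitive 27th roots of unity is fixed to that of \<open>x - 1\<close>.\<close>

lemma S27_construct:
  assumes "P = pX - 1 + 3 * K"
  shows "3 * poly P 1 * enorm (evp eom P) * cnorm (evp zet P) \<in> S27"
proof -
  \<comment> \<open>Q vanishes at the primitive 27th roots of unity and is 3 at all ninth roots of
    unity. So F agrees with x - 1 at the former and with P at the latter.\<close>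
  define Q where "Q = 1 + pX ^ 9 + pX ^ 18"
  define F where "F = pX - 1 + Q * K"
  obtain G where G: "cubic_norm F G" by (rule cubic_norm_exists)
  have e9: "eom ^ 9 = 1" "eom ^ 18 = 1"
  proof -
    have "eom ^ 9 = (eom ^ 3) ^ 3" "eom ^ 18 = (eom ^ 3) ^ 6" by (simp_all only: power_mult[symmetric]) simp_all
    then show "eom ^ 9 = 1" "eom ^ 18 = 1" by simp_all
  qed
  have z18: "zet ^ 18 = 1"
  proof -
    have "zet ^ 18 = (zet ^ 9) ^ 2" by (simp only: power_mult[symmetric]) simp
    then show ?thesis by (simp add: zet_nine)
  qed
  have 1: "poly F 1 = poly P 1" by (simp add: F_def assms Q_def)
  have 2: "evp eom F = evp eom P" by (simp add: F_def assms Q_def e9)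
  have 3: "evp zet F = evp zet P" by (simp add: F_def assms Q_def zet_nine z18)
  have "evp (omega 2 ^ j) G = omega 2 ^ j - 1" if j: "\<not> 3 dvd j" for j
  proof -
    define x where "x = omega 3 ^ j"
    have x3: "x ^ 3 = omega 2 ^ j"
    proof -
      have "x ^ 3 = (omega (Suc 2) ^ 3) ^ j"
        by (simp add: x_def power_mult[symmetric] mult.commute)
      then show ?thesis by (simp only: omega_Suc_cube)
    qed
    define c where "c = com ^ j"
    have x9: "x ^ 9 = c"
    proof -
      have "x ^ 9 = (omega 3 ^ 9) ^ j" by (simp add: x_def power_mult[symmetric] mult.commute)
      also have "omega 3 ^ 9 = com" using omega_pow_com[of 2] by simp
      finally show ?thesis by (simp add: c_def)
    qed
    have cc: "1 + c + c ^ 2 = 0"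
    proof -
      have "j mod 3 = 1 \<or> j mod 3 = 2" using j by presburger
      moreover have "c = com ^ (j mod 3)"
        unfolding c_def by (metis com_cube mult_div_mod_eq power_add power_mult power_one mult_1)
      moreover have "com * (com * com) = 1" using com_cube by (simp add: power3_eq_cube mult.assoc)
      ultimately show ?thesis using com_relation
        by (auto simp: power2_eq_square add_ac mult_ac)
    qed
    have Q0: "evp (u * x) Q = 0" if "u ^ 3 = 1" for u
    proof -
      have "(u * x) ^ 9 = (u ^ 3) ^ 3 * x ^ 9" by (simp only: power_mult_distrib power_mult[symmetric]) simp
      then have "(u * x) ^ 9 = c" using that x9 by simp
      moreover have "(u * x) ^ 18 = ((u * x) ^ 9) ^ 2" by (simp only: power_mult[symmetric]) simp
      ultimately show ?thesis using cc by (simp add: Q_def)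
    qed
    have F: "evp (u * x) F = u * x - 1" if "u ^ 3 = 1" for u using Q0[OF that] by (simp add: F_def)
    have "(com ^ 2) ^ 3 = 1" using com_cube by (metis power_mult mult.commute power_one)
    then have "evp (x ^ 3) G = (x - 1) * (com * x - 1) * (com ^ 2 * x - 1)"
      unfolding cubic_norm_conjugates[OF G com_relation] using F[of 1] F[of com] F[of "com ^ 2"] com_cube by simp
    also have "\<dots> = x ^ 3 - 1"
    proof -
      have w: "com * com = - 1 - com" "com * (com * z) = - z - com * z" for z
      proof -
        show w: "com * com = - 1 - com" using com_sq by (simp add: power2_eq_square)
        show "com * (com * z) = - z - com * z"
          unfolding mult.assoc[symmetric] w by (simp add: algebra_simps)
      qed
      show ?thesis by (simp add: power2_eq_square power3_eq_cube w algebra_simps)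
    qed
    finally show ?thesis unfolding x3 .
  qed
  then have "Nk 2 G = Nk 2 (pX - 1)" unfolding Nk_evp by (intro prod.cong) auto
  then have "cnorm (evp zet G) = cnorm lam" unfolding Nk_2 by (simp add: lam_def)
  then have "poly P 1 * enorm (evp eom P) * cnorm (evp zet P) * 3 \<in> S27"
    unfolding S27_iff using G 1 2 3 by (metis cnorm_simps(8))
  then show ?thesis by (simp add: mult_ac)
qed

text \<open>\<open>geom 9\<close> vanishes at w and zeta and is 9 at 1, so P takes the values 27 t,
  w - 1, zeta - 1 and the product is 3 * 27 t * 3 * 3.\<close>

lemma S27_multiple_729: "3 ^ 6 * t \<in> S27"
proof -
  define P where "P = pX - 1 + 3 * (Polynomial.smult t (geom 9))"
  have e: "evp eom (geom 9) = 0"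
  proof -
    have "eom ^ 9 = (eom ^ 3) ^ 3" by (simp only: power_mult[symmetric]) simp
    then have "elam * evp eom (geom 9) = 0" unfolding elam_def geom_mult by simp
    then show ?thesis by (metis mult_eq_0_iff enorm_eq_0 enorm_simps(7) zero_neq_numeral)
  qed
  have "lam * evp zet (geom 9) = 0" unfolding lam_def geom_mult by (simp add: zet_nine)
  then have z: "evp zet (geom 9) = 0" by simp
  have "poly P 1 = 27 * t"
    using evp_geom[of "1::int" 9] by (simp add: P_def evp_int)
  moreover have "evp eom P = elam" "evp zet P = lam" by (simp_all add: P_def e z elam_def lam_def)
  ultimately show ?thesis using S27_construct[OF P_def] by simp
qed

text \<open>Adding (x^3 - 1) L to K preserves the values at 1 and w. In P(zeta) / lam it adds
  \<open>nu * emb elam * evp zet L\<close>, where \<open>nu * emb elam\<close> is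
  \<open>lam^8\<close> up to a unit. So P(zeta) / lam can be moved freely within its class modulo
  \<open>lam^8\<close>.\<close>

lemma eom_adjust: "evp eom (pX ^ 3 - 1) = 0" "evp zet (pX ^ 3 - 1) = emb elam"
  by (simp_all add: zet_cube elam_def)

lemma lam_8_dvd_imp:
  assumes "lam ^ 8 dvd b" shows "\<exists>L. b = nu * emb elam * evp zet L"
proof -
  have "cnorm nu = 3 ^ 5"
  proof -
    have "cnorm lam * cnorm nu = cnorm 3" by (metis cnorm_mult lam_nu)
    then show ?thesis using cnorm_simps(7)[of 3] by simp
  qed
  then have n: "cnorm (nu * emb elam) = 3 ^ 8" by (simp add: cnorm_mult)
  then have "lam ^ 8 dvd nu * emb elam" by (simp add: lam_power_dvd_iff)
  then obtain d where d: "nu * emb elam = lam ^ 8 * d" by (auto elim: dvdE)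
  then have "cnorm d = 1" using n by (simp add: cnorm_mult cnorm_power)
  then obtain d' where d': "1 = d * d'" using cyc_unit_iff by (metis dvd_def)
  obtain c where c: "b = lam ^ 8 * c" using assms by (auto elim: dvdE)
  have "nu * emb elam * (d' * c) = lam ^ 8 * (d * d') * c" unfolding d by (simp add: mult_ac)
  also have "\<dots> = b" unfolding c d'[symmetric] by simp
  finally have "b = nu * emb elam * (d' * c)" by (rule sym)
  then show ?thesis using evp_zet_surj[of "d' * c"] by metis
qed

lemma not_lam_dvd_if_cnorm: assumes "\<not> 3 dvd cnorm x" shows "\<not> lam dvd x"
  using assms by (simp add: three_dvd_cnorm)

lemma S27_type1_81:
  assumes "type1 q" "q mod 9 = 1" shows "3 ^ 4 * q \<in> S27"
proof -
  have q: "prime q" using assms(1) by (simp add: type1_iff)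
  obtain A B where AB: "\<not> 3 dvd A" "q = enorm (of_int (delta q) + of_int (3 * A) * elam + of_int (9 * B))"
    using assms(1) unfolding type1_iff by blast
  define p where "p = of_int (delta q) + of_int (3 * A) * elam + of_int (9 * B)"
  have p: "enorm p = q" "\<not> etriv p"
    using AB enorm_form_nontrivial[OF AB(1), of "delta q"] by (auto simp: p_def delta_def)
  have "q > 1" using q prime_gt_1_int by blast
  then have "cnorm (emb p) > 1" using p(1) by (simp add: one_less_power)
  then have "emb p \<noteq> 0" "\<not> emb p dvd 1" unfolding cyc_unit_iff by (metis cnorm_simps(1) not_one_less_zero, simp)
  then obtain x where x: "prime_elem x" "x dvd emb p" using cyc.prime_factor by blast
  have cx: "cN x dvd p" "enorm (cN x) = q" using prime_over_1_cN[OF q assms(2) p(1) x] by auto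
  have nx: "cnorm x = q" using cx by (simp add: cnorm_def)
  obtain d where d: "p = cN x * d" using cx(1) by (auto elim: dvdE)
  then have "q = q * enorm d" using p(1) cx(2) by (simp add: enorm_mult)
  then have "d dvd 1" using \<open>q > 1\<close> by (simp add: eis_unit_iff)
  then have "\<not> etriv (cN x)" using p(2) d etriv_mult_unit_iff by metis
  moreover have "\<not> lam dvd x" using assms(2) by (intro not_lam_dvd_if_cnorm, unfold nx) presburger
  ultimately obtain y where y: "cnorm y = q" "lam ^ 8 dvd y - theta" using etriv_level_5 nx by metis
  obtain L where L: "y - theta = nu * emb elam * evp zet L" using lam_8_dvd_imp[OF y(2)] by blast
  \<comment> \<open>The constant 1 alone gives 3 at 1, w + 2 of norm 3 at w, and lam (1 + 3 / lam) =
    lam * \<open>theta\<close> at zeta; L then replaces \<open>theta\<close> by y. The product is 3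
    * 3 * 3 * 3 q.\<close>
  define P where "P = pX - 1 + 3 * (1 + (pX ^ 3 - 1) * L)"
  have "poly P 1 = 3" by (simp add: P_def)
  moreover have "enorm (evp eom P) = 3"
  proof -
    have "evp eom P = elam + 3" using eom_adjust(1) by (simp add: P_def elam_def)
    then show ?thesis by (simp add: enorm_def)
  qed
  moreover have "evp zet P = lam * y"
  proof -
    have "y = 1 + nu + nu * emb elam * evp zet L" using L by (simp add: theta_def algebra_simps)
    moreover have "lam * (1 + nu + nu * emb elam * l) = lam + lam * nu * (1 + emb elam * l)" for l
      by (simp add: algebra_simps)
    ultimately show ?thesis using eom_adjust(2) by (simp add: P_def lam_nu) (simp add: lam_def)
  qed
  ultimately show ?thesis using S27_construct[OF P_def] y(1) by (simp add: cnorm_mult)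
qed

lemma S27_type1_243:
  assumes "type1 q" shows "3 ^ 5 * q \<in> S27"
proof -
  obtain A B where AB: "\<not> 3 dvd A" "q = enorm (of_int (delta q) + of_int (3 * A) * elam + of_int (9 * B))"
    using assms unfolding type1_iff by blast
  obtain d k where d: "d \<in> {1, 4, 7}" and dk: "q = enorm (of_int d + 3 * ecnj elam + 9 * k)"
  proof -
    have "delta q \<in> {1, 2, 4}" by (simp add: delta_def)
    from enorm_form_adjusted[OF AB(1) this, of B] AB(2) show thesis using that by metis
  qed
  obtain k0 where k0: "d = 1 + 3 * k0" using d by (auto intro: that[of 0] that[of 1] that[of 2])
  obtain f where f: "evp eom f = k" using evp_eom_surj by blast
  \<comment> \<open>A unit in the class of d keeps the contribution of zeta equal to 3. For d = 7 it
    is \<open>eta^6\<close>, congruent to 16, since \<open>lam^8\<close> divides 9.\<close>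
  obtain e where e: "cnorm e = 1" "lam ^ 8 dvd e - of_int d"
  proof -
    have "lam ^ 8 dvd eta ^ 3 - 4" using unit_lam_levels(8) by (simp only: lam_power_dvd_iff)
    then have "lam ^ 8 dvd (eta ^ 3) ^ 2 - 4 ^ 2" by (rule dvd_diff_power)
    then have "lam ^ 8 dvd (eta ^ 3) ^ 2 - 4 ^ 2 + 9" using lam_8_dvd_9 by (rule dvd_add)
    then have "lam ^ 8 dvd (eta ^ 3) ^ 2 - 7" by simp
    then show thesis using d that[of 1] that[of "eta ^ 3"] that[of "(eta ^ 3) ^ 2"] \<open>lam ^ 8 dvd eta ^ 3 - 4\<close>
      by (auto simp: cnorm_power unit_lam_levels)
  qed
  have "lam ^ 8 dvd 3 * nu" unfolding lam_power_dvd_iff by (simp add: nu_def emb_def cyc_eval eis_eval power2_eq_square)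
  then have "lam ^ 8 dvd e - of_int d - (9 * evp zet f + 3 * nu)"
    by (rule dvd_diff[OF e(2) dvd_add[OF dvd_mult2[OF lam_8_dvd_9]]])
  then obtain L where L: "e - of_int d - (9 * evp zet f + 3 * nu) = nu * emb elam * evp zet L"
    using lam_8_dvd_imp by blast
  \<comment> \<open>The multiple of x - 1 produces d + 9 k at w. The constant 3 makes P(1) = 9 and,
    as 9 = elam * 3 * ecnj elam, supplies the remaining term at w. The product is 3 * 9 * 3 q *
    3.\<close>
  define K where "K = (pX - 1) * ([:k0:] + 3 * f) + 3 + (pX ^ 3 - 1) * L"
  define P where "P = pX - 1 + 3 * K"
  have "poly P 1 = 9" by (simp add: P_def K_def)
  moreover have "enorm (evp eom P) = 3 * q"
  proof -
    have "evp eom P = elam * (of_int d + 3 * ecnj elam + 9 * k)"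
    proof -
      have "elam * ecnj elam = 3" by (simp add: eis_eq_iff)
      moreover have "elam * (of_int d + 3 * ecnj elam + 9 * k) = elam * (of_int d + 9 * k) + 3 * (elam * ecnj elam)"
        by (simp add: algebra_simps)
      ultimately have "elam * (of_int d + 3 * ecnj elam + 9 * k) = elam * (of_int d + 9 * k) + 9" by simp
      then show ?thesis using eom_adjust(1)
        by (simp add: P_def K_def f k0 elam_def algebra_simps)
    qed
    then show ?thesis by (simp add: enorm_mult dk)
  qed
  moreover have "evp zet P = lam * e"
  proof -
    have "e = of_int d + 9 * evp zet f + 3 * nu + nu * emb elam * evp zet L" using L by (simp add: algebra_simps)
    then have "lam * e = lam * (of_int d + 9 * evp zet f) + (lam * nu) * (3 + emb elam * evp zet L)"
      by (simp add: algebra_simps)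
    then show ?thesis using eom_adjust(2) unfolding lam_nu
      by (simp add: P_def K_def k0 lam_def algebra_simps)
  qed
  ultimately show ?thesis using S27_construct[OF P_def] e(1) by (simp add: cnorm_mult)
qed

lemma S27_type3_243:
  assumes "type3 q" shows "3 ^ 5 * q \<in> S27"
proof -
  obtain h where h: "\<not> lam dvd h" "q = cnorm (1 + lam ^ 7 * h)"
    using assms unfolding type3_iff by blast
  \<comment> \<open>The polynomial 1 + x + x^2 vanishes at w, makes P(1) = 9, and moves P(zeta) /
    lam away from 1 exactly at level 7. The sign s below matches it with h modulo
    \<open>lam\<close>; multiplying by s at the end restores q.\<close>
  define \<phi> where "\<phi> = 1 + zet + zet ^ 2"
  have "3 ^ 7 dvd cnorm (nu * \<phi>)" "\<not> 3 ^ 8 dvd cnorm (nu * \<phi>)"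
    unfolding nu_def \<phi>_def power2_eq_square emb_def by (simp_all add: cyc_eval eis_eval)
  then have "lam ^ 7 dvd nu * \<phi>" and n8: "\<not> lam ^ 8 dvd nu * \<phi>" by (simp_all only: lam_power_dvd_iff not_False_eq_True)
  then obtain t where t: "nu * \<phi> = lam ^ 7 * t" by (auto elim: dvdE)
  have l8: "lam ^ 7 * lam = lam ^ 8" by (simp flip: power_Suc2)
  then have "\<not> lam dvd t" using n8 unfolding t by (metis mult_dvd_mono dvd_refl)
  then have "3 dvd aug h - aug t \<or> 3 dvd aug h + aug t" using h(1) unfolding lam_dvd by presburger
  then obtain s :: int where s: "s = 1 \<or> s = -1" "lam dvd h - of_int s * t"
    by (metis lam_dvd aug_simps(1,2) of_int_1 of_int_minus mult_1 mult_minus1 diff_minus_eq_add)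
  then have "lam ^ 7 * lam dvd lam ^ 7 * (h - of_int s * t)" by (intro mult_dvd_mono) auto
  then obtain L where L: "lam ^ 7 * (h - of_int s * t) = nu * emb elam * evp zet L"
    using lam_8_dvd_imp l8 by metis
  define K where "K = Polynomial.smult s (1 + pX + pX ^ 2) + (pX ^ 3 - 1) * L"
  define P where "P = pX - 1 + 3 * K"
  have "poly P 1 = 9 * s" by (simp add: P_def K_def)
  moreover have "evp eom P = elam"
  proof -
    have "evp eom K = of_int s * (1 + eom + eom ^ 2)"
      using eom_adjust(1) by (simp add: K_def power2_eq_square algebra_simps)
    also have "1 + eom + eom ^ 2 = 0" using eom_relation by (simp add: add_ac)
    finally show ?thesis by (simp add: P_def elam_def)
  qed
  moreover have "evp zet P = lam * (1 + lam ^ 7 * h)"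
  proof -
    have "lam ^ 7 * h = lam ^ 7 * (h - of_int s * t) + of_int s * (lam ^ 7 * t)"
      by (simp add: algebra_simps)
    also have "\<dots> = nu * (emb elam * evp zet L + of_int s * \<phi>)"
      unfolding L t[symmetric] by (simp add: algebra_simps)
    finally have "lam * (1 + lam ^ 7 * h) = lam + (lam * nu) * (emb elam * evp zet L + of_int s * \<phi>)"
      by (simp add: algebra_simps)
    then show ?thesis using eom_adjust(2) unfolding lam_nu
      by (simp add: P_def K_def lam_def \<phi>_def algebra_simps)
  qed
  ultimately have "3 ^ 5 * (s * q) \<in> S27" using S27_construct[OF P_def] h(2) by (simp add: cnorm_mult mult_ac)
  moreover have "s \<in> S27" using s(1) by (intro S27_coprime) auto
  ultimately have "s * (3 ^ 5 * (s * q)) \<in> S27" by (rule S27_mult[rotated])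
  then show ?thesis using s(1) by auto
qed

section \<open>Divisibility of determinants\<close>

lemma eis_nontrivial_prime_divisor:
  assumes "a \<noteq> 0" "\<not> etriv a"
  shows "\<exists>p. prime (enorm p) \<and> \<not> etriv p \<and> enorm p dvd enorm a"
proof -
  obtain x where x: "prime_elem x" "x dvd a" "\<not> etriv x"
    using eis.irreducible_factor[of a etriv] assms etriv_unit etriv_mult by metis
  have x0: "x \<noteq> 0" "\<not> x dvd 1" using x(1) by (auto simp: prime_elem_def)
  have "x dvd of_int (enorm x)" by (metis mult_ecnj dvd_triv_left)
  then obtain q where q: "prime q" "x dvd of_int q"
    using prime_elem_dvd_rational_prime[OF x(1)] x0 by (metis enorm_eq_0)
  have q1: "q > 1" using q(1) prime_gt_1_int by blast
  obtain d where d: "of_int q = x * d" using q(2) by (auto elim: dvdE)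
  then have qq: "q ^ 2 = enorm x * enorm d" by (metis enorm_mult enorm_simps(5))
  then obtain i where i: "i \<le> 2" "enorm x = q ^ i"
    using divides_primepow[of q "enorm x" 2] q(1) by auto
  have "i \<noteq> 0" using i(2) x0 eis_unit_iff by (metis power_0)
  moreover have "i \<noteq> 2"
  proof
    assume "i = 2"
    then have "enorm d = 1" using qq i(2) q1 by simp
    then have "etriv x" using d etriv_of_int[of q] etriv_mult_unit_iff eis_unit_iff by metis
    then show False using x(3) by simp
  qed
  ultimately have "enorm x = q" using i by (cases "i = 1") auto
  then show ?thesis using q(1) x by (intro exI[of _ x]) (auto elim!: dvdE simp: enorm_mult)
qed

section \<open>Pairs of trivial elements that agree modulo 3\<close>

lemma eaug_ecnj: "[eaug (ecnj a) = eaug a] (mod 3)"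
proof -
  have "eaug (ecnj a) - eaug a = 3 * (- e1 a)" by (simp add: eaug_def)
  then show ?thesis by (metis cong_iff_dvd_diff dvd_triv_left)
qed

lemma three_dvd_unit_diff:
  assumes "u \<in> eunits"
    "v \<in> eunits" "3 dvd u - v"
  shows "u = v"
  using assms by (auto simp: eis_numeral_dvd)

text \<open>The unit relating an element prime to 3 with its conjugate is already determined modulo 3, so it
  is the same for two elements that agree modulo 3.\<close>

lemma etriv_difference:
  assumes "etriv a" "etriv b" "9 dvd b - (a + 3 * k)" "\<not> elam dvd a"
  shows "\<exists>u. u \<in> {Eis 1 0, Eis 0 1, Eis (-1) (-1)} \<and> 9 dvd a - u * ecnj a \<and> 3 dvd k - u * ecnj k"
proof -
  have three: "(3 :: eis) \<noteq> 0" by (simp add: eis_eq_iff)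
  obtain u where u: "u \<in> eunits" "9 dvd a - u * ecnj a" using assms(1) by (rule etriv_cases)
  have "etriv (a + 3 * k)" using assms(2,3) etriv_cong by blast
  then obtain v where v: "v \<in> eunits" "9 dvd (a + 3 * k) - v * ecnj (a + 3 * k)" by (rule etriv_cases)
  have d: "9 dvd (a - v * ecnj a) + 3 * (k - v * ecnj k)" using v(2) by (simp add: algebra_simps)
  have t9: "(3::eis) dvd 9" by (simp add: eis_numeral_dvd)
  then have "3 dvd (a - v * ecnj a) + 3 * (k - v * ecnj k)" "3 dvd a - u * ecnj a"
    using d u(2) dvd_trans by blast+
  then have "3 dvd ((a - v * ecnj a) + 3 * (k - v * ecnj k)) - (a - u * ecnj a) - 3 * (k - v * ecnj k)"
    by (rule dvd_diff[OF dvd_diff dvd_triv_left])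
  also have "\<dots> = (u - v) * ecnj a" by (simp add: algebra_simps)
  finally have "3 dvd ((u - v) * ecnj a) * a" by (rule dvd_mult2)
  moreover have "((u - v) * ecnj a) * a = (u - v) * of_int (enorm a)"
    unfolding mult_ecnj[symmetric] by (simp only: mult_ac)
  ultimately have "3 dvd (u - v) * of_int (enorm a)" by simp
  moreover have "\<not> 3 dvd enorm a"
  proof -
    have "[enorm a = (eaug a)^2] (mod 3)"
      using enorm_mod_3[of a] by (simp add: eaug_def cong_iff_dvd_diff)
    then have "3 dvd enorm a \<longleftrightarrow> 3 dvd (eaug a)^2" by (rule cong_dvd_iff)
    then show ?thesis using assms(4) by (simp add: prime_dvd_power_iff elam_dvd eaug_def)
  qed
  ultimately have "3 dvd u - v"
    by (auto simp: eis_numeral_dvd prime_dvd_mult_iff)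
  then have uv: "u = v" by (rule three_dvd_unit_diff[OF u(1) v(1)])
  have "9 dvd ((a - v * ecnj a) + 3 * (k - v * ecnj k)) - (a - v * ecnj a)" by (rule dvd_diff[OF d]) (use u(2) uv in simp)
  then have "3 * 3 dvd 3 * (k - v * ecnj k)" by simp
  then have "(3 :: eis) = 0 \<or> 3 dvd k - v * ecnj k" unfolding dvd_mult_cancel_left .
  then have "3 dvd k - v * ecnj k" using three by blast
  \<comment> \<open>Conjugation is the identity on the residue field of w - 1, so u becomes 1 there;
    this excludes the negatives of the cube roots of unity.\<close>
  moreover have "eaug u mod 3 = 1"
  proof -
    have "elam dvd a - u * ecnj a"
    proof -
      have "elam dvd 9" by (simp add: elam_dvd)
      then show ?thesis using u(2) dvd_trans by blast
    qed
    then have "[eaug a = eaug (u * ecnj a)] (mod 3)"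
      by (simp add: elam_dvd cong_iff_dvd_diff eaug_def algebra_simps)
    also have "[eaug (u * ecnj a) = eaug u * eaug a] (mod 3)"
      using eaug_mult eaug_ecnj by (meson cong_mult cong_refl cong_trans)
    finally have "3 dvd (1 - eaug u) * eaug a" by (simp add: cong_iff_dvd_diff algebra_simps)
    then have "3 dvd 1 - eaug u" using assms(4) by (simp add: prime_dvd_mult_iff elam_dvd eaug_def)
    then show ?thesis by presburger
  qed
  then have "u \<in> {Eis 1 0, Eis 0 1, Eis (-1) (-1)}" using u(1) by (auto simp: eaug_def)
  ultimately show ?thesis using u(2) uv by blast
qed

text \<open>Adding h * \<open>nu\<close> shifts all three coordinates by s = h conj(w - 1). In the
  expansion of the norm all terms beyond the linear one contain 3 s^2, a multiple of 9. The linear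
  term is 3 s Q with Q = 1 modulo w - 1, and s times w - 1 is divisible by 3.\<close>

lemma cN_add_nu:
  assumes "\<not> lam dvd b"
  shows "9 dvd cN (b + of_int h * nu) - (cN b + 3 * (of_int h * ecnj elam))"
proof -
  define s where "s = of_int h * ecnj elam"
  define x y z where xyz: "x = c0 b" "y = c1 b" "z = c2 b"
  define Q where "Q = x^2 + eom * y^2 + eom^2 * z^2 - eom * (x * y + y * z + x * z)"
  have "c0 (b + of_int h * nu) = x + s" "c1 (b + of_int h * nu) = y + s" "c2 (b + of_int h * nu) = z + s"
    by (simp_all add: nu_def s_def xyz power2_eq_square mult_ac)
  then have c: "cN (b + of_int h * nu) = cN b + 3 * s * Q
      + 3 * s^2 * (x + eom * y + eom^2 * z - eom * (x + y + z)) - 3 * s^2 * (s * eom)"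
    unfolding cN_def Q_def xyz[symmetric] by (simp add: eom_norm)
  have s2: "9 dvd 3 * s^2"
  proof -
    have "3 * s^2 = 9 * (of_int (h^2) * (1 + eom))"
      by (simp add: s_def eis_eq_iff power2_eq_square)
    then show ?thesis by (metis dvd_triv_left)
  qed
  have "9 dvd 3 * s * (Q - 1)"
  proof -
    have "[eaug Q = (aug b)^2] (mod 3)"
    proof -
      have e: "[eaug (eom * t) = eaug t] (mod 3)" for t using eaug_mult[of eom t] by simp
      have sq: "[eaug (t^2) = eaug t * eaug t] (mod 3)" for t unfolding power2_eq_square by (rule eaug_mult)
      have Q: "Q = x^2 + eom * y^2 + eom * (eom * z^2) - eom * (x * y + y * z + x * z)"
        unfolding Q_def by (simp add: power2_eq_square mult.assoc)
      define E where "E = eaug x * eaug x + eaug y * eaug y + eaug z * eaug z -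
          (eaug x * eaug y + eaug y * eaug z + eaug x * eaug z)"
      have "[eaug Q = E] (mod 3)"
        unfolding Q eaug_simps E_def
        by (intro cong_add cong_diff sq cong_trans[OF e sq] cong_trans[OF e cong_trans[OF e sq]] cong_trans[OF e])
          (simp, intro cong_add eaug_mult)
      moreover have "(aug b)^2 - E = 3 * (eaug x * eaug y + eaug y * eaug z + eaug x * eaug z)"
        by (simp add: aug_def xyz E_def power2_eq_square algebra_simps)
      then have "[(aug b)^2 = E] (mod 3)" unfolding cong_iff_dvd_diff by simp
      ultimately show ?thesis using cong_sym cong_trans by blast
    qed
    moreover have "(aug b)^2 mod 3 = 1"
    proof -
      have "aug b mod 3 = 1 \<or> aug b mod 3 = 2" using assms unfolding lam_dvd by presburger
      then show ?thesis using power_mod[of "aug b" 3 2] by auto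
    qed
    ultimately have "eaug Q mod 3 = 1" unfolding cong_def by simp
    then have "3 dvd eaug Q - 1" by presburger
    then have "elam dvd Q - 1" by (simp add: elam_dvd eaug_def algebra_simps)
    then obtain t where "Q - 1 = elam * t" by (auto elim: dvdE)
    then have "3 * s * (Q - 1) = 3 * (of_int h * t) * (elam * ecnj elam)"
      unfolding s_def by (simp only: mult_ac)
    also have "elam * ecnj elam = 3" by (simp add: eis_eq_iff)
    finally have "3 * s * (Q - 1) = 9 * (of_int h * t)" by simp
    then show ?thesis by simp
  qed
  then have "9 dvd 3 * s * (Q - 1) + 3 * s^2 * (x + eom * y + eom^2 * z - eom * (x + y + z)) - 3 * s^2 * (s * eom)"
    by (rule dvd_diff[OF dvd_add[OF _ dvd_mult2[OF s2]] dvd_mult2[OF s2]])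
  also have "\<dots> = cN (b + of_int h * nu) - (cN b + 3 * s)" unfolding c by (simp add: algebra_simps)
  finally show ?thesis unfolding s_def .
qed

text \<open>For t = u conj(v) the norms of the three coordinates sum to 1 by
  \<open>mult_ccnj\<close>. Since t is 1 modulo 3, two coordinates vanish and t = 1.\<close>

lemma ctriv_unit_eq:
  assumes "u * ccnj u = 1" "v * ccnj v = 1" "lam ^ 6 dvd u - v"
  shows "u = v"
proof -
  define t where "t = u * ccnj v"
  have tt: "t * ccnj t = 1" using assms(1,2) by (simp add: t_def) (metis mult.assoc mult.commute mult.left_commute mult_1)
  have v': "ccnj v * v = 1" using assms(2) by (simp add: mult.commute)
  have "lam ^ 6 dvd (u - v) * ccnj v" using assms(3) by simp
  also have "(u - v) * ccnj v = t - 1" using assms(2) by (simp add: t_def algebra_simps)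
  finally have "3 dvd t - 1" using three_dvd_lam_6 dvd_trans by blast
  then have d: "3 dvd c0 t - 1" "3 dvd c1 t" "3 dvd c2 t" by (simp_all add: cyc_numeral_dvd)
  have "c0 (t * ccnj t) = of_int (cT t)" unfolding mult_ccnj by simp
  then have cT: "cT t = 1" unfolding tt by (simp add: eis_eq_iff)
  have z: "y = 0" if y: "3 dvd y" "enorm y \<le> 1" for y :: eis
  proof -
    obtain k where "y = 3 * k" using y(1) by (auto elim: dvdE)
    then have "enorm y = 9 * enorm k" by (simp add: enorm_mult)
    then have "enorm k = 0" using y(2) enorm_nonneg[of k] by linarith
    then show ?thesis using \<open>y = 3 * k\<close> by simp
  qed
  have "enorm (c1 t) \<le> 1" "enorm (c2 t) \<le> 1"
    using cT enorm_nonneg[of "c0 t"] enorm_nonneg[of "c1 t"] enorm_nonneg[of "c2 t"] unfolding cT_def by linarith+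
  then have c12: "c1 t = 0" "c2 t = 0" using z d by blast+
  then have "enorm (c0 t) = 1" using cT by (simp add: cT_def)
  then have "c0 t \<in> eunits" by (rule eis_units)
  then have "c0 t = 1" using d(1) by (auto simp: eis_numeral_dvd eis_eq_iff)
  then have "t = 1" using c12 by (simp add: cyc_eq_iff)
  then have "u * (ccnj v * v) = v" by (metis t_def mult.assoc mult_1)
  then show ?thesis using v' by simp
qed

lemma lam_power_dvd_3_mult: assumes "lam ^ (6 + n) dvd 3 * x" shows "lam ^ n dvd x"
proof -
  have "cnorm (3 :: cyc) = 3 ^ 6" using cnorm_simps(7)[of 3] by simp
  then have "3 ^ (6 + n) dvd 3 ^ 6 * cnorm x" using assms by (simp only: lam_power_dvd_iff cnorm_mult)
  then have "3 ^ 6 * 3 ^ n dvd 3 ^ 6 * cnorm x" by (simp only: power_add)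
  then show ?thesis unfolding lam_power_dvd_iff by simp
qed

text \<open>The two elements agree modulo \<open>lam^6\<close>, so the same root of unity u serves
  both. Subtracting and cancelling 3 leaves k = u conj(k) modulo \<open>lam^2\<close>, and u = 1
  there because b is an integer modulo \<open>lam^2\<close>.\<close>

lemma ctriv_difference:
  assumes "ctriv b" "ctriv (b + 3 * k)" "lam ^ 2 dvd b - of_int c" "\<not> 3 dvd c"
  shows "lam ^ 2 dvd k - ccnj k"
proof -
  obtain u where u: "u * ccnj u = 1" "lam ^ 8 dvd b - u * ccnj b" using assms(1) unfolding ctriv_def by blast
  obtain v where v: "v * ccnj v = 1" "lam ^ 8 dvd (b + 3 * k) - v * ccnj (b + 3 * k)"
    using assms(2) unfolding ctriv_def by blast
  have lamc: "\<not> lam dvd of_int c" using assms(4) by (simp add: lam_dvd)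
  have lam2: "lam dvd lam ^ 2" by (simp add: power2_eq_square)
  have nb: "\<not> lam dvd ccnj b"
  proof
    assume "lam dvd ccnj b"
    then have "lam dvd b" using lam_power_dvd_ccnj[of 1 "ccnj b"] by simp
    moreover have "lam dvd b - of_int c" using assms(3) lam2 dvd_trans by blast
    ultimately have "lam dvd b - (b - of_int c)" by (rule dvd_diff)
    then show False using lamc by simp
  qed
  have le: "lam ^ 6 dvd lam ^ 8" "lam ^ 2 dvd lam ^ 8" by (simp_all add: le_imp_power_dvd)
  have "lam ^ 6 dvd ((b + 3 * k) - v * ccnj (b + 3 * k)) - (b - u * ccnj b) - 3 * (k - v * ccnj k)"
    by (rule dvd_diff[OF dvd_diff[OF dvd_trans[OF le(1) v(2)] dvd_trans[OF le(1) u(2)]] dvd_mult2[OF lam_6_dvd_3]])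
  also have "\<dots> = (u - v) * ccnj b" by (simp add: algebra_simps)
  finally have "lam ^ 6 dvd u - v" using lam_power_dvd_mult nb by blast
  then have uv: "v = u" using ctriv_unit_eq u(1) v(1) by blast
  have "lam ^ 8 dvd ((b + 3 * k) - u * ccnj (b + 3 * k)) - (b - u * ccnj b)"
    by (rule dvd_diff[OF v(2)[unfolded uv] u(2)])
  also have "\<dots> = 3 * (k - u * ccnj k)" by (simp add: algebra_simps)
  finally have k: "lam ^ 2 dvd k - u * ccnj k" using lam_power_dvd_3_mult[of 2] by simp
  have "lam ^ 2 dvd ccnj b - of_int c" using lam_power_dvd_ccnj[OF assms(3)] by simp
  then have "lam ^ 2 dvd u * (ccnj b - of_int c) - (b - of_int c) + (b - u * ccnj b)"
    by (rule dvd_add[OF dvd_diff[OF dvd_mult assms(3)] dvd_trans[OF le(2) u(2)]])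
  also have "\<dots> = (1 - u) * of_int c" by (simp add: algebra_simps)
  finally have "lam ^ 2 dvd 1 - u" using lam_power_dvd_mult lamc by blast
  then have "lam ^ 2 dvd (k - u * ccnj k) - (1 - u) * ccnj k" by (rule dvd_diff[OF k dvd_mult2])
  then show ?thesis by (simp add: algebra_simps)
qed

section \<open>Taylor coefficients at 1 and the relations between the four factors\<close>

lemma taylor_exists: "\<exists>c0 c1 c2 R. F = [:c0:] + (pX - 1) * ([:c1:] + (pX - 1) * ([:c2:] + (pX - 1) * R))" for F :: "int poly"
proof -
  have 1: "\<exists>c R. F = [:c:] + (pX - 1) * R" for F :: "int poly"
  proof (induction F)
    case 0
    show ?case by (intro exI[of _ 0]) simp
  next
    case (pCons a F)
    then obtain c R where F: "F = [:c:] + (pX - 1) * R" by blast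
    have "pCons a F = [:a:] + pX * F" by simp
    also have "\<dots> = [:a + c:] + (pX - 1) * ([:c:] + pX * R)"
      unfolding F by (simp add: algebra_simps one_pCons)
    finally show ?case by blast
  qed
  then show ?thesis by metis
qed

definition taylor :: "int \<Rightarrow> int \<Rightarrow> int \<Rightarrow> int poly \<Rightarrow> int poly" where
  "taylor c d e R = [:c:] + (pX - 1) * ([:d:] + (pX - 1) * ([:e:] + (pX - 1) * R))"

text \<open>These are F(w) / (w - 1) and F(zeta) / (zeta - 1) for F with Taylor coefficients 3 a, d,
  e at 1, by 3 = elam * ecnj elam = lam * nu.\<close>

abbreviation ecomb :: "int \<Rightarrow> int \<Rightarrow> int \<Rightarrow> eis \<Rightarrow> eis" where
  "ecomb a d e x \<equiv> ecnj elam * of_int a + of_int d + of_int e * elam + elam ^ 2 * x"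

abbreviation ccomb :: "int \<Rightarrow> int \<Rightarrow> int \<Rightarrow> cyc \<Rightarrow> cyc" where
  "ccomb a d e x \<equiv> nu * of_int a + of_int d + of_int e * lam + lam ^ 2 * x"

lemma poly_taylor_1: "poly (taylor c d e R) 1 = c"
  by (simp add: taylor_def)

lemma evp_eom_taylor: "evp eom (taylor (3 * a) d e R) =
  elam * (ecomb a d e (evp eom R))"
proof -
  have "elam * (ecomb a d e (evp eom R)) =
    (elam * ecnj elam) * of_int a + elam * (of_int d + elam * (of_int e + elam * evp eom R))"
    by (simp add: power2_eq_square algebra_simps)
  also have "elam * ecnj elam = 3" by (simp add: eis_eq_iff)
  finally show ?thesis by (simp add: taylor_def elam_def)
qed

lemma evp_zet_taylor: "evp zet (taylor (3 * a) d e R) =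
  lam * (ccomb a d e (evp zet R))"
proof -
  have "lam * (ccomb a d e (evp zet R)) =
    (lam * nu) * of_int a + lam * (of_int d + lam * (of_int e + lam * evp zet R))"
    by (simp add: power2_eq_square algebra_simps)
  then show ?thesis unfolding lam_nu by (simp add: taylor_def lam_def)
qed

definition det_datum :: "int \<Rightarrow> int \<Rightarrow> int \<Rightarrow> int \<Rightarrow> bool" where
  "det_datum n c d e \<longleftrightarrow> (\<exists>R G. cubic_norm (taylor c d e R) G \<and>
     n = c * enorm (evp eom (taylor c d e R)) * cnorm (evp zet (taylor c d e R)) * cnorm (evp zet G))"

lemma S27_datum: "n \<in> S27 \<Longrightarrow> \<exists>c d e. det_datum n c d e"
  unfolding S27_iff det_datum_def using taylor_exists unfolding taylor_def[symmetric]
  by (metis poly_taylor_1)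

text \<open>Multiplying the polynomial by \<open>x\<close> does not change the determinant.\<close>

lemma det_datum_shift: assumes "det_datum n c d e" shows "det_datum n c (d + c) (e + d)"
proof -
  obtain R G where G: "cubic_norm (taylor c d e R) G"
    and n: "n = c * enorm (evp eom (taylor c d e R)) * cnorm (evp zet (taylor c d e R)) * cnorm (evp zet G)"
    using assms unfolding det_datum_def by blast
  have eq: "pX * taylor c d e R = taylor c (d + c) (e + d) ([:e:] + pX * R)"
  proof -
    have "pX * [:x:] = (pX - 1) * [:x:] + [:x:]" for x :: int by (simp add: one_pCons)
    then have *: "pX * ([:x:] + (pX - 1) * S) = [:x:] + (pX - 1) * ([:x:] + pX * S)" for x :: int and S
      by (simp add: algebra_simps)
    have s: "[:x + y:] = [:x:] + [:y:]" for x y :: int by simp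
    show ?thesis unfolding taylor_def * s by (simp only: algebra_simps)
  qed
  have X: "enorm (evp eom (pX * F)) = enorm (evp eom F)" "cnorm (evp zet (pX * F)) = cnorm (evp zet F)" for F
    by (simp_all add: enorm_mult cnorm_mult)
  have "cubic_norm (pX * taylor c d e R) (pX * G)"
  proof -
    obtain f g h where f: "taylor c d e R = trisect f g h"
      and g: "G = f ^ 3 + pX * g ^ 3 + pX ^ 2 * h ^ 3 - 3 * pX * f * g * h"
      using G unfolding cubic_norm_def by blast
    have "pX * trisect f g h = trisect (pX * h) f g"
      by (simp add: trisect_def pcompose_mult pcompose_pCons power2_eq_square power3_eq_cube algebra_simps)
    moreover have "pX * G = (pX * h) ^ 3 + pX * f ^ 3 + pX ^ 2 * g ^ 3 - 3 * pX * (pX * h) * f * g"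
      unfolding g by (simp only: power2_eq_square power3_eq_cube algebra_simps)
    ultimately show ?thesis unfolding cubic_norm_def f by blast
  qed
  then have "cubic_norm (taylor c (d + c) (e + d) ([:e:] + pX * R)) (pX * G)" unfolding eq .
  moreover have "n = c * enorm (evp eom (taylor c (d + c) (e + d) ([:e:] + pX * R))) *
      cnorm (evp zet (taylor c (d + c) (e + d) ([:e:] + pX * R))) * cnorm (evp zet (pX * G))"
    unfolding eq[symmetric] X by (rule n)
  ultimately show ?thesis unfolding det_datum_def by blast
qed

text \<open>When 3 divides c, a shift adds d to e and keeps d modulo 3, so at most two shifts make e
  divisible by 3.\<close>

lemma det_datum_normalise:
  assumes "det_datum n c d e" "3 dvd c" "\<not> 3 dvd d"
  shows "\<exists>d' e'. det_datum n c d' e' \<and> \<not> 3 dvd d' \<and> 3 dvd e'"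
proof -
  have 1: "det_datum n c (d + c) (e + d)" using assms(1) by (rule det_datum_shift)
  then have 2: "det_datum n c (d + c + c) (e + d + (d + c))" by (rule det_datum_shift)
  have "3 dvd e \<or> 3 dvd e + d \<or> 3 dvd e + d + (d + c)" using assms(2,3) by presburger
  moreover have "\<not> 3 dvd d + c" "\<not> 3 dvd d + c + c" using assms(2,3) by presburger+
  ultimately show ?thesis using assms 1 2 by blast
qed

text \<open>Each of the four factors gives up one 3, whence 3^4. Comparing G = F + 3 H with the
  cubic norm at 1 and at w gives the two equations for H that tie \<alpha>, \<beta> and the last
  factor together.\<close>

lemma det_datum_factors:
  assumes "det_datum n (3 * a) d e"
  obtains \<alpha> \<beta> A B H where "\<alpha> = ecomb a d e A" "\<beta> = ccomb a d e B"
    "n = 3 ^ 4 * a * (enorm \<alpha> * cnorm \<beta> * cnorm (\<beta> + nu * evp zet H))"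
    "poly H 1 = a * (3 * enorm \<alpha> - 1)" "elam * (cN \<beta> - \<alpha>) = 3 * evp eom H"
proof -
  obtain R G where G: "cubic_norm (taylor (3 * a) d e R) G" and n: "n = 3 * a *
      enorm (evp eom (taylor (3 * a) d e R)) * cnorm (evp zet (taylor (3 * a) d e R)) * cnorm (evp zet G)"
    using assms unfolding det_datum_def by blast
  obtain H where H: "G = taylor (3 * a) d e R + 3 * H" using cubic_norm_cong_3[OF G] by blast
  define \<alpha> where "\<alpha> = ecomb a d e (evp eom R)"
  define \<beta> where "\<beta> = ccomb a d e (evp zet R)"
  have \<alpha>: "evp eom (taylor (3 * a) d e R) = elam * \<alpha>" unfolding \<alpha>_def by (rule evp_eom_taylor)
  have \<beta>: "evp zet (taylor (3 * a) d e R) = lam * \<beta>" unfolding \<beta>_def by (rule evp_zet_taylor)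
  have "evp zet G = lam * \<beta> + (lam * nu) * evp zet H" unfolding lam_nu H by (simp add: \<beta>)
  then have \<beta>': "evp zet G = lam * (\<beta> + nu * evp zet H)" by (simp add: distrib_left mult.assoc)
  have "n = 3 ^ 4 * a * (enorm \<alpha> * cnorm \<beta> * cnorm (\<beta> + nu * evp zet H))"
    unfolding n \<alpha> \<beta> \<beta>' by (simp add: enorm_mult cnorm_mult)
  moreover have "poly H 1 = a * (3 * enorm \<alpha> - 1)"
  proof -
    have "3 * a + 3 * poly H 1 = 3 * a * (3 * enorm \<alpha>)"
      using cubic_norm_at_1[OF G] unfolding \<alpha> poly_taylor_1 enorm_mult H poly_add poly_mult by simp
    then have "3 * poly H 1 = 3 * (a * (3 * enorm \<alpha> - 1))" by (simp add: algebra_simps)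
    then show ?thesis by simp
  qed
  moreover have "elam * (cN \<beta> - \<alpha>) = 3 * evp eom H"
  proof -
    have "elam * \<alpha> + 3 * evp eom H = elam * cN \<beta>"
      using cubic_norm_cN[OF G] unfolding \<beta> cN_mult cN_lam H evp_add \<alpha> by simp
    then show ?thesis by (simp add: algebra_simps)
  qed
  ultimately show thesis using that[OF \<alpha>_def \<beta>_def] by blast
qed

lemma eaug_alpha: "[eaug (ecnj elam * x + of_int d + y * elam + elam ^ 2 * z) = d] (mod 3)"
proof -
  have "elam dvd ecnj elam * x + y * elam + elam ^ 2 * z"
  proof -
    have "ecnj elam = elam * (1 + eom)" by (simp add: eis_eq_iff)
    then have "elam dvd ecnj elam" by (metis dvd_triv_left)
    moreover have "elam dvd elam ^ 2" by (simp add: power2_eq_square)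
    ultimately show ?thesis by (intro dvd_add dvd_mult2 dvd_triv_right)
  qed
  then show ?thesis unfolding elam_dvd eaug_def[symmetric] cong_iff_dvd_diff by (simp add: algebra_simps)
qed

lemma lam_2_dvd_nu: "lam ^ 2 dvd nu"
  unfolding lam_power_dvd_iff nu_def emb_def by (simp add: cyc_eval eis_eval power2_eq_square)

lemma lam_dvd_nu: "lam dvd nu"
  using lam_2_dvd_nu by (metis dvd_mult_left power2_eq_square)

lemma aug_beta: "[aug (nu * x + of_int d + y * lam + lam ^ 2 * z) = d] (mod 3)"
proof -
  have "lam dvd nu * x + y * lam + lam ^ 2 * z"
    using lam_dvd_nu by (intro dvd_add dvd_mult2 dvd_triv_right) (simp_all add: power2_eq_square)
  then show ?thesis unfolding lam_dvd cong_iff_dvd_diff by (simp add: algebra_simps)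
qed

lemma three_dvd_enorm: "3 dvd enorm a \<longleftrightarrow> 3 dvd eaug a"
proof -
  have "[enorm a = (eaug a)^2] (mod 3)" using enorm_mod_3[of a] by (simp add: eaug_def cong_iff_dvd_diff)
  then have "3 dvd enorm a \<longleftrightarrow> 3 dvd (eaug a)^2" by (rule cong_dvd_iff)
  then show ?thesis by (simp add: prime_dvd_power_iff)
qed

lemma three_dvd_cnorm_aug: "3 dvd cnorm b \<longleftrightarrow> 3 dvd aug b"
  by (simp add: three_dvd_cnorm lam_dvd)

text \<open>Modulo 9 the norms of \<beta> and \<beta>' differ by 3 h conj(w - 1). If both were
  trivial, 3 would divide h (conj(w - 1) - u (w - 1)) for a cube root of unity u, which fails for
  all three. Only the sign of u saves this: for u = 1 + w the difference is 0.\<close>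

lemma det_case_81:
  assumes "\<not> 3 dvd h" "h = poly H 1" "\<not> lam dvd \<beta>" "\<beta>' = \<beta> + nu * evp zet H"
  shows "\<exists>q. type1 q \<and> q mod 9 = 1 \<and> (q dvd cnorm \<beta> \<or> q dvd cnorm \<beta>')"
proof -
  have "lam dvd evp zet (H - [:h:])" unfolding lam_dvd_evp by (simp add: assms(2))
  then obtain t where t: "evp zet H - of_int h = lam * t" by (auto elim: dvdE)
  have "\<beta>' = \<beta> + of_int h * nu + nu * (evp zet H - of_int h)" unfolding assms(4) by (simp add: algebra_simps)
  also have "\<dots> = \<beta> + of_int h * nu + (lam * nu) * t" unfolding t by (simp add: mult_ac)
  finally have \<beta>': "\<beta>' - (\<beta> + of_int h * nu) = 3 * t" unfolding lam_nu by simp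
  then have "9 dvd cN \<beta>' - cN (\<beta> + of_int h * nu)" by (intro cN_cong) simp
  then have d: "9 dvd cN \<beta>' - (cN \<beta> + 3 * (of_int h * ecnj elam))"
    using cN_add_nu[OF assms(3), of h] by (rule dvd_diff_trans)
  have ne: "\<not> elam dvd cN \<beta>"
    using cong_dvd_iff[OF eaug_cN[of \<beta>]] assms(3) by (simp add: elam_dvd lam_dvd eaug_def)
  have "\<not> (etriv (cN \<beta>) \<and> etriv (cN \<beta>'))"
  proof
    assume "etriv (cN \<beta>) \<and> etriv (cN \<beta>')"
    then obtain u where "u \<in> {Eis 1 0, Eis 0 1, Eis (-1) (-1)}"
      "3 dvd of_int h * ecnj elam - u * ecnj (of_int h * ecnj elam)"
      using etriv_difference[OF _ _ d ne] by blast
    then show False using assms(1) by (auto simp: eis_numeral_dvd) presburger+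
  qed
  moreover have "\<beta> \<noteq> 0" using assms(3) by auto
  moreover have "\<beta>' \<noteq> 0"
  proof
    assume "\<beta>' = 0"
    then have "lam dvd \<beta> + nu * evp zet H" unfolding assms(4)[symmetric] by simp
    then have "lam dvd \<beta> + nu * evp zet H - nu * evp zet H" using lam_dvd_nu by (intro dvd_diff) auto
    then show False using assms(3) by simp
  qed
  ultimately obtain p where "prime (enorm p)" "enorm p mod 9 = 1" "\<not> etriv p"
    "enorm p dvd cnorm \<beta> \<or> enorm p dvd cnorm \<beta>'"
    using nontrivial_cN_prime_divisor by metis
  then show ?thesis using type1_if_nontrivial by blast
qed

text \<open>Here \<open>\<beta>' = \<beta> + 3 * l\<close> and
  \<open>cN \<beta> = \<alpha> + 3 * k\<close>, where k and l come from the Taylor expansion of H.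
  The coefficient \<open>3 * e\<close> makes \<alpha> an integer modulo 3 and \<beta> one modulo
  \<open>lam^2\<close>, so if everything is trivial, k and l are their own conjugates modulo 3 and
  \<open>lam^2\<close>. The first gives h2 = m = -a modulo 3. The second gives 3 | h2, since
  conjugation changes l by h2 (lam - conj lam) modulo \<open>lam^2\<close> and lam - conj lam has
  level 1.\<close>

lemma det_case_243:
  assumes \<alpha>: "\<alpha> = ecomb (3 * a) d (3 * e) A"
    and \<beta>: "\<beta> = ccomb (3 * a) d (3 * e) B"
    and \<beta>': "\<beta>' = \<beta> + nu * evp zet H"
    and H: "poly H 1 = 3 * m" "elam * (cN \<beta> - \<alpha>) = 3 * evp eom H" "3 dvd m + a"
    and "\<not> 3 dvd d" "\<not> 3 dvd a" "\<not> lam dvd \<beta>" "\<beta>' \<noteq> 0" "\<alpha> \<noteq> 0" "\<not> elam dvd \<alpha>"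
  shows "\<exists>q. (type1 q \<or> type3 q) \<and> (q dvd enorm \<alpha> \<or> q dvd cnorm \<beta> \<or> q dvd cnorm \<beta>')"
proof -
  obtain c h1 h2 R where "H = taylor c h1 h2 R" using taylor_exists[of H] unfolding taylor_def[symmetric] by blast
  then have HT: "H = taylor (3 * m) h1 h2 R" using H(1) poly_taylor_1 by metis
  define k where "k = ecomb m h1 h2 (evp eom R)"
  define l where "l = ccomb m h1 h2 (evp zet R)"
  have k: "evp eom H = elam * k" unfolding HT k_def by (rule evp_eom_taylor)
  have l: "evp zet H = lam * l" unfolding HT l_def by (rule evp_zet_taylor)
  have "elam * (cN \<beta> - \<alpha>) = elam * (3 * k)" using H(2) k by (simp add: mult_ac)
  moreover have "elam \<noteq> 0" by (simp add: eis_eq_iff)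
  ultimately have "cN \<beta> - \<alpha> = 3 * k" by (simp only: mult_cancel_left) blast
  then have cN: "cN \<beta> = \<alpha> + 3 * k" by (simp add: algebra_simps)
  have "\<beta>' = \<beta> + (lam * nu) * l" unfolding \<beta>' l by (simp add: mult_ac)
  then have \<beta>'': "\<beta>' = \<beta> + 3 * l" unfolding lam_nu .
  have "\<beta> \<noteq> 0" using assms(9) by auto
  consider "\<not> etriv \<alpha>" | "\<not> etriv (cN \<beta>)" | "\<not> ctriv \<beta>" | "\<not> ctriv \<beta>'"
    | "etriv \<alpha>" "etriv (cN \<beta>)" "ctriv \<beta>" "ctriv \<beta>'" by blast
  then show ?thesis
  proof cases
    case 1
    then show ?thesis using eis_nontrivial_prime_divisor \<open>\<alpha> \<noteq> 0\<close> type1_if_nontrivial by blast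
  next
    case 2
    then show ?thesis using nontrivial_cN_prime_divisor \<open>\<beta> \<noteq> 0\<close> type1_if_nontrivial by blast
  next
    case 3
    then show ?thesis using nontrivial_prime_divisor[OF \<open>\<beta> \<noteq> 0\<close>] type1_if_nontrivial unfolding type3_iff by blast
  next
    case 4
    then show ?thesis using nontrivial_prime_divisor[OF \<open>\<beta>' \<noteq> 0\<close>] type1_if_nontrivial unfolding type3_iff by blast
  next
    case 5
    have e2: "elam ^ 2 = 3 * (- eom)" by (simp add: eis_eq_iff power2_eq_square)
    obtain u where u: "u \<in> {Eis 1 0, Eis 0 1, Eis (-1) (-1)}" "9 dvd \<alpha> - u * ecnj \<alpha>" "3 dvd k - u * ecnj k"
      using etriv_difference[OF 5(1,2) _ assms(12), of k] unfolding cN by auto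
    have "\<alpha> - of_int d = 3 * (ecnj elam * of_int a + of_int e * elam - eom * A)"
      unfolding \<alpha> e2 by (simp add: algebra_simps)
    then have \<alpha>3: "3 dvd \<alpha> - of_int d" by simp
    then have "3 dvd ecnj \<alpha> - of_int d" using ecnj_dvd[of 3 "\<alpha> - of_int d"] by simp
    then have u\<alpha>: "3 dvd u * (ecnj \<alpha> - of_int d)" by (rule dvd_mult)
    have "3 dvd \<alpha> - u * ecnj \<alpha>" using u(2) by (rule dvd_trans[rotated]) (simp add: eis_numeral_dvd)
    then have "3 dvd (\<alpha> - u * ecnj \<alpha>) - (\<alpha> - of_int d) + u * (ecnj \<alpha> - of_int d)"
      by (rule dvd_add[OF dvd_diff[OF _ \<alpha>3] u\<alpha>])
    then have "3 dvd (1 - u) * of_int d" by (simp add: algebra_simps)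
    then have "u = 1" using u(1) assms(7) by (auto simp: eis_numeral_dvd eis_eq_iff)
    then have "3 dvd e1 (k - ecnj k)" using u(3) by (simp add: eis_numeral_dvd)
    moreover have "e1 (k - ecnj k) = 2 * (h2 - m) + 3 * (2 * e1 (- eom * evp eom R))"
      unfolding k_def e2 by (simp add: power2_eq_square algebra_simps)
    ultimately have "3 dvd 2 * (h2 - m)" by (simp only: dvd_add_left_iff dvd_triv_left)
    then have nh2: "\<not> 3 dvd h2" using H(3) assms(8) by presburger
    have "lam ^ 2 dvd 3" using lam_6_dvd_3 by (rule dvd_trans[rotated]) (simp add: le_imp_power_dvd)
    then have "lam ^ 2 dvd nu * of_int (3 * a) + of_int (3 * e) * lam + lam ^ 2 * B"
      using lam_2_dvd_nu by (intro dvd_add) (auto intro: dvd_mult2)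
    then have "lam ^ 2 dvd \<beta> - of_int d" unfolding \<beta> by (simp add: algebra_simps)
    then have "lam ^ 2 dvd l - ccnj l"
      using ctriv_difference[OF 5(3) 5(4)[unfolded \<beta>'']] assms(7) by blast
    moreover have "lam ^ 2 dvd ccnj nu" "lam ^ 2 dvd ccnj (lam ^ 2 * evp zet R)"
      using lam_2_dvd_nu by (intro lam_power_dvd_ccnj; simp)+
    moreover have "l - ccnj l = (nu * of_int m + lam ^ 2 * evp zet R) - (ccnj nu * of_int m + ccnj (lam ^ 2 * evp zet R))
        + of_int h2 * (lam - ccnj lam)"
      unfolding l_def by (simp add: algebra_simps)
    ultimately have "lam ^ 2 dvd ((nu * of_int m + lam ^ 2 * evp zet R) - (ccnj nu * of_int m + ccnj (lam ^ 2 * evp zet R))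
        + of_int h2 * (lam - ccnj lam)) - ((nu * of_int m + lam ^ 2 * evp zet R) - (ccnj nu * of_int m + ccnj (lam ^ 2 * evp zet R)))"
      using lam_2_dvd_nu by (intro dvd_diff[OF _ dvd_diff[OF dvd_add dvd_add]]) (auto intro: dvd_mult2)
    then have "lam ^ 2 dvd of_int h2 * (lam - ccnj lam)" by simp
    then have "3 ^ 2 dvd h2 ^ 6 * cnorm (lam - ccnj lam)" by (simp only: lam_power_dvd_iff cnorm_mult cnorm_simps)
    moreover have "cnorm (lam - ccnj lam) = 3" by (simp add: cyc_eval eis_eval)
    ultimately obtain j where "h2 ^ 6 * 3 = 3 ^ 2 * j" by (auto elim: dvdE)
    then have "h2 ^ 6 = 3 * j" by simp
    then have "3 dvd h2 ^ 6" by simp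
    then show ?thesis using nh2 by (simp add: prime_dvd_power_iff)
  qed
qed

lemma S27_converse:
  assumes "n \<in> S27" "3 dvd n" "\<not> 3 ^ 6 dvd n"
  shows "(\<exists>m q. n = 3 ^ 4 * m * q \<and> \<not> 3 dvd m \<and> type1 q \<and> q mod 9 = 1) \<or>
    (\<exists>m q. n = 3 ^ 5 * m * q \<and> \<not> 3 dvd m \<and> (type1 q \<or> type3 q))"
proof -
  obtain c d e where D: "det_datum n c d e" using S27_datum[OF assms(1)] by blast
  have "3 dvd c"
  proof (rule ccontr)
    assume nc: "\<not> 3 dvd c"
    obtain R G where G: "cubic_norm (taylor c d e R) G" and n: "n = c *
        enorm (evp eom (taylor c d e R)) * cnorm (evp zet (taylor c d e R)) * cnorm (evp zet G)"
      using D unfolding det_datum_def by blast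
    obtain H where "G = taylor c d e R + 3 * H" using cubic_norm_cong_3[OF G] by blast
    then have "poly G 1 = c + 3 * poly H 1" by (simp add: poly_taylor_1)
    then have "\<not> 3 dvd poly G 1" using nc by presburger
    then have "\<not> 3 dvd n" unfolding n using nc
      by (simp add: prime_dvd_mult_iff three_dvd_enorm three_dvd_cnorm_aug
          cong_dvd_iff[OF eaug_evp] cong_dvd_iff[OF aug_evp] poly_taylor_1)
    then show False using assms(2) by simp
  qed
  then obtain a where a: "c = 3 * a" by (auto elim: dvdE)
  \<comment> \<open>Modulo the primes above 3 both \<alpha> and \<beta> reduce to d, so 3 | d would
    add two factors 3 to 3^4.\<close>
  have nd: "\<not> 3 dvd d" if D: "det_datum n (3 * a) d e" for d e
  proof
    assume d: "3 dvd d"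
    obtain \<alpha> \<beta> A B H where \<alpha>: "\<alpha> = ecomb a d e A" and \<beta>: "\<beta> = ccomb a d e B"
      and n: "n = 3 ^ 4 * a * (enorm \<alpha> * cnorm \<beta> * cnorm (\<beta> + nu * evp zet H))"
      by (rule det_datum_factors[OF D])
    have "3 dvd enorm \<alpha>" unfolding three_dvd_enorm \<alpha> using cong_dvd_iff[OF eaug_alpha] d by blast
    moreover have "3 dvd cnorm \<beta>" unfolding three_dvd_cnorm_aug \<beta> using cong_dvd_iff[OF aug_beta] d by blast
    ultimately have "3 ^ 4 * 1 * (3 * 3 * 1) dvd n" unfolding n by (intro mult_dvd_mono) auto
    then show False using assms(3) by simp
  qed
  obtain d e' where D': "det_datum n (3 * a) d e'" "3 dvd e'"
    using det_datum_normalise[OF D[unfolded a] _ nd[OF D[unfolded a]]] by auto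
  obtain e where e: "e' = 3 * e" using D'(2) by (auto elim: dvdE)
  have d: "\<not> 3 dvd d" using nd[OF D'(1)] .
  obtain \<alpha> \<beta> A B H where \<alpha>0: "\<alpha> = ecomb a d (3 * e) A" and \<beta>0: "\<beta> = ccomb a d (3 * e) B"
    and n: "n = 3 ^ 4 * a * (enorm \<alpha> * cnorm \<beta> * cnorm (\<beta> + nu * evp zet H))"
    and H: "poly H 1 = a * (3 * enorm \<alpha> - 1)" and cN: "elam * (cN \<beta> - \<alpha>) = 3 * evp eom H"
    by (rule det_datum_factors[OF D'(1)[unfolded e]])
  define \<beta>' where "\<beta>' = \<beta> + nu * evp zet H"
  have "\<not> 3 dvd eaug \<alpha>" using cong_dvd_iff[OF eaug_alpha] d unfolding \<alpha>0 by blast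
  then have \<alpha>: "\<not> elam dvd \<alpha>" "\<not> 3 dvd enorm \<alpha>" by (simp_all add: three_dvd_enorm elam_dvd eaug_def)
  have "\<not> 3 dvd aug \<beta>" using cong_dvd_iff[OF aug_beta] d unfolding \<beta>0 by blast
  then have \<beta>: "\<not> lam dvd \<beta>" by (simp add: lam_dvd)
  have \<beta>': "\<not> lam dvd \<beta>'"
    unfolding \<beta>'_def using \<beta> lam_dvd_nu by (simp add: dvd_add_left_iff)
  define X where "X = enorm \<alpha> * cnorm \<beta> * cnorm \<beta>'"
  have X: "\<not> 3 dvd X" using \<alpha> \<beta> \<beta>' by (simp add: X_def prime_dvd_mult_iff three_dvd_cnorm)
  have nX: "n = 3 ^ 4 * a * X" unfolding n X_def \<beta>'_def ..
  have split: "\<exists>m. X = m * q \<and> \<not> 3 dvd m" if "q dvd X" for q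
    using that X by (auto elim!: dvdE)
  show ?thesis
  proof (cases "3 dvd a")
    case False
    moreover have "\<not> 3 dvd 3 * enorm \<alpha> - 1" by presburger
    moreover have "prime (3 :: int)" by simp
    ultimately have "\<not> 3 dvd a * (3 * enorm \<alpha> - 1)" using prime_dvd_mult_iff by blast
    then obtain q where q: "type1 q" "q mod 9 = 1" "q dvd X"
      using det_case_81[OF _ H[symmetric] \<beta> \<beta>'_def] unfolding X_def by (meson dvd_mult dvd_mult2)
    obtain m where m: "X = m * q" "\<not> 3 dvd m" using split q(3) by blast
    have "n = 3 ^ 4 * (a * m) * q" "\<not> 3 dvd a * m" using nX m False by (simp_all add: prime_dvd_mult_iff)
    then show ?thesis using q by blast
  next
    case True
    then obtain b where b: "a = 3 * b" by (auto elim: dvdE)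
    have nb: "\<not> 3 dvd b"
    proof
      assume "3 dvd b"
      then have "3 ^ 4 * (3 * 3) * 1 dvd 3 ^ 4 * (3 * b) * X" by (intro mult_dvd_mono) auto
      then show False using assms(3) unfolding nX b by simp
    qed
    have "\<exists>q. (type1 q \<or> type3 q) \<and> (q dvd enorm \<alpha> \<or> q dvd cnorm \<beta> \<or> q dvd cnorm \<beta>')"
    proof (rule det_case_243[OF \<alpha>0[unfolded b] \<beta>0[unfolded b] \<beta>'_def])
      show "poly H 1 = 3 * (b * (3 * enorm \<alpha> - 1))" using H b by simp
      show "3 dvd b * (3 * enorm \<alpha> - 1) + b" by (simp add: algebra_simps)
      show "\<beta>' \<noteq> 0" "\<alpha> \<noteq> 0" using \<alpha>(1) \<beta>' by auto
    qed (use cN d nb \<beta> \<alpha> in auto)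
    then obtain q where q: "type1 q \<or> type3 q" "q dvd X" unfolding X_def by (meson dvd_mult dvd_mult2)
    obtain m where m: "X = m * q" "\<not> 3 dvd m" using split q(2) by blast
    have "n = 3 ^ 5 * (b * m) * q" "\<not> 3 dvd b * m" using nX m nb b by (simp_all add: prime_dvd_mult_iff)
    then show ?thesis using q by blast
  qed
qed

theorem theorem1p3:
  shows "S27 = {n. coprime n 3}
             \<union> {n. 3 ^ 6 dvd n}
             \<union> {3 ^ 4 * m * q | m q. \<not> 3 dvd m \<and> type1 q \<and> q mod 9 = 1}
             \<union> {3 ^ 5 * m * q | m q. \<not> 3 dvd m \<and>
                   ((type1 q \<and> q mod 3 = 1) \<or> (type3 q \<and> q mod 9 = 1))}"
proof -
  have cop: "coprime n 3 \<longleftrightarrow> \<not> 3 dvd n" for n :: int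
    using prime_imp_coprime[of 3 n] by (auto simp: coprime_commute)
  have mult: "c * m * q \<in> S27" if "c * q \<in> S27" "\<not> 3 dvd m" for c m q
    using S27_mult[OF that(1) S27_coprime[OF that(2)]] by (simp add: mult_ac)
  have "n \<in> S27 \<longleftrightarrow> coprime n 3 \<or> 3 ^ 6 dvd n
      \<or> (\<exists>m q. n = 3 ^ 4 * m * q \<and> \<not> 3 dvd m \<and> type1 q \<and> q mod 9 = 1)
      \<or> (\<exists>m q. n = 3 ^ 5 * m * q \<and> \<not> 3 dvd m \<and> (type1 q \<or> type3 q))" (is "_ \<longleftrightarrow> ?A \<or> ?B \<or> ?C \<or> ?D") for n
  proof
    assume "n \<in> S27"
    then show "?A \<or> ?B \<or> ?C \<or> ?D" using S27_converse[of n] cop[of n] by blast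
  next
    have "n \<in> S27" if ?B using that S27_multiple_729 by (auto elim!: dvdE)
    moreover have "n \<in> S27" if ?C using that mult S27_type1_81 by blast
    moreover have "n \<in> S27" if ?D using that mult S27_type1_243 S27_type3_243 by blast
    ultimately show "n \<in> S27" if "?A \<or> ?B \<or> ?C \<or> ?D" using that cop S27_coprime by blast
  qed
  moreover have "type1 q \<Longrightarrow> q mod 3 = 1" "type3 q \<Longrightarrow> q mod 9 = 1" for q
    by (simp_all add: type1_iff type3_iff)
  ultimately show ?thesis by blast
qed

end
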